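(* Let $H$ be a finite-dimensional Hopf algebra over $k$, and let $H\text{-mod}$ be the finite tensor category of finite-dimensional left $H$-modules. Then $H$ is cosemisimple and unimodular if and only if $H\text{-mod}$ has the property CU.
   Context: Setting. $k$ is an algebraically closed field of arbitrary characteristic. A finite-dimensional Hopf algebra $H$ is cosemisimple if it is semisimple as a coalgebra, and unimodular if its spaces of left integrals $\{\Lambda \in H : h\Lambda = \varepsilon(h)\Lambda \ \forall h\}$ and right integrals $\{\Lambda \in H : \Lambda h = \varepsilon(h)\Lambda \ \forall h\}$ coincide. A finite abelian category over $k$ is a $k$-linear category equivalent to the category of finite-dimensional left modules over a finite-dimensional $k$-algebra. A finite tensor category over $k$ is a rigid monoidal category $\mathcal{C}$ (regarded as strict, with unit object $\mathbf{1}$) that is a finite abelian category over $k$, whose tensor product is $k$-linear in each variable, and whose unit object is simple. The left dual of $X$ is $(X^*, \mathrm{ev}_X: X^* \otimes X \to \mathbf{1}, \mathrm{coev}_X: \mathbf{1} \to X \otimes X^* )$. Central Hopf comonad of a finite tensor category $\mathcal{C}$. For $V \in \mathcal{C}$ the end $\mathsf{Z}(V) = \int_{X \in \mathcal{C}} X \otimes V \otimes X^*$ exists; let $\pi_{V;X}: \mathsf{Z}(V) \to X \otimes V \otimes X^*$ be its universal dinatural transformation. $\mathsf{Z}$ is an endofunctor of $\mathcal{C}$ such that $\pi_{V;X}$ is natural in $V$. Let $\delta_V: \mathsf{Z}(V) \to \mathsf{Z}^2(V)$ be determined by $(\mathrm{id}_X \otimes \pi_{V;Y} \otimes \mathrm{id}_{X^*})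 \circ \pi_{\mathsf{Z}(V);X} \circ \delta_V = \pi_{V;X\otimes Y}$, and $\mathsf{u}: \mathbf{1} \to \mathsf{Z}(\mathbf{1})$ by $\pi_{\mathbf{1};X} \circ \mathsf{u} = \mathrm{coev}_X$, for all $V,X,Y \in \mathcal{C}$. Modular object. Let $\mathsf{R}: \mathcal{C} \to \mathcal{Z}(\mathcal{C})$ be a right adjoint of the forgetful functor $\mathsf{U}$ from the Drinfeld center $\mathcal{Z}(\mathcal{C})$ to $\mathcal{C}$ (one has $\mathsf{Z} = \mathsf{U}\mathsf{R}$). The modular object $\alpha$ of $\mathcal{C}$ is the unique (up to isomorphism) simple object of $\mathcal{C}$ with $\mathrm{Hom}_{\mathcal{Z}(\mathcal{C})}(\mathsf{R}(\alpha), \mathbf{1}) \neq 0$; it is invertible. $\mathcal{C}$ is called unimodular if $\alpha \cong \mathbf{1}$. A categorical cointegral of $\mathcal{C}$ is a morphism $\lambda: \mathsf{Z}(\alpha) \to \mathbf{1}$ in $\mathcal{C}$ with $\mathsf{Z}(\lambda) \circ \delta_{\alpha} = \mathsf{u} \circ \lambda$; the space of these is one-dimensional. Property CU. Let $\lambda$ be a non-zero categorical cointegral of $\mathcal{C}$. $\mathcal{C}$ has the property CU if $\mathcal{C}$ is unimodular and the composition $\mathbf{1} \xrightarrow{\mathsf{u}} \mathsf{Z}(\mathbf{1}) \xrightarrow{\cong} \mathsf{Z}(\alpha) \xrightarrow{\lambda} \mathbf{1}$ is non-zero, where the second arrow is $\mathsf{Z}$ applied to an isomorphism $\mathbf{1}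 \cong \alpha$. *)

theory Defs
  imports
    "HOL-Library.FuncSet"
    "HOL-Library.Poly_Mapping"
    "HOL-Computational_Algebra.Computational_Algebra"
    "Jordan_Normal_Form.Matrix"
begin

section \<open>Tensors as formal linear combinations\<close>

text \<open>
  The type \<open>'p \<Rightarrow>\<^sub>0 'k\<close> is the free vector space on \<open>'p\<close>. The tensor powers of a vector space \<open>H\<close>
  are the usual quotients: an element of \<open>H \<otimes> H\<close> is given by a formal linear combination of pairs,
  an element of \<open>H \<otimes> H \<otimes> H\<close> by one of triples, and two of them denote the same tensor iff they
  differ by an element of the span of the multilinearity relations. A ``slot'' is a map inserting
  a vector at one position of a tuple whose other entries are fixed.
\<close>

definition formal_scale :: "'k::field \<Rightarrow> ('p \<Rightarrow>\<^sub>0 'k) \<Rightarrow> ('p \<Rightarrow>\<^sub>0 'k)" where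
  "formal_scale c t = Poly_Mapping.map ((*) c) t"

definition linear_extension ::
    "('k::field \<Rightarrow> 'v \<Rightarrow> 'v) \<Rightarrow> ('p \<Rightarrow> 'v) \<Rightarrow> ('p \<Rightarrow>\<^sub>0 'k) \<Rightarrow> 'v::ab_group_add" where
  "linear_extension s F t = (\<Sum>p\<in>Poly_Mapping.keys t. s (Poly_Mapping.lookup t p) (F p))"

definition multilinear_relations ::
    "('k::field \<Rightarrow> 'h \<Rightarrow> 'h::ab_group_add) \<Rightarrow> ('h \<Rightarrow> 'p) set \<Rightarrow> ('p \<Rightarrow>\<^sub>0 'k) set" where
  "multilinear_relations scale slots =
     (\<Union>\<iota>\<in>slots.
        {Poly_Mapping.single (\<iota> (x + y)) 1
           - Poly_Mapping.single (\<iota> x) 1 - Poly_Mapping.single (\<iota> y) 1 | x y. True}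
      \<union> {Poly_Mapping.single (\<iota> (scale c x)) 1 - Poly_Mapping.single (\<iota> x) c | c x. True})"

definition slots2 :: "('h \<Rightarrow> 'h \<times> 'h) set" where
  "slots2 = (\<Union>z. {\<lambda>x. (x, z), \<lambda>x. (z, x)})"

definition slots3 :: "('h \<Rightarrow> 'h \<times> 'h \<times> 'h) set" where
  "slots3 = (\<Union>y z. {\<lambda>x. (x, y, z), \<lambda>x. (y, x, z), \<lambda>x. (y, z, x)})"

definition tensor2_eq ::
    "('k::field \<Rightarrow> 'h \<Rightarrow> 'h::ab_group_add) \<Rightarrow> ('h \<times> 'h \<Rightarrow>\<^sub>0 'k) \<Rightarrow> ('h \<times> 'h \<Rightarrow>\<^sub>0 'k) \<Rightarrow> bool" where
  "tensor2_eq scale s t \<longleftrightarrow> s - t \<in> module.span formal_scale (multilinear_relations scale slots2)"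

definition tensor3_eq ::
    "('k::field \<Rightarrow> 'h \<Rightarrow> 'h::ab_group_add) \<Rightarrow>
     ('h \<times> 'h \<times> 'h \<Rightarrow>\<^sub>0 'k) \<Rightarrow> ('h \<times> 'h \<times> 'h \<Rightarrow>\<^sub>0 'k) \<Rightarrow> bool" where
  "tensor3_eq scale s t \<longleftrightarrow> s - t \<in> module.span formal_scale (multilinear_relations scale slots3)"


section \<open>Hopf algebras\<close>

text \<open>
  The underlying ring is the type \<open>'h\<close>. The formal combination \<open>\<Delta> x\<close> represents the comultiplication
  of \<open>x\<close>; so all laws for \<open>\<Delta>\<close> hold up to equality of tensors. The requirement \<open>0 \<noteq> 1\<close> of
  \<^class>\<open>ring_1\<close> is no restriction, since \<open>\<epsilon> 1 = 1\<close>.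
\<close>

locale hopf_algebra = vector_space scale
  for scale :: "'k::field \<Rightarrow> 'h::ring_1 \<Rightarrow> 'h" +
  fixes \<Delta> :: "'h \<Rightarrow> ('h \<times> 'h \<Rightarrow>\<^sub>0 'k)"
    and \<epsilon> :: "'h \<Rightarrow> 'k"
    and S :: "'h \<Rightarrow> 'h"
  assumes scale_mult_left: "scale c x * y = scale c (x * y)"
    and scale_mult_right: "x * scale c y = scale c (x * y)"
    and comult_add: "tensor2_eq scale (\<Delta> (x + y)) (\<Delta> x + \<Delta> y)"
    and comult_scale: "tensor2_eq scale (\<Delta> (scale c x)) (formal_scale c (\<Delta> x))"
    and counit_linear: "Vector_Spaces.linear scale (*) \<epsilon>"
    and coassoc: "tensor3_eq scale
          (linear_extension formal_scale
             (\<lambda>(a, b). linear_extension formal_scale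
                         (\<lambda>(a1, a2). Poly_Mapping.single (a1, a2, b) 1) (\<Delta> a)) (\<Delta> x))
          (linear_extension formal_scale
             (\<lambda>(a, b). linear_extension formal_scale
                         (\<lambda>(b1, b2). Poly_Mapping.single (a, b1, b2) 1) (\<Delta> b)) (\<Delta> x))"
    and counit_left: "linear_extension scale (\<lambda>(a, b). scale (\<epsilon> a) b) (\<Delta> x) = x"
    and counit_right: "linear_extension scale (\<lambda>(a, b). scale (\<epsilon> b) a) (\<Delta> x) = x"
    and comult_one: "tensor2_eq scale (\<Delta> 1) (Poly_Mapping.single (1, 1) 1)"
    and comult_mult: "tensor2_eq scale (\<Delta> (x * y))
          (linear_extension formal_scale
             (\<lambda>(a, b). linear_extension formal_scale
                         (\<lambda>(c, d). Poly_Mapping.single (a * c, b * d) 1) (\<Delta> y)) (\<Delta> x))"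
    and counit_one: "\<epsilon> 1 = 1"
    and counit_mult: "\<epsilon> (x * y) = \<epsilon> x * \<epsilon> y"
    and antipode_linear: "Vector_Spaces.linear scale scale S"
    and antipode_left: "linear_extension scale (\<lambda>(a, b). S a * b) (\<Delta> x) = scale (\<epsilon> x) 1"
    and antipode_right: "linear_extension scale (\<lambda>(a, b). a * S b) (\<Delta> x) = scale (\<epsilon> x) 1"

definition finite_dimensional :: "('k::field \<Rightarrow> 'v \<Rightarrow> 'v::ab_group_add) \<Rightarrow> bool" where
  "finite_dimensional scale \<longleftrightarrow> (\<exists>B. finite B \<and> module.span scale B = UNIV)"

definition subcoalgebra ::
    "('k::field \<Rightarrow> 'h \<Rightarrow> 'h::ab_group_add) \<Rightarrow> ('h \<Rightarrow> ('h \<times> 'h \<Rightarrow>\<^sub>0 'k)) \<Rightarrow> 'h set \<Rightarrow> bool" where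
  "subcoalgebra scale \<Delta> D \<longleftrightarrow>
     module.subspace scale D \<and>
     (\<forall>x\<in>D. \<exists>t. Poly_Mapping.keys t \<subseteq> D \<times> D \<and> tensor2_eq scale (\<Delta> x) t)"

definition simple_subcoalgebra ::
    "('k::field \<Rightarrow> 'h \<Rightarrow> 'h::ab_group_add) \<Rightarrow> ('h \<Rightarrow> ('h \<times> 'h \<Rightarrow>\<^sub>0 'k)) \<Rightarrow> 'h set \<Rightarrow> bool" where
  "simple_subcoalgebra scale \<Delta> D \<longleftrightarrow>
     subcoalgebra scale \<Delta> D \<and> D \<noteq> {0} \<and>
     (\<forall>E. subcoalgebra scale \<Delta> E \<and> E \<subseteq> D \<longrightarrow> E = {0} \<or> E = D)"

text \<open>A coalgebra is semisimple if it is the sum of its simple subcoalgebras, i.e.\ equals its coradical.\<close>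

definition cosemisimple ::
    "('k::field \<Rightarrow> 'h \<Rightarrow> 'h::ab_group_add) \<Rightarrow> ('h \<Rightarrow> ('h \<times> 'h \<Rightarrow>\<^sub>0 'k)) \<Rightarrow> bool" where
  "cosemisimple scale \<Delta> \<longleftrightarrow> module.span scale (\<Union>{D. simple_subcoalgebra scale \<Delta> D}) = UNIV"

definition left_integrals :: "('k \<Rightarrow> 'h \<Rightarrow> 'h) \<Rightarrow> ('h \<Rightarrow> 'k) \<Rightarrow> 'h::ring_1 set" where
  "left_integrals scale \<epsilon> = {\<Lambda>. \<forall>h. h * \<Lambda> = scale (\<epsilon> h) \<Lambda>}"

definition right_integrals :: "('k \<Rightarrow> 'h \<Rightarrow> 'h) \<Rightarrow> ('h \<Rightarrow> 'k) \<Rightarrow> 'h::ring_1 set" where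
  "right_integrals scale \<epsilon> = {\<Lambda>. \<forall>h. \<Lambda> * h = scale (\<epsilon> h) \<Lambda>}"

definition unimodular_hopf :: "('k \<Rightarrow> 'h::ring_1 \<Rightarrow> 'h) \<Rightarrow> ('h \<Rightarrow> 'k) \<Rightarrow> bool" where
  "unimodular_hopf scale \<epsilon> \<longleftrightarrow> left_integrals scale \<epsilon> = right_integrals scale \<epsilon>"


section \<open>Categories, functors, adjunctions\<close>

text \<open>
  Morphism sets need not be disjoint, so identities, zero morphisms, and the action of a functor on
  morphisms take the objects as arguments.
\<close>

record ('o, 'm) category =
  obj :: "'o set"
  mor :: "'o \<Rightarrow> 'o \<Rightarrow> 'm set"
  cmp :: "'m \<Rightarrow> 'm \<Rightarrow> 'm"  (infixr \<open>\<cdot>\<index>\<close> 65)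
  idt :: "'o \<Rightarrow> 'm"
  zer :: "'o \<Rightarrow> 'o \<Rightarrow> 'm"

definition iso_morphism :: "('o, 'm, 'x) category_scheme \<Rightarrow> 'o \<Rightarrow> 'o \<Rightarrow> 'm \<Rightarrow> bool" where
  "iso_morphism C X Y f \<longleftrightarrow>
     f \<in> mor C X Y \<and> (\<exists>g\<in>mor C Y X. g \<cdot>\<^bsub>C\<^esub> f = idt C X \<and> f \<cdot>\<^bsub>C\<^esub> g = idt C Y)"

definition isomorphic_objects :: "('o, 'm, 'x) category_scheme \<Rightarrow> 'o \<Rightarrow> 'o \<Rightarrow> bool" where
  "isomorphic_objects C X Y \<longleftrightarrow> (\<exists>f. iso_morphism C X Y f)"

definition monomorphism :: "('o, 'm, 'x) category_scheme \<Rightarrow> 'o \<Rightarrow> 'o \<Rightarrow> 'm \<Rightarrow> bool" where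
  "monomorphism C X Y f \<longleftrightarrow>
     f \<in> mor C X Y \<and>
     (\<forall>W\<in>obj C. \<forall>g\<in>mor C W X. \<forall>h\<in>mor C W X. f \<cdot>\<^bsub>C\<^esub> g = f \<cdot>\<^bsub>C\<^esub> h \<longrightarrow> g = h)"

definition simple_object :: "('o, 'm, 'x) category_scheme \<Rightarrow> 'o \<Rightarrow> bool" where
  "simple_object C X \<longleftrightarrow>
     X \<in> obj C \<and> idt C X \<noteq> zer C X X \<and>
     (\<forall>Y\<in>obj C. \<forall>f. monomorphism C Y X f \<longrightarrow> f = zer C Y X \<or> iso_morphism C Y X f)"

record ('o, 'm, 'p, 'n) functor_data =
  fobj :: "'o \<Rightarrow> 'p"
  fmor :: "'o \<Rightarrow> 'o \<Rightarrow> 'm \<Rightarrow> 'n"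

definition is_functor ::
    "('o, 'm, 'x) category_scheme \<Rightarrow> ('p, 'n, 'y) category_scheme \<Rightarrow>
     ('o, 'm, 'p, 'n) functor_data \<Rightarrow> bool" where
  "is_functor C D F \<longleftrightarrow>
     (\<forall>X\<in>obj C. fobj F X \<in> obj D \<and> fmor F X X (idt C X) = idt D (fobj F X)) \<and>
     (\<forall>X\<in>obj C. \<forall>Y\<in>obj C. \<forall>f\<in>mor C X Y. fmor F X Y f \<in> mor D (fobj F X) (fobj F Y)) \<and>
     (\<forall>X\<in>obj C. \<forall>Y\<in>obj C. \<forall>W\<in>obj C. \<forall>f\<in>mor C X Y. \<forall>g\<in>mor C Y W.
        fmor F X W (g \<cdot>\<^bsub>C\<^esub> f) = fmor F Y W g \<cdot>\<^bsub>D\<^esub> fmor F X Y f)"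

text \<open>\<open>F : C \<rightarrow> D\<close> is left adjoint to \<open>G : D \<rightarrow> C\<close>, expressed by unit, counit, and triangle identities.\<close>

definition adjoint_functors ::
    "('o, 'm, 'x) category_scheme \<Rightarrow> ('p, 'n, 'y) category_scheme \<Rightarrow>
     ('o, 'm, 'p, 'n) functor_data \<Rightarrow> ('p, 'n, 'o, 'm) functor_data \<Rightarrow> bool" where
  "adjoint_functors C D F G \<longleftrightarrow>
     is_functor C D F \<and> is_functor D C G \<and>
     (\<exists>\<eta> e.
        (\<forall>X\<in>obj C. \<eta> X \<in> mor C X (fobj G (fobj F X))) \<and>
        (\<forall>X\<in>obj C. \<forall>Y\<in>obj C. \<forall>f\<in>mor C X Y.
           fmor G (fobj F X) (fobj F Y) (fmor F X Y f) \<cdot>\<^bsub>C\<^esub> \<eta> X = \<eta> Y \<cdot>\<^bsub>C\<^esub> f) \<and>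
        (\<forall>V\<in>obj D. e V \<in> mor D (fobj F (fobj G V)) V) \<and>
        (\<forall>V\<in>obj D. \<forall>W\<in>obj D. \<forall>f\<in>mor D V W.
           f \<cdot>\<^bsub>D\<^esub> e V = e W \<cdot>\<^bsub>D\<^esub> fmor F (fobj G V) (fobj G W) (fmor G V W f)) \<and>
        (\<forall>X\<in>obj C.
           e (fobj F X) \<cdot>\<^bsub>D\<^esub> fmor F X (fobj G (fobj F X)) (\<eta> X) = idt D (fobj F X)) \<and>
        (\<forall>V\<in>obj D.
           fmor G (fobj F (fobj G V)) V (e V) \<cdot>\<^bsub>C\<^esub> \<eta> (fobj G V) = idt C (fobj G V)))"


section \<open>Property CU\<close>

text \<open>
  The data of a strict monoidal category with zero morphisms and a chosen left dual
  \<open>(X\<^sup>*, ev\<^sub>X : X\<^sup>* \<otimes> X \<rightarrow> 1, coev\<^sub>X : 1 \<rightarrow> X \<otimes> X\<^sup>*)\<close> for each object. The definitions of this section are meant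
  for finite tensor categories. The tensor product is \<open>\<boxdot>\<close> on objects and \<open>\<boxtimes>\<close> on morphisms.
\<close>

record ('o, 'm) tensor_category = "('o, 'm) category" +
  tens :: "'o \<Rightarrow> 'o \<Rightarrow> 'o"  (infixr \<open>\<boxdot>\<index>\<close> 75)
  tensm :: "'m \<Rightarrow> 'm \<Rightarrow> 'm"  (infixr \<open>\<boxtimes>\<index>\<close> 75)
  unt :: "'o"
  ldual :: "'o \<Rightarrow> 'o"
  ev :: "'o \<Rightarrow> 'm"
  coev :: "'o \<Rightarrow> 'm"

text \<open>The dual \<open>f\<^sup>* : Y\<^sup>* \<rightarrow> X\<^sup>*\<close> of \<open>f : X \<rightarrow> Y\<close>.\<close>

definition dual_map :: "('o, 'm, 'x) tensor_category_scheme \<Rightarrow> 'o \<Rightarrow> 'o \<Rightarrow> 'm \<Rightarrow> 'm" where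
  "dual_map C X Y f =
     (ev C Y \<boxtimes>\<^bsub>C\<^esub> idt C (ldual C X))
     \<cdot>\<^bsub>C\<^esub> (idt C (ldual C Y) \<boxtimes>\<^bsub>C\<^esub> f \<boxtimes>\<^bsub>C\<^esub> idt C (ldual C X))
     \<cdot>\<^bsub>C\<^esub> (idt C (ldual C Y) \<boxtimes>\<^bsub>C\<^esub> coev C X)"

text \<open>
  The canonical isomorphism \<open>(X \<otimes> Y)\<^sup>* \<rightarrow> Y\<^sup>* \<otimes> X\<^sup>*\<close>, usually suppressed in writing; the chosen duals
  need not satisfy \<open>(X \<otimes> Y)\<^sup>* = Y\<^sup>* \<otimes> X\<^sup>*\<close>.
\<close>

definition dual_tens :: "('o, 'm, 'x) tensor_category_scheme \<Rightarrow> 'o \<Rightarrow> 'o \<Rightarrow> 'm" where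
  "dual_tens C X Y =
     (ev C (X \<boxdot>\<^bsub>C\<^esub> Y) \<boxtimes>\<^bsub>C\<^esub> idt C (ldual C Y \<boxdot>\<^bsub>C\<^esub> ldual C X))
     \<cdot>\<^bsub>C\<^esub> (idt C (ldual C (X \<boxdot>\<^bsub>C\<^esub> Y)) \<boxtimes>\<^bsub>C\<^esub>
           ((idt C X \<boxtimes>\<^bsub>C\<^esub> coev C Y \<boxtimes>\<^bsub>C\<^esub> idt C (ldual C X)) \<cdot>\<^bsub>C\<^esub> coev C X))"

subsection \<open>Drinfeld center and modular object\<close>

definition half_braiding ::
    "('o, 'm, 'x) tensor_category_scheme \<Rightarrow> 'o \<Rightarrow> ('o \<Rightarrow> 'm) \<Rightarrow> bool" where
  "half_braiding C V \<sigma> \<longleftrightarrow>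
     \<sigma> \<in> extensional (obj C) \<and>
     (\<forall>X\<in>obj C. iso_morphism C (V \<boxdot>\<^bsub>C\<^esub> X) (X \<boxdot>\<^bsub>C\<^esub> V) (\<sigma> X)) \<and>
     (\<forall>X\<in>obj C. \<forall>Y\<in>obj C. \<forall>f\<in>mor C X Y.
        \<sigma> Y \<cdot>\<^bsub>C\<^esub> (idt C V \<boxtimes>\<^bsub>C\<^esub> f) = (f \<boxtimes>\<^bsub>C\<^esub> idt C V) \<cdot>\<^bsub>C\<^esub> \<sigma> X) \<and>
     (\<forall>X\<in>obj C. \<forall>Y\<in>obj C.
        \<sigma> (X \<boxdot>\<^bsub>C\<^esub> Y) = (idt C X \<boxtimes>\<^bsub>C\<^esub> \<sigma> Y) \<cdot>\<^bsub>C\<^esub> (\<sigma> X \<boxtimes>\<^bsub>C\<^esub> idt C Y))"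

definition drinfeld_center ::
    "('o, 'm, 'x) tensor_category_scheme \<Rightarrow> ('o \<times> ('o \<Rightarrow> 'm), 'm) category" where
  "drinfeld_center C =
     \<lparr>obj = {(V, \<sigma>). V \<in> obj C \<and> half_braiding C V \<sigma>},
      mor = (\<lambda>(V, \<sigma>) (W, \<tau>).
        {f \<in> mor C V W. \<forall>X\<in>obj C. (idt C X \<boxtimes>\<^bsub>C\<^esub> f) \<cdot>\<^bsub>C\<^esub> \<sigma> X = \<tau> X \<cdot>\<^bsub>C\<^esub> (f \<boxtimes>\<^bsub>C\<^esub> idt C X)}),
      cmp = cmp C,
      idt = (\<lambda>(V, \<sigma>). idt C V),
      zer = (\<lambda>(V, \<sigma>) (W, \<tau>). zer C V W)\<rparr>"

definition center_unit :: "('o, 'm, 'x) tensor_category_scheme \<Rightarrow> 'o \<times> ('o \<Rightarrow> 'm)" where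
  "center_unit C = (unt C, \<lambda>X\<in>obj C. idt C X)"

definition center_forget :: "('o \<times> ('o \<Rightarrow> 'm), 'm, 'o, 'm) functor_data" where
  "center_forget = \<lparr>fobj = fst, fmor = (\<lambda>_ _ f. f)\<rparr>"

definition modular_object :: "('o, 'm, 'x) tensor_category_scheme \<Rightarrow> 'o \<Rightarrow> bool" where
  "modular_object C \<alpha> \<longleftrightarrow>
     simple_object C \<alpha> \<and>
     (\<exists>R. adjoint_functors (drinfeld_center C) C center_forget R \<and>
          (\<exists>f\<in>mor (drinfeld_center C) (fobj R \<alpha>) (center_unit C).
             f \<noteq> zer (drinfeld_center C) (fobj R \<alpha>) (center_unit C)))"

definition unimodular_category :: "('o, 'm, 'x) tensor_category_scheme \<Rightarrow> bool" where
  "unimodular_category C \<longleftrightarrow> (\<exists>\<alpha>. modular_object C \<alpha> \<and> isomorphic_objects C \<alpha> (unt C))"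

subsection \<open>Central Hopf comonad and categorical cointegrals\<close>

text \<open>A dinatural transformation from the constant \<open>W\<close> to \<open>(X', X) \<mapsto> X \<otimes> V \<otimes> X'\<^sup>*\<close>.\<close>

definition central_wedge ::
    "('o, 'm, 'x) tensor_category_scheme \<Rightarrow> 'o \<Rightarrow> 'o \<Rightarrow> ('o \<Rightarrow> 'm) \<Rightarrow> bool" where
  "central_wedge C V W j \<longleftrightarrow>
     (\<forall>X\<in>obj C. j X \<in> mor C W (X \<boxdot>\<^bsub>C\<^esub> V \<boxdot>\<^bsub>C\<^esub> ldual C X)) \<and>
     (\<forall>X\<in>obj C. \<forall>Y\<in>obj C. \<forall>f\<in>mor C X Y.
        (f \<boxtimes>\<^bsub>C\<^esub> idt C V \<boxtimes>\<^bsub>C\<^esub> idt C (ldual C X)) \<cdot>\<^bsub>C\<^esub> j X =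
        (idt C Y \<boxtimes>\<^bsub>C\<^esub> idt C V \<boxtimes>\<^bsub>C\<^esub> dual_map C X Y f) \<cdot>\<^bsub>C\<^esub> j Y)"

definition central_end ::
    "('o, 'm, 'x) tensor_category_scheme \<Rightarrow> 'o \<Rightarrow> 'o \<Rightarrow> ('o \<Rightarrow> 'm) \<Rightarrow> bool" where
  "central_end C V E p \<longleftrightarrow>
     E \<in> obj C \<and> central_wedge C V E p \<and>
     (\<forall>W\<in>obj C. \<forall>j. central_wedge C V W j \<longrightarrow>
        (\<exists>!g. g \<in> mor C W E \<and> (\<forall>X\<in>obj C. p X \<cdot>\<^bsub>C\<^esub> g = j X)))"

definition central_hopf_comonad ::
    "('o, 'm, 'x) tensor_category_scheme \<Rightarrow> ('o, 'm, 'o, 'm) functor_data \<Rightarrow>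
     ('o \<Rightarrow> 'o \<Rightarrow> 'm) \<Rightarrow> ('o \<Rightarrow> 'm) \<Rightarrow> 'm \<Rightarrow> bool" where
  "central_hopf_comonad C Z \<pi> \<delta> u \<longleftrightarrow>
     (\<forall>V\<in>obj C. central_end C V (fobj Z V) (\<pi> V)) \<and>
     is_functor C C Z \<and>
     (\<forall>V\<in>obj C. \<forall>W\<in>obj C. \<forall>f\<in>mor C V W. \<forall>X\<in>obj C.
        \<pi> W X \<cdot>\<^bsub>C\<^esub> fmor Z V W f =
        (idt C X \<boxtimes>\<^bsub>C\<^esub> f \<boxtimes>\<^bsub>C\<^esub> idt C (ldual C X)) \<cdot>\<^bsub>C\<^esub> \<pi> V X) \<and>
     (\<forall>V\<in>obj C.
        \<delta> V \<in> mor C (fobj Z V) (fobj Z (fobj Z V)) \<and>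
        (\<forall>X\<in>obj C. \<forall>Y\<in>obj C.
           (idt C X \<boxtimes>\<^bsub>C\<^esub> \<pi> V Y \<boxtimes>\<^bsub>C\<^esub> idt C (ldual C X)) \<cdot>\<^bsub>C\<^esub> \<pi> (fobj Z V) X \<cdot>\<^bsub>C\<^esub> \<delta> V =
           (idt C X \<boxtimes>\<^bsub>C\<^esub> idt C Y \<boxtimes>\<^bsub>C\<^esub> idt C V \<boxtimes>\<^bsub>C\<^esub> dual_tens C X Y) \<cdot>\<^bsub>C\<^esub> \<pi> V (X \<boxdot>\<^bsub>C\<^esub> Y))) \<and>
     u \<in> mor C (unt C) (fobj Z (unt C)) \<and>
     (\<forall>X\<in>obj C. \<pi> (unt C) X \<cdot>\<^bsub>C\<^esub> u = coev C X)"

definition categorical_cointegral ::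
    "('o, 'm, 'x) tensor_category_scheme \<Rightarrow> ('o, 'm, 'o, 'm) functor_data \<Rightarrow>
     ('o \<Rightarrow> 'm) \<Rightarrow> 'm \<Rightarrow> 'o \<Rightarrow> 'm \<Rightarrow> bool" where
  "categorical_cointegral C Z \<delta> u \<alpha> l \<longleftrightarrow>
     l \<in> mor C (fobj Z \<alpha>) (unt C) \<and>
     fmor Z (fobj Z \<alpha>) (unt C) l \<cdot>\<^bsub>C\<^esub> \<delta> \<alpha> = u \<cdot>\<^bsub>C\<^esub> l"

text \<open>
  The choices made here (the end, the modular object, the non-zero cointegral \<open>l\<close>, the isomorphism
  \<open>i : 1 \<rightarrow> \<alpha>\<close>) are unique up to isomorphism and non-zero scalars, respectively, and do not affect
  whether the composition vanishes.
\<close>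

definition property_CU :: "('o, 'm, 'x) tensor_category_scheme \<Rightarrow> bool" where
  "property_CU C \<longleftrightarrow>
     unimodular_category C \<and>
     (\<exists>Z \<pi> \<delta> u \<alpha> l i.
        central_hopf_comonad C Z \<pi> \<delta> u \<and>
        modular_object C \<alpha> \<and>
        categorical_cointegral C Z \<delta> u \<alpha> l \<and>
        l \<noteq> zer C (fobj Z \<alpha>) (unt C) \<and>
        iso_morphism C (unt C) \<alpha> i \<and>
        l \<cdot>\<^bsub>C\<^esub> fmor Z (unt C) \<alpha> i \<cdot>\<^bsub>C\<^esub> u \<noteq> zer C (unt C) (unt C))"


section \<open>The tensor category of finite-dimensional modules\<close>

text \<open>
  A finite-dimensional left \<open>H\<close>-module is taken on a coordinate space \<open>k\<^sup>n\<close>, i.e.\ it is a matrix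
  representation \<open>(n, \<rho>)\<close> of \<open>H\<close>; a morphism is the matrix of a linear map. With \<open>k\<^sup>m \<otimes> k\<^sup>n\<close> identified
  with \<open>k\<^sup>m\<^sup>n\<close> through the lexicographic order of the basis, the tensor product is strictly associative
  and unital.
\<close>

definition kronecker :: "'k::semiring_0 mat \<Rightarrow> 'k mat \<Rightarrow> 'k mat" where
  "kronecker A B =
     mat (dim_row A * dim_row B) (dim_col A * dim_col B)
       (\<lambda>(i, j). A $$ (i div dim_row B, j div dim_col B) * B $$ (i mod dim_row B, j mod dim_col B))"

type_synonym ('h, 'k) matrix_rep = "nat \<times> ('h \<Rightarrow> 'k mat)"

definition is_matrix_rep ::
    "('k::field \<Rightarrow> 'h::ring_1 \<Rightarrow> 'h) \<Rightarrow> nat \<Rightarrow> ('h \<Rightarrow> 'k mat) \<Rightarrow> bool" where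
  "is_matrix_rep scale n \<rho> \<longleftrightarrow>
     (\<forall>x. \<rho> x \<in> carrier_mat n n) \<and>
     (\<forall>x y. \<rho> (x + y) = \<rho> x + \<rho> y) \<and>
     (\<forall>c x. \<rho> (scale c x) = c \<cdot>\<^sub>m \<rho> x) \<and>
     \<rho> 1 = 1\<^sub>m n \<and>
     (\<forall>x y. \<rho> (x * y) = \<rho> x * \<rho> y)"

definition intertwiners ::
    "('h, 'k::field) matrix_rep \<Rightarrow> ('h, 'k) matrix_rep \<Rightarrow> 'k mat set" where
  "intertwiners = (\<lambda>(n, \<rho>) (m, \<sigma>). {A \<in> carrier_mat m n. \<forall>x. A * \<rho> x = \<sigma> x * A})"

text \<open>The action of \<open>x\<close> on \<open>V \<otimes> W\<close> is that of \<open>\<Delta> x\<close>. The sum is taken entrywise.\<close>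

definition rep_tensor ::
    "('h \<Rightarrow> ('h \<times> 'h \<Rightarrow>\<^sub>0 'k::field)) \<Rightarrow>
     ('h, 'k) matrix_rep \<Rightarrow> ('h, 'k) matrix_rep \<Rightarrow> ('h, 'k) matrix_rep" where
  "rep_tensor \<Delta> = (\<lambda>(n, \<rho>) (m, \<sigma>).
     (n * m, \<lambda>x. mat (n * m) (n * m) (\<lambda>(i, j).
        linear_extension (*) (\<lambda>(a, b). kronecker (\<rho> a) (\<sigma> b) $$ (i, j)) (\<Delta> x))))"

text \<open>
  On \<open>V\<^sup>*\<close>, with the dual basis, \<open>x\<close> acts by \<open>f \<mapsto> f \<circ> S x\<close>. Evaluation and coevaluation are the
  row and column vectors with entry 1 at the positions of \<open>e\<^sup>i \<otimes> e\<^sub>i\<close> and \<open>e\<^sub>i \<otimes> e\<^sup>i\<close>.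
\<close>

definition rep_dual :: "('h \<Rightarrow> 'h) \<Rightarrow> ('h, 'k::field) matrix_rep \<Rightarrow> ('h, 'k) matrix_rep" where
  "rep_dual S = (\<lambda>(n, \<rho>). (n, \<lambda>x. transpose_mat (\<rho> (S x))))"

definition modules ::
    "('k::field \<Rightarrow> 'h::ring_1 \<Rightarrow> 'h) \<Rightarrow> ('h \<Rightarrow> ('h \<times> 'h \<Rightarrow>\<^sub>0 'k)) \<Rightarrow> ('h \<Rightarrow> 'k) \<Rightarrow> ('h \<Rightarrow> 'h) \<Rightarrow>
     (('h, 'k) matrix_rep, 'k mat) tensor_category" where
  "modules scale \<Delta> \<epsilon> S =
     \<lparr>obj = {(n, \<rho>). is_matrix_rep scale n \<rho>},
      mor = intertwiners,
      cmp = (*),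
      idt = (\<lambda>(n, \<rho>). 1\<^sub>m n),
      zer = (\<lambda>(n, \<rho>) (m, \<sigma>). 0\<^sub>m m n),
      tens = rep_tensor \<Delta>,
      tensm = kronecker,
      unt = (1, \<lambda>x. mat 1 1 (\<lambda>_. \<epsilon> x)),
      ldual = rep_dual S,
      ev = (\<lambda>(n, \<rho>). mat 1 (n * n) (\<lambda>(_, j). if j div n = j mod n then 1 else 0)),
      coev = (\<lambda>(n, \<rho>). mat (n * n) 1 (\<lambda>(i, _). if i div n = i mod n then 1 else 0))\<rparr>"

end

theory Submission
  imports Defs
begin

text \<open>
  Both sides are equivalent to the existence of a functional \<open>\<lambda>\<close> on \<open>H\<close> such that
  \<open>h\<^sub>1 \<lambda>(h\<^sub>2) = \<lambda>(h) 1\<close>, \<open>\<lambda>(x\<^sub>1 h S(x\<^sub>2)) = \<epsilon>(x) \<lambda>(h)\<close> and \<open>\<lambda>(1) = 1\<close>.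

  On the categorical side, \<open>Z(1)\<close> is \<open>H\<close> with the adjoint action, and \<open>\<lambda>\<close> is a categorical cointegral
  on it, and at the same time a morphism \<open>R(1) \<rightarrow> 1\<close> of the Drinfeld center, which exhibits \<open>1\<close> as the
  modular object.

  On the Hopf algebra side, the first condition and \<open>\<lambda>(1) = 1\<close> say that \<open>\<lambda>\<close> is a normalised integral of
  the dual algebra: it exists if \<open>H\<close> is the sum of its simple subcoalgebras (take \<open>\<lambda> = 0\<close> on those
  not containing \<open>1\<close>), and conversely Maschke averaging over \<open>\<lambda>\<close> splits off every subcoalgebra. Such a \<open>\<lambda>\<close> is
  nondegenerate. The second condition amounts to \<open>\<lambda>(x h) = \<lambda>(h S\<^sup>2(x))\<close>, which by nondegeneracy is
  equivalent to unimodularity.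
\<close>

section \<open>Sweedler calculus\<close>

text \<open>Tensors are classes of formal sums, so identities in \<open>H \<otimes> H\<close> are
  tested on multilinear forms with values in the field; finite dimension supplies enough of them.
  The obstacle is the antipode. Half-braidings have to be invertible, and for the one on
  \<open>H \<otimes> V\<close> this is derived from bijectivity of \<open>S\<close>. Bijectivity is
  drawn from the normalised functional itself: its nondegeneracy, in the form that
  \<open>l (h * S g) = 0\<close> for all \<open>h\<close> implies \<open>g = 0\<close>, contains the
  injectivity of \<open>S\<close>. Accordingly the right adjoint of the forgetful functor is
  constructed for bijective \<open>S\<close>. On the categorical side a vector \<open>x\<close> of a
  module \<open>X\<close> is encoded as the module map \<open>h \<mapsto> h x\<close> from the
  regular representation, which takes 1 to \<open>x\<close>. Hence wedges and half-braidings are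
  controlled by their components at the regular representation. The matrix proofs imitate this: two
  matrices are compared after contracting a tensor factor with an arbitrary vector.\<close>

lemma lookup_formal_scale [simp]:
  "Poly_Mapping.lookup (formal_scale c t) p = c * Poly_Mapping.lookup t p"
  by (simp add: formal_scale_def Poly_Mapping.map.rep_eq when_def)

lemma formal_scale_single [simp]:
  "formal_scale c (Poly_Mapping.single p a) = Poly_Mapping.single p (c * a)"
  by (rule poly_mapping_eqI) (simp add: lookup_single when_def)

interpretation formal: vector_space "formal_scale :: 'k::field \<Rightarrow> ('p \<Rightarrow>\<^sub>0 'k) \<Rightarrow> ('p \<Rightarrow>\<^sub>0 'k)"
  by unfold_locales (auto intro!: poly_mapping_eqI simp: lookup_add algebra_simps)

context vector_space
begin

lemma linear_extension_superset:
  assumes "finite K" "Poly_Mapping.keys t \<subseteq> K"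
  shows "linear_extension scale F t = (\<Sum>p\<in>K. scale (Poly_Mapping.lookup t p) (F p))"
  unfolding linear_extension_def using assms
  by (intro sum.mono_neutral_left) (auto simp: in_keys_iff)

lemma linear_extension_add:
  "linear_extension scale F (s + t) = linear_extension scale F s + linear_extension scale F t"
proof -
  let ?K = "Poly_Mapping.keys s \<union> Poly_Mapping.keys t"
  have "Poly_Mapping.keys (s + t) \<subseteq> ?K" by (rule keys_add)
  then show ?thesis
    by (simp add: linear_extension_superset[of ?K] lookup_add scale_left_distrib sum.distrib)
qed

lemma linear_extension_formal_scale:
  "linear_extension scale F (formal_scale c t) = scale c (linear_extension scale F t)"
proof -
  have "Poly_Mapping.keys (formal_scale c t) \<subseteq> Poly_Mapping.keys t" by (auto simp: in_keys_iff)
  then show ?thesis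
    by (simp add: linear_extension_superset[of "Poly_Mapping.keys t"] scale_sum_right)
qed

lemma linear_extension_single [simp]:
  "linear_extension scale F (Poly_Mapping.single p c) = scale c (F p)"
  by (simp add: linear_extension_superset[of "{p}"])

lemma linear_extension_linear: "Vector_Spaces.linear formal_scale scale (linear_extension scale F)"
  by (rule Vector_Spaces.linear.intro)
    (simp_all add: vector_space_axioms formal.vector_space_axioms module_hom_def module_hom_axioms_def
      module_axioms formal.module_axioms linear_extension_add linear_extension_formal_scale)

end

lemma linear_comp_linear_extension:
  assumes "Vector_Spaces.linear s s' f"
  shows "f (linear_extension s F t) = linear_extension s' (\<lambda>p. f (F p)) t"
proof -
  interpret f: Vector_Spaces.linear s s' f by fact
  show ?thesis by (simp add: linear_extension_def f.sum f.scale)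
qed

interpretation field_vs: vector_space "(*) :: 'k::field \<Rightarrow> 'k \<Rightarrow> 'k"
  by unfold_locales (simp_all add: distrib_left distrib_right mult.assoc)

text \<open>For the field acting on itself this rule reads \<open>a * (b * x) = a * b * x\<close>,
  the reverse of \<open>mult.assoc\<close>, and would loop with it.\<close>

declare field_vs.scale_scale [simp del]

text \<open>Universal property of the quotient by the span of \<open>R\<close>: a linear functional
  that kills the generators of the relations descends to congruence classes.\<close>

lemma linear_extension_vanishes:
  fixes s :: "'p \<Rightarrow>\<^sub>0 'k::field"
  assumes "s - t \<in> formal.span R" "\<And>r. r \<in> R \<Longrightarrow> linear_extension (*) F r = 0"
  shows "linear_extension (*) F s = linear_extension (*) F t"
proof -
  interpret L: Vector_Spaces.linear formal_scale "(*)" "linear_extension (*) F"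
    by (rule field_vs.linear_extension_linear)
  have "linear_extension (*) F (s - t) = 0"
    by (rule L.eq_0_on_span[OF _ assms(1)]) (rule assms(2))
  then show ?thesis by (simp add: L.diff)
qed

context hopf_algebra
begin

text \<open>Linearity spelled out as two equations (see \<open>functional_linear\<close>), so that
  multilinearity of long Sweedler expressions becomes a goal for the simplifier.\<close>

definition functional :: "('h \<Rightarrow> 'k) \<Rightarrow> bool" where
  "functional f \<longleftrightarrow> (\<forall>x y. f (x + y) = f x + f y) \<and> (\<forall>c x. f (scale c x) = c * f x)"

definition bilinear_form :: "('h \<Rightarrow> 'h \<Rightarrow> 'k) \<Rightarrow> bool" where
  "bilinear_form F \<longleftrightarrow> (\<forall>z. functional (\<lambda>x. F x z)) \<and> (\<forall>z. functional (\<lambda>x. F z x))"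

definition trilinear_form :: "('h \<Rightarrow> 'h \<Rightarrow> 'h \<Rightarrow> 'k) \<Rightarrow> bool" where
  "trilinear_form F \<longleftrightarrow> (\<forall>y z. functional (\<lambda>x. F x y z)) \<and> (\<forall>y z. functional (\<lambda>x. F y x z))
     \<and> (\<forall>y z. functional (\<lambda>x. F y z x))"

lemma functional_add: "functional f \<Longrightarrow> f (x + y) = f x + f y"
  and functional_scale: "functional f \<Longrightarrow> f (scale c x) = c * f x"
  by (auto simp: functional_def)

lemma functional_linear: "functional f \<longleftrightarrow> Vector_Spaces.linear scale (*) f"
  unfolding functional_def Vector_Spaces.linear_def module_hom_def module_hom_axioms_def
  using vector_space_axioms module_axioms field_vs.vector_space_axioms field_vs.module_axioms by auto

lemma functional_zero: "functional f \<Longrightarrow> f 0 = 0"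
  using functional_scale[of f 0 0] by simp

lemma functional_diff: "functional f \<Longrightarrow> f (x - y) = f x - f y"
  using functional_add[of f "x - y" y] by simp

lemma functional_sum: "functional f \<Longrightarrow> f (\<Sum>i\<in>I. g i) = (\<Sum>i\<in>I. f (g i))"
  by (induction I rule: infinite_finite_induct) (auto simp: functional_zero functional_add)

lemma tensor2_eq_bilinear:
  assumes "tensor2_eq scale s t" "bilinear_form F"
  shows "linear_extension (*) (\<lambda>(a, b). F a b) s = linear_extension (*) (\<lambda>(a, b). F a b) t"
proof -
  interpret L: Vector_Spaces.linear formal_scale "(*)" "linear_extension (*) (\<lambda>(a, b). F a b)"
    by (rule field_vs.linear_extension_linear)
  show ?thesis
    using assms(1) unfolding tensor2_eq_def
    by (rule linear_extension_vanishes)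
      (use assms(2) in \<open>auto simp: multilinear_relations_def slots2_def L.diff
        bilinear_form_def functional_def\<close>)
qed

lemma tensor3_eq_trilinear:
  assumes "tensor3_eq scale s t" "trilinear_form F"
  shows "linear_extension (*) (\<lambda>(a, b, c). F a b c) s = linear_extension (*) (\<lambda>(a, b, c). F a b c) t"
proof -
  interpret L: Vector_Spaces.linear formal_scale "(*)" "linear_extension (*) (\<lambda>(a, b, c). F a b c)"
    by (rule field_vs.linear_extension_linear)
  show ?thesis
    using assms(1) unfolding tensor3_eq_def
    by (rule linear_extension_vanishes)
      (use assms(2) in \<open>auto simp: multilinear_relations_def slots3_def L.diff
        trilinear_form_def functional_def\<close>)
qed

text \<open>
  \<open>sw x F\<close> is the Sweedler sum \<open>F x\<^sub>1 x\<^sub>2\<close>. Restricting to forms with values in the base field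
  suffices, as functionals separate points.
\<close>

definition sw :: "'h \<Rightarrow> ('h \<Rightarrow> 'h \<Rightarrow> 'k) \<Rightarrow> 'k" where
  "sw x F = linear_extension (*) (\<lambda>(a, b). F a b) (\<Delta> x)"

lemma sw_sum: "sw x F = (\<Sum>p\<in>Poly_Mapping.keys (\<Delta> x). Poly_Mapping.lookup (\<Delta> x) p * F (fst p) (snd p))"
  by (simp add: sw_def linear_extension_def case_prod_beta')

lemma sw_distrib: "sw x (\<lambda>a b. F a b + G a b) = sw x F + sw x G"
  by (simp add: sw_sum distrib_left sum.distrib)

lemma sw_cmult: "sw x (\<lambda>a b. c * F a b) = c * sw x F"
  by (simp add: sw_sum sum_distrib_left mult.left_commute)

lemma sw_cmult_right: "sw x (\<lambda>a b. F a b * c) = sw x F * c"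
  by (simp add: sw_sum sum_distrib_right mult.assoc)

lemma sw_sum_distrib: "sw x (\<lambda>a b. \<Sum>i\<in>I. F i a b) = (\<Sum>i\<in>I. sw x (F i))"
  by (simp add: sw_sum sum_distrib_left sum.swap[of _ I])

lemma sw_commute: "sw x (\<lambda>a b. sw y (\<lambda>c d. F a b c d)) = sw y (\<lambda>c d. sw x (\<lambda>a b. F a b c d))"
proof -
  have "sw x (\<lambda>a b. sw y (\<lambda>c d. F a b c d)) =
      sw x (\<lambda>a b. \<Sum>p\<in>Poly_Mapping.keys (\<Delta> y). Poly_Mapping.lookup (\<Delta> y) p * F a b (fst p) (snd p))"
    by (subst (2) sw_sum) simp
  also have "\<dots> = sw y (\<lambda>c d. sw x (\<lambda>a b. F a b c d))"
    unfolding sw_sum_distrib sw_cmult by (simp add: sw_sum)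
  finally show ?thesis .
qed

lemma sw_add: "bilinear_form F \<Longrightarrow> sw (x + y) F = sw x F + sw y F"
  unfolding sw_def using tensor2_eq_bilinear[OF comult_add]
  by (simp add: field_vs.linear_extension_add)

lemma sw_scale: "bilinear_form F \<Longrightarrow> sw (scale c x) F = c * sw x F"
  unfolding sw_def using tensor2_eq_bilinear[OF comult_scale]
  by (simp add: field_vs.linear_extension_formal_scale)

lemma sw_one: "bilinear_form F \<Longrightarrow> sw 1 F = F 1 1"
  unfolding sw_def using tensor2_eq_bilinear[OF comult_one] by simp

lemma sw_functional: "bilinear_form F \<Longrightarrow> functional (\<lambda>x. sw x F)"
  by (simp add: functional_def sw_add sw_scale)

lemma sw_mult:
  assumes "bilinear_form F"
  shows "sw (x * y) F = sw x (\<lambda>a b. sw y (\<lambda>c d. F (a * c) (b * d)))"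
proof -
  have lin: "Vector_Spaces.linear formal_scale (*) (linear_extension (*) G)" for G :: "'h \<times> 'h \<Rightarrow> 'k"
    by (rule field_vs.linear_extension_linear)
  show ?thesis
    unfolding sw_def tensor2_eq_bilinear[OF comult_mult assms]
    by (simp add: linear_comp_linear_extension[OF lin] case_prod_beta')
qed

lemma sw_coassoc:
  assumes "trilinear_form F"
  shows "sw x (\<lambda>a b. sw a (\<lambda>c d. F c d b)) = sw x (\<lambda>a b. sw b (\<lambda>c d. F a c d))"
proof -
  have lin: "Vector_Spaces.linear formal_scale (*) (linear_extension (*) G)" for G :: "'h \<times> 'h \<times> 'h \<Rightarrow> 'k"
    by (rule field_vs.linear_extension_linear)
  show ?thesis
    unfolding sw_def using tensor3_eq_trilinear[OF coassoc[of x] assms]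
    by (simp add: linear_comp_linear_extension[OF lin] case_prod_beta')
qed

text \<open>The bridge between the two kinds of Sweedler sum: the counit and antipode axioms are
  equations in \<open>H\<close>, and this turns them into equations between values of
  \<open>sw\<close>.\<close>

lemma functional_sw:
  assumes "functional f"
  shows "f (linear_extension scale (\<lambda>(a, b). F a b) (\<Delta> x)) = sw x (\<lambda>a b. f (F a b))"
  using linear_comp_linear_extension[OF assms[unfolded functional_linear], of "\<lambda>(a, b). F a b" "\<Delta> x"]
  by (simp add: sw_def case_prod_beta')

lemma sw_counit_left: "functional f \<Longrightarrow> sw x (\<lambda>a b. \<epsilon> a * f b) = f x"
  using functional_sw[of f "\<lambda>a b. scale (\<epsilon> a) b" x] by (simp add: counit_left functional_scale[of f])

lemma sw_counit_right: "functional f \<Longrightarrow> sw x (\<lambda>a b. \<epsilon> b * f a) = f x"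
  using functional_sw[of f "\<lambda>a b. scale (\<epsilon> b) a" x] by (simp add: counit_right functional_scale[of f])

lemma sw_antipode_left: "functional f \<Longrightarrow> sw x (\<lambda>a b. f (S a * b)) = \<epsilon> x * f 1"
  using functional_sw[of f "\<lambda>a b. S a * b" x] by (simp add: antipode_left functional_scale[of f])

lemma sw_antipode_right: "functional f \<Longrightarrow> sw x (\<lambda>a b. f (a * S b)) = \<epsilon> x * f 1"
  using functional_sw[of f "\<lambda>a b. a * S b" x] by (simp add: antipode_right functional_scale[of f])

lemma counit_functional: "functional \<epsilon>"
  using counit_linear by (simp add: functional_linear)

lemma counit_add: "\<epsilon> (x + y) = \<epsilon> x + \<epsilon> y" and counit_scale: "\<epsilon> (scale c x) = c * \<epsilon> x"
  using counit_functional by (auto simp: functional_def)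

lemma S_add: "S (x + y) = S x + S y"
proof -
  interpret Vector_Spaces.linear scale scale S by (rule antipode_linear)
  show ?thesis by (rule add)
qed

lemma S_scale: "S (scale c x) = scale c (S x)"
proof -
  interpret Vector_Spaces.linear scale scale S by (rule antipode_linear)
  show ?thesis by (rule scale)
qed

end

section \<open>Coordinates, and the antipode as an anti-homomorphism\<close>

locale fd_hopf_algebra = hopf_algebra scale \<Delta> \<epsilon> S + finite_dimensional_vector_space scale Basis
  for scale :: "'k::field \<Rightarrow> 'h::ring_1 \<Rightarrow> 'h"
    and \<Delta> :: "'h \<Rightarrow> ('h \<times> 'h \<Rightarrow>\<^sub>0 'k)" and \<epsilon> :: "'h \<Rightarrow> 'k" and S :: "'h \<Rightarrow> 'h" and Basis :: "'h set"
begin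

definition bas :: "nat \<Rightarrow> 'h" where
  "bas = (SOME f. bij_betw f {..<card Basis} Basis)"

definition crd :: "nat \<Rightarrow> 'h \<Rightarrow> 'k" where
  "crd i x = representation Basis x (bas i)"

abbreviation d :: nat where "d \<equiv> card Basis"

lemma bas_bij: "bij_betw bas {..<d} Basis"
proof -
  have "\<exists>f. bij_betw f {..<d} Basis"
    using ex_bij_betw_nat_finite[OF finite_Basis] by (simp add: atLeast0LessThan)
  then show ?thesis unfolding bas_def by (rule someI_ex)
qed

lemma crd_functional [simp]: "functional (crd i)"
  by (simp add: functional_def crd_def representation_add representation_scale
      independent_Basis span_Basis)

lemma crd_bas [simp]: "i < d \<Longrightarrow> j < d \<Longrightarrow> crd i (bas j) = (if i = j then 1 else 0)"
  using bas_bij unfolding bij_betw_def inj_on_def crd_def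
  by (subst representation_basis) (auto simp: independent_Basis)

lemma expand: "x = (\<Sum>i<d. scale (crd i x) (bas i))"
proof -
  have "(\<Sum>b\<in>Basis. scale (representation Basis x b) b) = x"
    by (rule sum_representation_eq) (simp_all add: independent_Basis span_Basis finite_Basis)
  then show ?thesis
    using sum.reindex_bij_betw[OF bas_bij, of "\<lambda>b. scale (representation Basis x b) b"]
    by (simp add: crd_def)
qed

lemma functional_expand: "functional f \<Longrightarrow> f x = (\<Sum>i<d. crd i x * f (bas i))"
  using functional_sum[of f "\<lambda>i. scale (crd i x) (bas i)" "{..<d}"] functional_scale[of f]
  by (simp flip: expand)

lemma crd_eqI: "(\<And>i. i < d \<Longrightarrow> crd i x = crd i y) \<Longrightarrow> x = y"
  by (subst expand[of x], subst expand[of y]) simp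

text \<open>Coordinates are functionals, so functionals separate points. Identities in
  \<open>H\<close> are proved by applying an arbitrary \<open>f\<close> and computing with
  \<open>sw\<close>.\<close>

lemma functional_eqI:
  assumes "\<And>f. functional f \<Longrightarrow> f x = f y"
  shows "x = y"
  by (rule crd_eqI) (simp add: assms)

text \<open>Together these two collections prove the bilinearity and trilinearity conditions of the
  Sweedler rules by rewriting: sums and scalars are pulled out of products, antipodes, counits and
  nested Sweedler sums.\<close>

lemmas form_defs = bilinear_form_def trilinear_form_def functional_def
lemmas form_simps = distrib_left distrib_right scale_mult_left scale_mult_right S_add S_scale
  counit_add counit_scale counit_mult sw_add sw_scale sw_distrib sw_cmult sw_cmult_right
  scale_right_distrib mult.assoc mult.left_commute

lemma functional_simps:
  assumes "functional f"
  shows "f (x + y) = f x + f y" "f (scale c x) = c * f x"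
  using assms by (auto simp: functional_def)

lemma sw_cong: "(\<And>a b. F a b = G a b) \<Longrightarrow> sw x F = sw x G"
  by presburger

text \<open>Both sides are convolution inverses of the multiplication
  \<open>H \<otimes> H \<rightarrow> H\<close>. Concretely, \<open>S (x\<^sub>1 y\<^sub>1) x\<^sub>2
  y\<^sub>2 S y\<^sub>3 S x\<^sub>3\<close> collapses to the left side when the antipode law is
  applied from the right, and to the right side when it is applied from the left.\<close>

lemma S_mult: "S (x * y) = S y * S x"
proof (rule functional_eqI)
  fix f assume f: "functional f"
  note [simp] = functional_simps[OF f] form_defs form_simps
  define P where "P a b c = sw y (\<lambda>p q'. sw q' (\<lambda>q r. f (S (a * p) * b * q * S r * S c)))" for a b c
  have tri: "trilinear_form P" by (simp add: P_def)
  \<comment> \<open>Collapse from the right, innermost pair first: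
    \<open>y\<^sub>2 S y\<^sub>3\<close> disappears here, \<open>x\<^sub>2 S x\<^sub>3\<close> in
    the next step.\<close>
  have 1: "P a b c = f (S (a * y) * b * S c)" for a b c
  proof -
    have "sw q' (\<lambda>q r. f (S (a * p) * b * q * S r * S c)) = \<epsilon> q' * f (S (a * p) * b * S c)" for p q'
      using sw_antipode_right[of "\<lambda>z. f (S (a * p) * b * z * S c)" q'] by simp
    then show ?thesis unfolding P_def
      using sw_counit_right[of "\<lambda>p. f (S (a * p) * b * S c)" y] by simp
  qed
  have "sw x (\<lambda>a b'. sw b' (\<lambda>b c. P a b c)) = sw x (\<lambda>a b'. \<epsilon> b' * f (S (a * y)))"
  proof (intro sw_cong)
    fix a b'
    show "sw b' (\<lambda>b c. P a b c) = \<epsilon> b' * f (S (a * y))"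
      using sw_antipode_right[of "\<lambda>z. f (S (a * y) * z)" b'] by (simp add: 1)
  qed
  then have A: "sw x (\<lambda>a b'. sw b' (\<lambda>b c. P a b c)) = f (S (x * y))"
    using sw_counit_right[of "\<lambda>a. f (S (a * y))" x] by simp
  \<comment> \<open>Collapse from the left: coassociativity in \<open>y\<close> regroups the first
    two factors, so that \<open>S (a p) b q\<close> becomes an instance of the antipode law for the
    product \<open>a' * p'\<close>.\<close>
  have 2: "sw a' (\<lambda>a b. P a b c) = \<epsilon> a' * f (S y * S c)" for a' c
  proof -
    have "P a b c = sw y (\<lambda>p' r. sw p' (\<lambda>p q. f (S (a * p) * b * q * S r * S c)))" for a b
      unfolding P_def by (rule sw_coassoc[symmetric]) simp
    then have "sw a' (\<lambda>a b. P a b c)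
        = sw y (\<lambda>p' r. sw a' (\<lambda>a b. sw p' (\<lambda>p q. f (S (a * p) * b * q * S r * S c))))"
      by (subst sw_commute) simp
    also have "\<dots> = sw y (\<lambda>p' r. sw (a' * p') (\<lambda>u v. f (S u * v * S r * S c)))"
      by (subst sw_mult) simp_all
    also have "\<dots> = sw y (\<lambda>p' r. \<epsilon> a' * (\<epsilon> p' * f (S r * S c)))"
      using sw_antipode_left[of "\<lambda>z. f (z * S r * S c)" for r] by simp
    also have "\<dots> = \<epsilon> a' * f (S y * S c)"
      using sw_counit_left[of "\<lambda>r. \<epsilon> a' * f (S r * S c)" y] by simp
    finally show ?thesis .
  qed
  have "sw x (\<lambda>a b'. sw b' (\<lambda>b c. P a b c)) = sw x (\<lambda>a' c. sw a' (\<lambda>a b. P a b c))"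
    by (rule sw_coassoc[OF tri, symmetric])
  also have "\<dots> = f (S y * S x)"
    unfolding 2 using sw_counit_left[of "\<lambda>c. f (S y * S c)" x] by simp
  finally show "f (S (x * y)) = f (S y * S x)" using A by simp
qed

lemma S_one [simp]: "S 1 = 1"
proof (rule functional_eqI)
  fix f assume f: "functional f"
  note [simp] = functional_simps[OF f] form_defs form_simps
  show "f (S 1) = f 1"
    using sw_antipode_left[OF f, of 1] by (subst (asm) sw_one) (simp_all add: counit_one)
qed

text \<open>Apply \<open>\<epsilon>\<close> to the left antipode law and absorb the second factor
  with the counit law.\<close>

lemma counit_S [simp]: "\<epsilon> (S x) = \<epsilon> x"
proof -
  have "functional (\<lambda>x. \<epsilon> (S x))" by (simp add: form_defs form_simps)
  then show ?thesis
    using sw_antipode_left[OF counit_functional, of x] sw_counit_right[of "\<lambda>x. \<epsilon> (S x)" x]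
    by (simp add: counit_mult counit_one mult.commute)
qed

text \<open>Uniqueness of convolution inverses again, now of \<open>\<Delta>\<close>: both sides
  invert it. \<open>P\<close> stands for \<open>\<Delta>(S x\<^sub>1) (x\<^sub>2 \<otimes>
  x\<^sub>3) (S x\<^sub>5 \<otimes> S x\<^sub>4)\<close>, which is collapsed from either
  end.\<close>

lemma sw_S:
  assumes F: "bilinear_form F"
  shows "sw (S x) F = sw x (\<lambda>a b. F (S b) (S a))"
proof -
  have [simp]: "F (x + y) = (\<lambda>z. F x z + F y z)" "F z (x + y) = F z x + F z y"
    "F (scale c x) = (\<lambda>y. c * F x y)" "F x (scale c y) = c * F x y" for x y z c
    using F by (auto simp: form_defs)
  note [simp] = form_defs form_simps
  define P where "P a u v g k = sw (S a) (\<lambda>p q. F (p * u * S k) (q * v * S g))" for a u v g k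
  have "sw t (\<lambda>m c. sw m (\<lambda>u v. sw c (\<lambda>g k. P a u v g k))) = \<epsilon> t * sw (S a) F" for a t
  proof -
    have "sw t (\<lambda>m c. sw m (\<lambda>u v. sw c (\<lambda>g k. P a u v g k)))
        = sw t (\<lambda>u r. sw r (\<lambda>v c. sw c (\<lambda>g k. P a u v g k)))"
      by (rule sw_coassoc) (simp add: P_def)
    also have "\<dots> = sw t (\<lambda>u r. sw r (\<lambda>n k. sw n (\<lambda>v g. P a u v g k)))"
      by (intro sw_cong sw_coassoc[symmetric]) (simp add: P_def)
    also have "\<dots> = sw t (\<lambda>u r. sw r (\<lambda>n k. \<epsilon> n * sw (S a) (\<lambda>p q. F (p * u * S k) q)))"
    proof (intro sw_cong)
      fix u r n k
      show "sw n (\<lambda>v g. P a u v g k) = \<epsilon> n * sw (S a) (\<lambda>p q. F (p * u * S k) q)"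
        using sw_antipode_right[of "\<lambda>z. sw (S a) (\<lambda>p q. F (p * u * S k) (q * z))" n]
        by (simp add: P_def)
    qed
    also have "\<dots> = sw t (\<lambda>u r. sw (S a) (\<lambda>p q. F (p * u * S r) q))"
    proof (intro sw_cong)
      fix u r
      show "sw r (\<lambda>n k. \<epsilon> n * sw (S a) (\<lambda>p q. F (p * u * S k) q))
          = sw (S a) (\<lambda>p q. F (p * u * S r) q)"
        by (rule sw_counit_left) simp
    qed
    also have "\<dots> = \<epsilon> t * sw (S a) F"
      using sw_antipode_right[of "\<lambda>z. sw (S a) (\<lambda>p q. F (p * z) q)" t] by simp
    finally show ?thesis .
  qed
  then have "sw x (\<lambda>a t. sw t (\<lambda>m c. sw m (\<lambda>u v. sw c (\<lambda>g k. P a u v g k)))) = sw (S x) F"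
    using sw_counit_right[of "\<lambda>a. sw (S a) F" x] by simp
  moreover have "sw x (\<lambda>a t. sw t (\<lambda>m c. sw m (\<lambda>u v. sw c (\<lambda>g k. P a u v g k))))
      = sw x (\<lambda>w c. sw w (\<lambda>a m. sw m (\<lambda>u v. sw c (\<lambda>g k. P a u v g k))))"
    by (rule sw_coassoc[symmetric]) (simp add: P_def)
  moreover have "sw w (\<lambda>a m. sw m (\<lambda>u v. sw c (\<lambda>g k. P a u v g k))) = \<epsilon> w * sw c (\<lambda>g k. F (S k) (S g))"
    for w c
  proof -
    \<comment> \<open>\<open>G z\<close> is
      \<open>\<Delta>(z) (S c\<^sub>2 \<otimes> S c\<^sub>1)\<close>. Multiplicativity of
      \<open>\<Delta>\<close> collects \<open>\<Delta>(S a) \<Delta>(m)\<close> into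
      \<open>\<Delta>(S a * m)\<close>, to which the antipode law applies.\<close>
    define G where "G z = sw c (\<lambda>g k. sw z (\<lambda>r s. F (r * S k) (s * S g)))" for z
    have "sw m (\<lambda>u v. sw c (\<lambda>g k. P a u v g k)) = G (S a * m)" for a m
    proof -
      have "sw m (\<lambda>u v. sw c (\<lambda>g k. P a u v g k)) = sw c (\<lambda>g k. sw m (\<lambda>u v. P a u v g k))"
        by (rule sw_commute)
      also have "\<dots> = sw c (\<lambda>g k. sw (S a) (\<lambda>p q. sw m (\<lambda>u v. F (p * u * S k) (q * v * S g))))"
        unfolding P_def by (subst sw_commute) simp
      also have "\<dots> = G (S a * m)"
        unfolding G_def by (subst sw_mult) simp_all
      finally show ?thesis .
    qed
    then have "sw w (\<lambda>a m. sw m (\<lambda>u v. sw c (\<lambda>g k. P a u v g k))) = sw w (\<lambda>a m. G (S a * m))"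
      by simp
    also have "\<dots> = \<epsilon> w * G 1" by (rule sw_antipode_left) (simp add: G_def)
    also have "G 1 = sw c (\<lambda>g k. F (S k) (S g))"
      unfolding G_def by (subst sw_one) simp_all
    finally show ?thesis .
  qed
  moreover have "sw x (\<lambda>w c. \<epsilon> w * sw c (\<lambda>g k. F (S k) (S g))) = sw x (\<lambda>g k. F (S k) (S g))"
    using sw_counit_left[of "\<lambda>c. sw c (\<lambda>g k. F (S k) (S g))" x] by simp
  ultimately show ?thesis by simp
qed

section \<open>Cointegrals and unimodularity\<close>

text \<open>
  \<open>cointegral \<lambda>\<close> says that \<open>\<lambda>\<close> is a left integral of the dual algebra: \<open>h\<^sub>1 \<lambda>(h\<^sub>2) = \<lambda>(h) 1\<close>.
\<close>

definition cointegral :: "('h \<Rightarrow> 'k) \<Rightarrow> bool" where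
  "cointegral l \<longleftrightarrow> functional l \<and> (\<forall>f x. functional f \<longrightarrow> sw x (\<lambda>a b. f a * l b) = l x * f 1)"

lemma cointegral_functional: "cointegral l \<Longrightarrow> functional l"
  and cointegral_sw: "cointegral l \<Longrightarrow> functional f \<Longrightarrow> sw x (\<lambda>a b. f a * l b) = l x * f 1"
  by (auto simp: cointegral_def)

text \<open>Expand \<open>l (h * S g\<^sub>1) 1\<close> by the cointegral law at the element
  \<open>h * S g\<^sub>1\<close>; since \<open>S\<close> reverses \<open>\<Delta>\<close>, a factor
  \<open>S g\<^sub>2 g\<^sub>3\<close> appears and cancels.\<close>

lemma cointegral_antipode:
  assumes l: "cointegral l" and f: "functional f"
  shows "sw h (\<lambda>a b. f a * l (b * S g)) = sw g (\<lambda>a b. l (h * S a) * f b)"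
proof -
  note [simp] = functional_simps[OF f] functional_simps[OF cointegral_functional[OF l]] form_defs form_simps
  have 1: "l (h * S a) * f b = sw a (\<lambda>s r. sw h (\<lambda>p q. f (p * S r * b) * l (q * S s)))" for a b
  proof -
    have "l (h * S a) * f b = sw (h * S a) (\<lambda>p q. f (p * b) * l q)"
      using cointegral_sw[OF l, of "\<lambda>z. f (z * b)"] by simp
    also have "\<dots> = sw h (\<lambda>p q. sw (S a) (\<lambda>r s. f (p * r * b) * l (q * s)))"
      by (subst sw_mult) simp_all
    also have "\<dots> = sw h (\<lambda>p q. sw a (\<lambda>s r. f (p * S r * b) * l (q * S s)))"
      by (subst sw_S) simp_all
    finally show ?thesis by (subst sw_commute)
  qed
  have "sw g (\<lambda>a b. l (h * S a) * f b)
      = sw g (\<lambda>s t. sw t (\<lambda>r b. sw h (\<lambda>p q. f (p * S r * b) * l (q * S s))))"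
    unfolding 1 by (rule sw_coassoc) simp
  also have "\<dots> = sw g (\<lambda>s t. \<epsilon> t * sw h (\<lambda>p q. f p * l (q * S s)))"
  proof (intro sw_cong)
    fix s t
    show "sw t (\<lambda>r b. sw h (\<lambda>p q. f (p * S r * b) * l (q * S s))) = \<epsilon> t * sw h (\<lambda>p q. f p * l (q * S s))"
      using sw_antipode_left[of "\<lambda>z. sw h (\<lambda>p q. f (p * z) * l (q * S s))" t] by simp
  qed
  also have "\<dots> = sw h (\<lambda>p q. f p * l (q * S g))"
    by (rule sw_counit_right) simp
  finally show ?thesis by simp
qed

text \<open>The companion for multiplication from the left: the cointegral law is applied at
  \<open>g\<^sub>2 h\<close>, and \<open>S g\<^sub>1 g\<^sub>2\<close> cancels.\<close>

lemma cointegral_antipode':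
  assumes l: "cointegral l" and f: "functional f"
  shows "sw h (\<lambda>a b. f a * l (g * b)) = sw g (\<lambda>a b. f (S a) * l (b * h))"
proof -
  note [simp] = functional_simps[OF f] functional_simps[OF cointegral_functional[OF l]] form_defs form_simps
  have 1: "f (S a) * l (b * h) = sw b (\<lambda>p q. sw h (\<lambda>r s. f (S a * p * r) * l (q * s)))" for a b
  proof -
    have "f (S a) * l (b * h) = sw (b * h) (\<lambda>p q. f (S a * p) * l q)"
      using cointegral_sw[OF l, of "\<lambda>z. f (S a * z)"] by simp
    also have "\<dots> = sw b (\<lambda>p q. sw h (\<lambda>r s. f (S a * p * r) * l (q * s)))"
      by (subst sw_mult) simp_all
    finally show ?thesis .
  qed
  have "sw g (\<lambda>a b. f (S a) * l (b * h))
      = sw g (\<lambda>t q. sw t (\<lambda>a p. sw h (\<lambda>r s. f (S a * p * r) * l (q * s))))"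
    unfolding 1 by (rule sw_coassoc[symmetric]) simp
  also have "\<dots> = sw g (\<lambda>t q. \<epsilon> t * sw h (\<lambda>r s. f r * l (q * s)))"
  proof (intro sw_cong)
    fix q t
    show "sw t (\<lambda>a p. sw h (\<lambda>r s. f (S a * p * r) * l (q * s))) = \<epsilon> t * sw h (\<lambda>r s. f r * l (q * s))"
      using sw_antipode_left[of "\<lambda>z. sw h (\<lambda>r s. f (z * r) * l (q * s))" t] by simp
  qed
  also have "\<dots> = sw h (\<lambda>r s. f r * l (g * s))"
    by (rule sw_counit_left) simp
  finally show ?thesis by simp
qed

text \<open>If the tensor \<open>G(z, x\<^sub>1) x\<^sub>2\<close> vanishes for each constant
  \<open>z\<close>, then \<open>z\<close> may also depend linearly on the second factor: expanding
  \<open>K b\<close> in the basis leaves finitely many constants.\<close>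

lemma bilinear_form_zero_extend:
  assumes "\<And>z f. functional f \<Longrightarrow> sw x (\<lambda>a b. G z a * f b) = 0"
    and "\<And>a. functional (\<lambda>z. G z a)"
    and "\<And>x y. K (x + y) = K x + K y" "\<And>c x. K (scale c x) = scale c (K x)"
  shows "sw x (\<lambda>a b. G (K b) a) = 0"
proof -
  have "sw x (\<lambda>a b. G (K b) a) = sw x (\<lambda>a b. \<Sum>i<d. G (bas i) a * crd i (K b))"
  proof (intro sw_cong)
    fix a b
    show "G (K b) a = (\<Sum>i<d. G (bas i) a * crd i (K b))"
      by (subst functional_expand[OF assms(2)]) (simp add: mult.commute)
  qed
  also have "\<dots> = (\<Sum>i<d. sw x (\<lambda>a b. G (bas i) a * crd i (K b)))"
    by (rule sw_sum_distrib)
  also have "\<dots> = 0"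
    using crd_functional by (intro sum.neutral ballI assms(1)) (simp add: functional_def assms(3,4))
  finally show ?thesis .
qed

text \<open>By \<open>cointegral_antipode\<close> the hypothesis gives
  \<open>l (z * S g\<^sub>1) g\<^sub>2 = 0\<close> for every constant \<open>z\<close>. With
  \<open>S (S g\<^sub>2)\<close> in the place of \<open>z\<close> and \<open>g\<^sub>3\<close> kept,
  the argument of \<open>l\<close> becomes \<open>S (g\<^sub>1 S g\<^sub>2)\<close>, which the
  antipode law turns into a multiple of \<open>l 1 = 1\<close>; what remains is
  \<open>g\<close>.\<close>

lemma cointegral_nondegenerate:
  assumes l: "cointegral l" and one: "l 1 = 1" and g: "\<And>h. l (h * S g) = 0"
  shows "g = 0"
proof (rule functional_eqI)
  fix f assume f: "functional f"
  note [simp] = functional_simps[OF f] functional_simps[OF cointegral_functional[OF l]] form_defs form_simps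
  have 0: "sw g (\<lambda>a b. l (z * S a) * f' b) = 0" if "functional f'" for z f'
    using cointegral_antipode[OF l that, of z g] g by (simp add: sw_sum)
  \<comment> \<open>The linear map that puts \<open>S (S u\<^sub>1)\<close>, weighted by
    \<open>f u\<^sub>2\<close>, in the place of the constant \<open>z\<close>.\<close>
  define K where "K u = linear_extension scale (\<lambda>(b, c). scale (f c) (S (S b))) (\<Delta> u)" for u
  have K: "f' (K u) = sw u (\<lambda>b c. f c * f' (S (S b)))" if "functional f'" for f' u
    unfolding K_def functional_sw[OF that] by (simp add: functional_simps[OF that])
  have K_add: "K (x + y) = K x + K y" for x y
  proof (rule functional_eqI)
    fix f' assume f': "functional f'"
    note [simp] = functional_simps[OF f'] K[OF f']
    show "f' (K (x + y)) = f' (K x + K y)" by simp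
  qed
  have K_scale: "K (scale c x) = scale c (K x)" for c x
  proof (rule functional_eqI)
    fix f' assume f': "functional f'"
    note [simp] = functional_simps[OF f'] K[OF f']
    show "f' (K (scale c x)) = f' (scale c (K x))" by simp
  qed
  have "f g = sw g (\<lambda>t c. \<epsilon> t * f c)"
    using sw_counit_left[OF f] by simp
  also have "\<dots> = sw g (\<lambda>t c. sw t (\<lambda>a b. l (S (S b) * S a) * f c))"
  proof (intro sw_cong)
    fix t c
    show "\<epsilon> t * f c = sw t (\<lambda>a b. l (S (S b) * S a) * f c)"
      using sw_antipode_right[of "\<lambda>z. l (S z)" t] by (simp add: S_mult one)
  qed
  also have "\<dots> = sw g (\<lambda>a u. sw u (\<lambda>b c. l (S (S b) * S a) * f c))"
    by (rule sw_coassoc) simp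
  also have "\<dots> = sw g (\<lambda>a u. l (K u * S a))"
  proof (intro sw_cong)
    fix a u
    show "sw u (\<lambda>b c. l (S (S b) * S a) * f c) = l (K u * S a)"
      using K[of "\<lambda>z. l (z * S a)" u] by (simp add: mult.commute)
  qed
  also have "\<dots> = 0"
    by (rule bilinear_form_zero_extend[where G = "\<lambda>z a. l (z * S a)" and K = K])
      (simp_all add: 0 K_add K_scale)
  finally show "f g = f 0" using functional_zero[OF f] by simp
qed


lemma linearI:
  "(\<And>x y. g (x + y) = g x + g y) \<Longrightarrow> (\<And>c x. g (scale c x) = scale c (g x)) \<Longrightarrow>
    Vector_Spaces.linear scale scale g"
  by (intro Vector_Spaces.linear.intro)
    (simp_all add: vector_space_axioms module_hom_def module_hom_axioms_def module_axioms)

lemma endo_surj: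
  assumes "Vector_Spaces.linear scale scale g" "\<And>x. g x = 0 \<Longrightarrow> x = 0"
  shows "surj g"
proof -
  interpret g: Vector_Spaces.linear scale scale g by fact
  have "inj g" using assms(2) by (simp add: g.inj_iff_eq_0)
  then show ?thesis using assms(1) by (rule linear_inj_imp_surj[rotated])
qed

text \<open>The nondegeneracy statement pairs \<open>h\<close> with \<open>S g\<close>, so an
  element killed by \<open>S\<close> pairs to zero with everything. Finite dimension then makes
  \<open>S\<close> bijective.\<close>

lemma S_inj:
  assumes l: "cointegral l" "l 1 = 1" shows "S x = 0 \<Longrightarrow> x = 0"
proof -
  assume "S x = 0"
  then have "l (h * S x) = 0" for h
    using functional_zero[OF cointegral_functional[OF l(1)]] by simp
  then show "x = 0" by (rule cointegral_nondegenerate[OF l])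
qed

lemma S_surj:
  assumes l: "cointegral l" "l 1 = 1" shows "surj S"
  by (rule endo_surj[OF antipode_linear]) (rule S_inj[OF l])

lemma cointegral_nondegenerate_right:
  assumes l: "cointegral l" "l 1 = 1" and "\<And>h. l (h * y) = 0"
  shows "y = 0"
proof -
  obtain g where "y = S g" using S_surj[OF l] by (auto simp: surj_def)
  moreover have "S 0 = 0" using S_scale[of 0 0] by simp
  ultimately show ?thesis using cointegral_nondegenerate[OF l] assms(3) by blast
qed

text \<open>The map taking \<open>y\<close> to \<open>l (_ * y)\<close> is injective from
  \<open>H\<close> to its dual by nondegeneracy, hence onto by dimension: \<open>H\<close> is a
  Frobenius algebra with form \<open>l\<close>.\<close>

lemma cointegral_represents:
  assumes l: "cointegral l" "l 1 = 1" and f: "functional f"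
  obtains y where "\<And>h. f h = l (h * y)"
proof -
  note [simp] = functional_simps[OF cointegral_functional[OF l(1)]] form_simps
  \<comment> \<open>The functional \<open>l (_ * y)\<close> is recorded by the element that has its
    values on the basis as coordinates, so that \<open>endo_surj\<close> applies.\<close>
  define T where "T y = (\<Sum>i<d. scale (l (bas i * y)) (bas i))" for y
  have crd_T: "crd i (T y) = l (bas i * y)" if "i < d" for i y
  proof -
    have "crd i (T y) = (\<Sum>j<d. l (bas j * y) * crd i (bas j))"
      unfolding T_def by (simp add: functional_sum functional_simps[OF crd_functional])
    also have "\<dots> = (\<Sum>j<d. if j = i then l (bas j * y) else 0)"
      using that by (intro sum.cong) auto
    finally show ?thesis using that by simp
  qed
  have eq: "f h = l (h * y)" if "\<And>i. i < d \<Longrightarrow> f (bas i) = l (bas i * y)" "functional f" for f y h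
    using functional_expand[OF that(2), of h] functional_expand[of "\<lambda>h. l (h * y)" h] that(1)
    by (simp add: functional_def)
  have "surj T"
  proof (rule endo_surj)
    show "Vector_Spaces.linear scale scale T"
      by (rule linearI; rule crd_eqI) (simp_all add: crd_T functional_simps[OF crd_functional])
    fix y assume "T y = 0"
    then have "0 = l (bas i * y)" if "i < d" for i
      using crd_T[OF that, of y] functional_zero[OF crd_functional] by simp
    then have "0 = l (h * y)" for h
      by (rule eq) (simp_all add: functional_def)
    then show "y = 0" using cointegral_nondegenerate_right[OF l] by simp
  qed
  then obtain y where y: "T y = (\<Sum>i<d. scale (f (bas i)) (bas i))"
    by (metis surj_def)
  have "f (bas i) = l (bas i * y)" if "i < d" for i
  proof -
    have "crd i (T y) = (\<Sum>j<d. f (bas j) * crd i (bas j))"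
      unfolding y by (simp add: functional_sum functional_simps[OF crd_functional])
    also have "\<dots> = (\<Sum>j<d. if j = i then f (bas j) else 0)"
      using that by (intro sum.cong) auto
    finally show ?thesis using that by (simp add: crd_T)
  qed
  then show ?thesis using eq[OF _ f] that by blast
qed

definition ad_invariant :: "('h \<Rightarrow> 'k) \<Rightarrow> bool" where
  "ad_invariant l \<longleftrightarrow> (\<forall>x h. sw x (\<lambda>a b. l (a * h * S b)) = \<epsilon> x * l h)"

text \<open>
  With an integral \<open>\<Lambda>\<close> such that \<open>\<lambda>(h\<Lambda>) = \<epsilon>(h)\<close>, unimodularity gives both \<open>\<Lambda>\<^sub>1 \<lambda>(\<Lambda>\<^sub>2 S g) = g\<close> and
  \<open>\<Lambda>\<^sub>1 \<lambda>(g \<Lambda>\<^sub>2) = S g\<close>; comparing them determines the Nakayama automorphism of \<open>\<lambda>\<close> to be \<open>S\<^sup>2\<close>.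
\<close>

lemma unimodular_nakayama:
  assumes l: "cointegral l" "l 1 = 1" and uni: "unimodular_hopf scale \<epsilon>"
  shows "l (g * z) = l (z * S (S g))"
proof -
  have fl: "functional l" using l(1) by (rule cointegral_functional)
  note [simp] = functional_simps[OF fl] form_simps
  obtain \<Lambda> where \<Lambda>: "\<And>h. \<epsilon> h = l (h * \<Lambda>)"
    using cointegral_represents[OF l counit_functional] by blast
  have left: "h * \<Lambda> = scale (\<epsilon> h) \<Lambda>" for h
  proof -
    have "l (k * (h * \<Lambda> - scale (\<epsilon> h) \<Lambda>)) = 0" for k
      using \<Lambda>[of k] \<Lambda>[of "k * h"]
      by (simp add: right_diff_distrib functional_diff[OF fl] mult.commute)
    then show ?thesis using cointegral_nondegenerate_right[OF l] by fastforce
  qed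
  then have "\<Lambda> \<in> left_integrals scale \<epsilon>" by (simp add: left_integrals_def)
  then have right: "\<Lambda> * h = scale (\<epsilon> h) \<Lambda>" for h
    using uni by (simp add: unimodular_hopf_def right_integrals_def)
  have l\<Lambda>: "l \<Lambda> = 1" using \<Lambda>[of 1] by (simp add: counit_one)
  \<comment> \<open>\<open>w\<close> measures the Nakayama automorphism: \<open>S w\<close> is its
    value at \<open>g\<close>, and the goal becomes \<open>w = S g\<close>.\<close>
  obtain w where w: "\<And>z. l (g * z) = l (z * S w)"
  proof -
    have "functional (\<lambda>z. l (g * z))" by (simp add: functional_def)
    from cointegral_represents[OF l this] obtain y where "\<And>z. l (g * z) = l (z * y)" by blast
    moreover obtain w where "y = S w" using S_surj[OF l] by (auto simp: surj_def)
    ultimately show ?thesis using that by blast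
  qed
  have "f w = f (S g)" if f: "functional f" for f
  proof -
    note [simp] = functional_simps[OF f]
    have "f w = sw w (\<lambda>a b. l (\<Lambda> * S a) * f b)"
      using sw_counit_left[OF f, of w] by (simp add: right l\<Lambda>)
    also have "\<dots> = sw \<Lambda> (\<lambda>a b. f a * l (g * b))"
      using cointegral_antipode[OF l(1) f, of \<Lambda> w] by (simp add: w)
    also have "\<dots> = sw g (\<lambda>a b. f (S a) * l (b * \<Lambda>))"
      by (rule cointegral_antipode'[OF l(1) f])
    also have "\<dots> = f (S g)"
      using sw_counit_right[of "\<lambda>a. f (S a)" g] by (simp add: left l\<Lambda> functional_def mult.commute)
    finally show ?thesis .
  qed
  then have "w = S g" by (rule functional_eqI)
  then show ?thesis using w by simp
qed

text \<open>With \<open>S\<^sup>2\<close> as Nakayama automorphism, the factor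
  \<open>x\<^sub>1\<close> moves to the right as \<open>S (S x\<^sub>1)\<close> and combines with
  \<open>S x\<^sub>2\<close> to \<open>S (S x\<^sub>1 x\<^sub>2)\<close>, the antipode of a scalar
  after summation.\<close>

lemma unimodular_ad_invariant:
  assumes l: "cointegral l" "l 1 = 1" and uni: "unimodular_hopf scale \<epsilon>"
  shows "ad_invariant l"
  unfolding ad_invariant_def
proof (intro allI)
  fix x h
  note [simp] = functional_simps[OF cointegral_functional[OF l(1)]] form_simps
  have "sw x (\<lambda>a b. l (a * h * S b)) = sw x (\<lambda>a b. l (h * S (S a * b)))"
  proof (intro sw_cong)
    fix a b
    show "l (a * h * S b) = l (h * S (S a * b))"
      using unimodular_nakayama[OF l uni, of a "h * S b"] by (simp only: S_mult mult.assoc)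
  qed
  also have "\<dots> = \<epsilon> x * l h"
    using sw_antipode_left[of "\<lambda>z. l (h * S z)" x] by (simp add: functional_def)
  finally show "sw x (\<lambda>a b. l (a * h * S b)) = \<epsilon> x * l h" .
qed

text \<open>Insert \<open>\<epsilon>(x\<^sub>2)\<close> in the form
  \<open>S (x\<^sub>2 S x\<^sub>3) = S (S x\<^sub>3) S x\<^sub>2\<close>; then
  \<open>x\<^sub>1\<close> and \<open>S x\<^sub>2\<close> form the adjoint action on
  \<open>h * S (S x\<^sub>3)\<close>, which invariance removes.\<close>

lemma ad_invariant_nakayama:
  assumes fl: "functional l" and ad: "ad_invariant l"
  shows "l (x * h) = l (h * S (S x))"
proof -
  note [simp] = functional_simps[OF fl] form_defs form_simps
  have "l (x * h) = sw x (\<lambda>a t. \<epsilon> t * l (a * h))"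
    using sw_counit_right[of "\<lambda>a. l (a * h)" x] by simp
  also have "\<dots> = sw x (\<lambda>a t. sw t (\<lambda>b c. l (a * (h * S (S c)) * S b)))"
  proof (intro sw_cong)
    fix a t
    show "\<epsilon> t * l (a * h) = sw t (\<lambda>b c. l (a * (h * S (S c)) * S b))"
      using sw_antipode_right[of "\<lambda>z. l (a * h * S z)" t] by (simp add: S_mult)
  qed
  also have "\<dots> = sw x (\<lambda>m c. sw m (\<lambda>a b. l (a * (h * S (S c)) * S b)))"
    by (rule sw_coassoc[symmetric]) simp
  also have "\<dots> = sw x (\<lambda>m c. \<epsilon> m * l (h * S (S c)))"
    using ad by (simp only: ad_invariant_def)
  also have "\<dots> = l (h * S (S x))"
    by (rule sw_counit_left) simp
  finally show ?thesis .
qed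

text \<open>The Nakayama rule exchanges the two sides of an integral: a left integral satisfies
  \<open>l (\<Lambda> * h) = \<epsilon> h * l \<Lambda>\<close>, and nondegeneracy lifts this from
  \<open>l\<close> to \<open>\<Lambda>\<close> itself. The other inclusion is symmetric.\<close>

lemma ad_invariant_unimodular:
  assumes l: "cointegral l" "l 1 = 1" and ad: "ad_invariant l"
  shows "unimodular_hopf scale \<epsilon>"
proof -
  have fl: "functional l" using l(1) by (rule cointegral_functional)
  note [simp] = functional_simps[OF fl] form_simps
  note nak = ad_invariant_nakayama[OF fl ad]
  \<comment> \<open>\<open>w\<close> inverts \<open>S \<circ> S\<close>, so that any element can
    stand on the right of the Nakayama rule.\<close>
  obtain w where w: "\<And>h. S (S (w h)) = h"
    using surj_f_inv_f[OF S_surj[OF l]] that[of "\<lambda>h. inv_into UNIV S (inv_into UNIV S h)"] by simp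
  have \<epsilon>_w: "\<epsilon> (w h) = \<epsilon> h" for h
    using w[of h] by (metis counit_S)
  \<comment> \<open>Nondegeneracy in the other argument, transported by the Nakayama rule.\<close>
  have nondeg: "y = 0" if y: "\<And>h. l (y * h) = 0" for y
  proof -
    have "S (S y) = 0"
      by (rule cointegral_nondegenerate_right[OF l]) (simp add: nak[symmetric] y)
    then show ?thesis using S_inj[OF l] by blast
  qed
  have "\<Lambda> \<in> right_integrals scale \<epsilon>" if "\<Lambda> \<in> left_integrals scale \<epsilon>" for \<Lambda>
  proof -
    have left: "h * \<Lambda> = scale (\<epsilon> h) \<Lambda>" for h using that by (simp add: left_integrals_def)
    have *: "l (\<Lambda> * h) = \<epsilon> h * l \<Lambda>" for h
      using nak[of "w h" \<Lambda>] by (simp add: w left \<epsilon>_w)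
    have "l ((\<Lambda> * h - scale (\<epsilon> h) \<Lambda>) * k) = 0" for h k
      using *[of k] *[of "h * k"] by (simp add: left_diff_distrib functional_diff[OF fl])
    then show ?thesis using nondeg unfolding right_integrals_def by fastforce
  qed
  moreover have "\<Lambda> \<in> left_integrals scale \<epsilon>" if "\<Lambda> \<in> right_integrals scale \<epsilon>" for \<Lambda>
  proof -
    have right: "\<Lambda> * h = scale (\<epsilon> h) \<Lambda>" for h using that by (simp add: right_integrals_def)
    have *: "l (h * \<Lambda>) = \<epsilon> h * l \<Lambda>" for h
      using nak[of h \<Lambda>] by (simp add: right)
    have "l (k * (h * \<Lambda> - scale (\<epsilon> h) \<Lambda>)) = 0" for h k
      using *[of k] *[of "k * h"] by (simp add: right_diff_distrib functional_diff[OF fl])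
    then show ?thesis using cointegral_nondegenerate_right[OF l] unfolding left_integrals_def by fastforce
  qed
  ultimately show ?thesis unfolding unimodular_hopf_def by blast
qed


section \<open>Cosemisimplicity\<close>

text \<open>A normal form modulo the multilinearity relations: only pairs of basis vectors occur,
  and the coefficients are values of bilinear forms. Hence bilinear forms detect equality of
  tensors.\<close>

lemma tensor2_eq_basis:
  "t - (\<Sum>i<d. \<Sum>j<d. formal_scale (linear_extension (*) (\<lambda>(a, b). crd i a * crd j b) t)
      (Poly_Mapping.single (bas i, bas j) 1))
    \<in> formal.span (multilinear_relations scale slots2)"
proof -
  let ?N = "formal.span (multilinear_relations scale slots2)"
  let ?s = "\<lambda>p. Poly_Mapping.single p (1::'k)"
  have slot: "?s (\<iota> (\<Sum>i\<in>I. scale (c i) (v i))) - (\<Sum>i\<in>I. formal_scale (c i) (?s (\<iota> (v i)))) \<in> ?N"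
    if "\<iota> \<in> slots2" "finite I" for \<iota> :: "'h \<Rightarrow> 'h \<times> 'h" and I :: "nat set" and c v
    using that(2)
  proof induction
    case empty
    \<comment> \<open>In the scaling relation for the scalar 0 the second term is a zero formal sum,
      so a tuple with a zero entry is itself a relation.\<close>
    have "?s (\<iota> (scale 0 0)) - Poly_Mapping.single (\<iota> 0) 0 \<in> ?N"
      by (rule formal.span_base) (use that(1) in \<open>unfold multilinear_relations_def, blast\<close>)
    then show ?case by simp
  next
    case (insert i I)
    let ?S = "\<Sum>i\<in>I. scale (c i) (v i)"
    have "?s (\<iota> (scale (c i) (v i) + ?S)) - ?s (\<iota> (scale (c i) (v i))) - ?s (\<iota> ?S) \<in> ?N"
      by (rule formal.span_base) (use that(1) in \<open>unfold multilinear_relations_def, blast\<close>)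
    moreover have "?s (\<iota> (scale (c i) (v i))) - Poly_Mapping.single (\<iota> (v i)) (c i) \<in> ?N"
      by (rule formal.span_base) (use that(1) in \<open>unfold multilinear_relations_def, blast\<close>)
    ultimately have "(?s (\<iota> (scale (c i) (v i) + ?S)) - ?s (\<iota> (scale (c i) (v i))) - ?s (\<iota> ?S))
       + (?s (\<iota> (scale (c i) (v i))) - Poly_Mapping.single (\<iota> (v i)) (c i))
       + (?s (\<iota> ?S) - (\<Sum>i\<in>I. formal_scale (c i) (?s (\<iota> (v i))))) \<in> ?N"
      using insert.IH by (intro formal.span_add)
    then show ?case using insert.hyps by (simp add: algebra_simps)
  qed
  have pair: "?s (a, b) - (\<Sum>i<d. \<Sum>j<d. formal_scale (crd i a * crd j b) (?s (bas i, bas j))) \<in> ?N" for a b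
  proof -
    have "?s (a, b) - (\<Sum>i<d. formal_scale (crd i a) (?s (bas i, b))) \<in> ?N"
      using slot[of "\<lambda>x. (x, b)" "{..<d}" "\<lambda>i. crd i a" bas] by (auto simp: slots2_def simp flip: expand)
    moreover have "(\<Sum>i<d. formal_scale (crd i a)
        (?s (bas i, b) - (\<Sum>j<d. formal_scale (crd j b) (?s (bas i, bas j))))) \<in> ?N"
    proof (intro formal.span_sum formal.span_scale)
      fix i
      show "?s (bas i, b) - (\<Sum>j<d. formal_scale (crd j b) (?s (bas i, bas j))) \<in> ?N"
        using slot[of "\<lambda>x. (bas i, x)" "{..<d}" "\<lambda>j. crd j b" bas] by (auto simp: slots2_def simp flip: expand)
    qed
    ultimately have "?s (a, b) - (\<Sum>i<d. formal_scale (crd i a) (?s (bas i, b))) + (\<Sum>i<d. formal_scale (crd i a)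
        (?s (bas i, b) - (\<Sum>j<d. formal_scale (crd j b) (?s (bas i, bas j))))) \<in> ?N"
      by (rule formal.span_add)
    then show ?thesis
      by (simp add: formal.scale_right_diff_distrib sum_subtractf formal.scale_sum_right)
  qed
  have t: "t = (\<Sum>p\<in>Poly_Mapping.keys t. formal_scale (Poly_Mapping.lookup t p) (?s p))"
    by (rule poly_mapping_eqI)
      (auto simp: lookup_sum lookup_single when_def in_keys_iff sum.delta' cong: if_cong)
  have swap: "(\<Sum>p\<in>K. \<Sum>i<d. \<Sum>j<d. g p i j) = (\<Sum>i<d. \<Sum>j<d. \<Sum>p\<in>K. g p i j)"
    for K :: "('h \<times> 'h) set" and g :: "'h \<times> 'h \<Rightarrow> nat \<Rightarrow> nat \<Rightarrow> ('h \<times> 'h \<Rightarrow>\<^sub>0 'k)"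
    by (subst sum.swap, rule sum.cong[OF refl], rule sum.swap)
  have "(\<Sum>p\<in>Poly_Mapping.keys t. formal_scale (Poly_Mapping.lookup t p)
      (?s p - (\<Sum>i<d. \<Sum>j<d. formal_scale (crd i (fst p) * crd j (snd p)) (?s (bas i, bas j))))) \<in> ?N"
    (is "(\<Sum>p\<in>_. formal_scale _ (?s p - ?r p)) \<in> _")
  proof (rule formal.span_sum, rule formal.span_scale)
    fix p
    show "?s p - ?r p \<in> ?N" using pair[of "fst p" "snd p"] by simp
  qed
  moreover have "(\<Sum>p\<in>Poly_Mapping.keys t. formal_scale (Poly_Mapping.lookup t p) (?s p - ?r p))
      = t - (\<Sum>p\<in>Poly_Mapping.keys t. formal_scale (Poly_Mapping.lookup t p) (?r p))"
    by (subst (3) t) (simp only: formal.scale_right_diff_distrib sum_subtractf)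
  moreover have "(\<Sum>p\<in>Poly_Mapping.keys t. formal_scale (Poly_Mapping.lookup t p) (?r p))
      = (\<Sum>i<d. \<Sum>j<d. formal_scale (linear_extension (*) (\<lambda>(a, b). crd i a * crd j b) t) (?s (bas i, bas j)))"
    unfolding formal.scale_sum_right formal.scale_scale swap
    by (simp only: linear_extension_def case_prod_beta' formal.scale_sum_left)
  ultimately show ?thesis by simp
qed

text \<open>The products of coordinate functions determine the normal form. Conditions on
  representatives of \<open>\<Delta> x\<close> can thus be stated through \<open>sw\<close>.\<close>

lemma tensor2_eq_iff:
  "tensor2_eq scale s t \<longleftrightarrow> (\<forall>F. bilinear_form F \<longrightarrow>
     linear_extension (*) (\<lambda>(a, b). F a b) s = linear_extension (*) (\<lambda>(a, b). F a b) t)"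
proof safe
  assume eq: "\<forall>F. bilinear_form F \<longrightarrow>
     linear_extension (*) (\<lambda>(a, b). F a b) s = linear_extension (*) (\<lambda>(a, b). F a b) t"
  let ?n = "\<lambda>t. \<Sum>i<d. \<Sum>j<d. formal_scale (linear_extension (*) (\<lambda>(a, b). crd i a * crd j b) t)
      (Poly_Mapping.single (bas i, bas j) 1)"
  have "bilinear_form (\<lambda>a b. crd i a * crd j b)" for i j
    by (simp add: form_defs form_simps functional_simps[OF crd_functional])
  then have "?n s = ?n t" using eq by simp
  moreover have "(s - ?n s) - (t - ?n t) \<in> formal.span (multilinear_relations scale slots2)"
    by (intro formal.span_diff tensor2_eq_basis)
  ultimately show "tensor2_eq scale s t"
    by (simp add: tensor2_eq_def)
qed (rule tensor2_eq_bilinear)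

lemma subcoalgebra_iff:
  "subcoalgebra scale \<Delta> D \<longleftrightarrow> subspace D \<and> (\<forall>x\<in>D. \<exists>t. Poly_Mapping.keys t \<subseteq> D \<times> D \<and>
     (\<forall>F. bilinear_form F \<longrightarrow> sw x F = linear_extension (*) (\<lambda>(a, b). F a b) t))"
  unfolding subcoalgebra_def tensor2_eq_iff sw_def ..

lemma subcoalgebra_subspace: "subcoalgebra scale \<Delta> D \<Longrightarrow> subspace D"
  by (simp add: subcoalgebra_def)

text \<open>The chosen \<open>\<Delta> x\<close> may involve elements outside \<open>D\<close>, but
  some equivalent formal sum lives on \<open>D \<times> D\<close>; so only the values of a form on
  \<open>D\<close> matter.\<close>

lemma subcoalgebra_sw_cong:
  assumes "subcoalgebra scale \<Delta> D" "x \<in> D" "bilinear_form F" "bilinear_form G"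
    and "\<And>a b. a \<in> D \<Longrightarrow> b \<in> D \<Longrightarrow> F a b = G a b"
  shows "sw x F = sw x G"
proof -
  obtain t where t: "Poly_Mapping.keys t \<subseteq> D \<times> D"
    and eq: "\<And>F. bilinear_form F \<Longrightarrow> sw x F = linear_extension (*) (\<lambda>(a, b). F a b) t"
    using assms(1,2) unfolding subcoalgebra_iff by meson
  have "linear_extension (*) (\<lambda>(a, b). F a b) t = linear_extension (*) (\<lambda>(a, b). G a b) t"
    unfolding linear_extension_def using t assms(5) by (intro sum.cong) auto
  then show ?thesis by (simp add: eq assms(3,4))
qed

lemma subcoalgebra_span_Union:
  assumes "\<And>D. D \<in> \<D> \<Longrightarrow> subcoalgebra scale \<Delta> D"
  shows "subcoalgebra scale \<Delta> (span (\<Union>\<D>))"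
  unfolding subcoalgebra_iff
proof (intro conjI ballI)
  fix x assume "x \<in> span (\<Union>\<D>)"
  then show "\<exists>t. Poly_Mapping.keys t \<subseteq> span (\<Union>\<D>) \<times> span (\<Union>\<D>) \<and>
     (\<forall>F. bilinear_form F \<longrightarrow> sw x F = linear_extension (*) (\<lambda>(a, b). F a b) t)"
  proof (induction rule: span_induct_alt)
    case base
    have "\<forall>F. bilinear_form F \<longrightarrow> sw 0 F = linear_extension (*) (\<lambda>(a, b). F a b) 0"
      using functional_zero[OF sw_functional] by (simp add: linear_extension_def)
    then show ?case by (intro exI[of _ 0]) simp
  next
    case (step c x y)
    then obtain D where D: "D \<in> \<D>" "x \<in> D" by blast
    obtain s where s: "Poly_Mapping.keys s \<subseteq> D \<times> D"
        "\<forall>F. bilinear_form F \<longrightarrow> sw x F = linear_extension (*) (\<lambda>(a, b). F a b) s"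
      using assms D unfolding subcoalgebra_iff by meson
    obtain t where t: "Poly_Mapping.keys t \<subseteq> span (\<Union>\<D>) \<times> span (\<Union>\<D>)"
        "\<forall>F. bilinear_form F \<longrightarrow> sw y F = linear_extension (*) (\<lambda>(a, b). F a b) t"
      using step.IH by meson
    have "Poly_Mapping.keys (formal_scale c s) \<subseteq> Poly_Mapping.keys s" by (auto simp: in_keys_iff)
    moreover have "D \<subseteq> span (\<Union>\<D>)" using D(1) by (meson Sup_upper order_trans span_superset)
    ultimately have "Poly_Mapping.keys (formal_scale c s + t) \<subseteq> span (\<Union>\<D>) \<times> span (\<Union>\<D>)"
      using s(1) t(1) keys_add[of "formal_scale c s" t] by blast
    moreover have "\<forall>F. bilinear_form F \<longrightarrow>
        sw (scale c x + y) F = linear_extension (*) (\<lambda>(a, b). F a b) (formal_scale c s + t)"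
      using s(2) t(2) by (simp add: sw_add sw_scale field_vs.linear_extension_add
        field_vs.linear_extension_formal_scale)
    ultimately show ?case by blast
  qed
qed simp

lemma projection_exists:
  assumes "subspace D"
  obtains p where "\<And>x. p x \<in> D" "\<And>x. x \<in> D \<Longrightarrow> p x = x"
    "\<And>x y. p (x + y) = p x + p y" "\<And>c x. p (scale c x) = scale c (p x)"
proof -
  interpret vector_space_pair scale scale by unfold_locales
  have "Vector_Spaces.linear scale scale id" by (rule linearI) simp_all
  from linear_exists_left_inverse_on[OF this assms] obtain p where p: "range p \<subseteq> D"
    "Vector_Spaces.linear scale scale p" "\<forall>v\<in>D. p v = v"
    by auto
  interpret p: Vector_Spaces.linear scale scale p by fact
  show ?thesis using p by (intro that[of p]) (auto simp: p.add p.scale)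
qed

lemma functional_separating:
  assumes "subspace D" "y \<notin> D"
  obtains f where "functional f" "f y = 1" "\<And>x. x \<in> D \<Longrightarrow> f x = 0"
proof -
  obtain p where p: "\<And>x. p x \<in> D" "\<And>x. x \<in> D \<Longrightarrow> p x = x"
    "\<And>x y. p (x + y) = p x + p y" "\<And>c x. p (scale c x) = scale c (p x)"
    using projection_exists[OF assms(1)] by blast
  have "y \<noteq> p y" using p(1)[of y] assms(2) by auto
  then obtain f where f: "functional f" "f y \<noteq> f (p y)" using functional_eqI by blast
  let ?c = "f y - f (p y)"
  show ?thesis
  proof (rule that[of "\<lambda>x. (f x - f (p x)) / ?c"])
    show "functional (\<lambda>x. (f x - f (p x)) / ?c)"
      by (simp add: functional_def p functional_simps[OF f(1)] add_divide_distrib diff_divide_distrib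
        right_diff_distrib)
  qed (use p f(2) in auto)
qed

lemma subspace_memI:
  assumes "subspace D" "\<And>f. functional f \<Longrightarrow> (\<And>x. x \<in> D \<Longrightarrow> f x = 0) \<Longrightarrow> f y = 0"
  shows "y \<in> D"
  using functional_separating[OF assms(1)] assms(2) by (metis zero_neq_one)

lemma grouplike_one_subcoalgebra: "subcoalgebra scale \<Delta> (span {1})"
proof -
  have "\<exists>t. Poly_Mapping.keys t \<subseteq> span {1} \<times> span {1} \<and>
      (\<forall>F. bilinear_form F \<longrightarrow> sw x F = linear_extension (*) (\<lambda>(a, b). F a b) t)" if x: "x \<in> span {1}" for x
  proof -
    obtain c where c: "x = scale c 1" using x by (auto simp: span_singleton)
    have "Poly_Mapping.keys (Poly_Mapping.single (1::'h, 1::'h) c) \<subseteq> span {1} \<times> span {1}"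
      by (auto intro: span_base split: if_splits)
    moreover have "\<forall>F. bilinear_form F \<longrightarrow>
        sw x F = linear_extension (*) (\<lambda>(a, b). F a b) (Poly_Mapping.single (1, 1) c)"
      by (simp add: c sw_scale sw_one)
    ultimately show ?thesis by blast
  qed
  then show ?thesis unfolding subcoalgebra_iff by simp
qed

text \<open>
  Convolution products of functionals that separate 1 from the single subcoalgebras separate 1 from
  finitely many of them simultaneously.
\<close>

lemma separate_one:
  assumes "finite \<E>" "\<And>E. E \<in> \<E> \<Longrightarrow> subcoalgebra scale \<Delta> E \<and> 1 \<notin> E"
  shows "\<exists>f. functional f \<and> f 1 = 1 \<and> (\<forall>E\<in>\<E>. \<forall>x\<in>E. f x = 0)"
  using assms
proof (induction \<E>)
  case empty
  then show ?case using counit_functional counit_one by blast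
next
  case (insert E \<E>)
  have "\<exists>f. functional f \<and> f 1 = 1 \<and> (\<forall>E\<in>\<E>. \<forall>x\<in>E. f x = 0)"
    by (rule insert.IH) (use insert.prems in auto)
  then obtain f where f: "functional f" "f 1 = 1" "\<And>E x. E \<in> \<E> \<Longrightarrow> x \<in> E \<Longrightarrow> f x = 0" by metis
  have E: "subcoalgebra scale \<Delta> E" "1 \<notin> E" using insert.prems by auto
  obtain g where g: "functional g" "g 1 = 1" "\<And>x. x \<in> E \<Longrightarrow> g x = 0"
    using functional_separating[OF subcoalgebra_subspace[OF E(1)] E(2)] by blast
  note [simp] = form_defs form_simps functional_simps[OF f(1)] functional_simps[OF g(1)]
  let ?h = "\<lambda>x. sw x (\<lambda>a b. f a * g b)"
  have "?h x = 0" if "D \<in> insert E \<E>" "x \<in> D" for D x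
  proof -
    have "?h x = sw x (\<lambda>a b. 0)"
      by (rule subcoalgebra_sw_cong[of D]) (use that insert.prems f g in auto)
    then show ?thesis by (simp add: sw_sum)
  qed
  moreover have "?h 1 = 1" by (subst sw_one) (simp_all add: f g)
  ultimately show ?case by (intro exI[of _ ?h]) simp
qed

text \<open>On a simple subcoalgebra without 1 both sides of the cointegral law vanish; a simple one
  containing 1 is the line through 1, where the law holds because 1 is grouplike.\<close>

lemma cosemisimple_cointegral:
  assumes "cosemisimple scale \<Delta>"
  obtains l where "cointegral l" "l 1 = 1"
proof -
  let ?U = "\<Union>{D. simple_subcoalgebra scale \<Delta> D \<and> 1 \<notin> D}"
  \<comment> \<open>A basis of the span of these subcoalgebras is finite and meets only finitely
    many chosen ones, the situation that \<open>separate_one\<close> handles.\<close>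
  obtain B where B: "B \<subseteq> ?U" "independent B" "?U \<subseteq> span B"
    by (rule maximal_independent_subset)
  then have "\<forall>b\<in>B. \<exists>E. simple_subcoalgebra scale \<Delta> E \<and> 1 \<notin> E \<and> b \<in> E" by blast
  then obtain E where E: "\<And>b. b \<in> B \<Longrightarrow> simple_subcoalgebra scale \<Delta> (E b) \<and> 1 \<notin> E b \<and> b \<in> E b"
    by metis
  have "\<exists>l. functional l \<and> l 1 = 1 \<and> (\<forall>D\<in>E ` B. \<forall>x\<in>D. l x = 0)"
    by (rule separate_one) (use finiteI_independent[OF B(2)] E in \<open>auto simp: simple_subcoalgebra_def\<close>)
  then obtain l where l: "functional l" "l 1 = 1" and lB: "\<And>b. b \<in> B \<Longrightarrow> l b = 0"
    using E by fastforce
  have lU: "l x = 0" if "simple_subcoalgebra scale \<Delta> D" "1 \<notin> D" "x \<in> D" for x D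
  proof -
    interpret l: Vector_Spaces.linear scale "(*)" l using l(1) by (simp add: functional_linear)
    have "x \<in> span B" using that B(3) by blast
    then show ?thesis by (rule l.eq_0_on_span[rotated]) (rule lB)
  qed
  have "cointegral l" unfolding cointegral_def
  proof (intro conjI allI impI)
    fix f x assume f: "functional f"
    note [simp] = form_defs form_simps functional_simps[OF f] functional_simps[OF l(1)]
    have "x \<in> span (\<Union>{D. simple_subcoalgebra scale \<Delta> D})"
      using assms by (simp add: cosemisimple_def)
    then show "sw x (\<lambda>a b. f a * l b) = l x * f 1"
    proof (induction rule: span_induct_alt)
      case base
      show ?case using functional_zero[OF l(1)] functional_zero[OF sw_functional] by simp
    next
      case (step c x y)
      then obtain D where D: "simple_subcoalgebra scale \<Delta> D" "x \<in> D" by blast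
      then have sub: "subcoalgebra scale \<Delta> D" by (simp add: simple_subcoalgebra_def)
      have "sw x (\<lambda>a b. f a * l b) = l x * f 1"
      proof (cases "1 \<in> D")
        case True
        then have "span {1} \<subseteq> D" using subcoalgebra_subspace[OF sub] by (intro span_minimal) auto
        moreover have "span {1} \<noteq> {0::'h}" using span_base[of 1 "{1}"] by auto
        ultimately have "D = span {1}"
          using D(1) grouplike_one_subcoalgebra unfolding simple_subcoalgebra_def by metis
        then obtain c where "x = scale c 1" using D(2) by (auto simp: span_singleton)
        then show ?thesis by (simp add: sw_one l)
      next
        case False
        have "sw x (\<lambda>a b. f a * l b) = sw x (\<lambda>a b. 0)"
          by (rule subcoalgebra_sw_cong[OF sub D(2)]) (use lU[OF D(1) False] in auto)
        then show ?thesis using lU[OF D(1) False D(2)] by (simp add: sw_sum)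
      qed
      then show ?case using step.IH by simp
    qed
  qed (rule l(1))
  then show ?thesis using that l(2) by blast
qed

text \<open>The mirror image of \<open>cointegral_antipode\<close> for \<open>l \<circ> S\<close>:
  that lemma is applied to \<open>S h\<close> and \<open>S g\<close>, with \<open>f\<close> composed
  with the inverse of \<open>S\<close>, and \<open>S\<close> reverses
  \<open>\<Delta>\<close>.\<close>

lemma cointegral_comp_antipode_right:
  assumes l: "cointegral l" "l 1 = 1" and f: "functional f"
  shows "sw h (\<lambda>a b. l (S (S g * a)) * f b) = sw g (\<lambda>a b. f a * l (S (S b * h)))"
    (is "?l = ?r")
proof -
  obtain w where Sw: "\<And>x. S (w x) = x"
    using surj_f_inv_f[OF S_surj[OF l]] that[of "inv_into UNIV S"] by simp
  have S_eqI: "x = y" if "S x = S y" for x y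
  proof -
    interpret S: Vector_Spaces.linear scale scale S by (rule antipode_linear)
    show ?thesis using S_inj[OF l, of "x - y"] that by (simp add: S.diff)
  qed
  have w_lin: "w (x + y) = w x + w y" "w (scale c x) = scale c (w x)" and wS: "w (S x) = x" for x y c
    by (rule S_eqI, simp add: S_add S_scale Sw)+
  have fw: "functional (\<lambda>x. f (w x))"
    using f by (simp add: functional_def w_lin)
  note [simp] = functional_simps[OF f] functional_simps[OF cointegral_functional[OF l(1)]] form_defs form_simps w_lin
  have "?l = sw (S h) (\<lambda>x y. f (w x) * l (y * S (S g)))"
    by (subst sw_S) (simp_all add: wS S_mult mult.commute[of "f _"])
  also have "\<dots> = sw (S g) (\<lambda>a b. l (S h * S a) * f (w b))"
    by (rule cointegral_antipode[OF l(1) fw])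
  also have "\<dots> = ?r"
    by (subst sw_S) (simp_all add: wS S_mult mult.commute[of "f _"])
  finally show ?thesis .
qed

text \<open>
  Dual Maschke: averaging a linear projection onto a subcoalgebra over the cointegral, on the left and
  on the right, gives functionals \<open>\<chi>\<close> and \<open>\<psi>\<close> such that \<open>h \<mapsto> \<chi>(h\<^sub>1) h\<^sub>2\<close> and \<open>h \<mapsto> h\<^sub>1 \<psi>(h\<^sub>2)\<close> are again
  projections onto it. They coincide, so this is a projection of bicomodules.
\<close>

lemma subcoalgebra_complement:
  assumes l: "cointegral l" "l 1 = 1" and D: "subcoalgebra scale \<Delta> D"
  obtains K where "subcoalgebra scale \<Delta> K" "D \<inter> K = {0}" "\<And>x. \<exists>a\<in>D. \<exists>b\<in>K. x = a + b"
proof -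
  have subD: "subspace D" using D by (rule subcoalgebra_subspace)
  obtain p where p: "\<And>x. p x \<in> D" "\<And>x. x \<in> D \<Longrightarrow> p x = x"
    "\<And>x y. p (x + y) = p x + p y" "\<And>c x. p (scale c x) = scale c (p x)"
    using projection_exists[OF subD] by blast
  note [simp] = functional_simps[OF cointegral_functional[OF l(1)]] form_defs form_simps p(3,4)
  \<comment> \<open>With \<open>p\<close> replaced by the identity, the antipode law and
    \<open>l 1 = 1\<close> would give \<open>\<epsilon>\<close> in both cases; on \<open>D\<close>
    this is what happens.\<close>
  define \<chi> where "\<chi> h = sw h (\<lambda>u v. l (p u * S v))" for h
  define \<psi> where "\<psi> h = sw h (\<lambda>u v. l (S (S u * p v)))" for h
  have \<chi>: "functional \<chi>" and \<psi>: "functional \<psi>" by (simp_all add: \<chi>_def \<psi>_def)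
  note [simp] = functional_simps[OF \<chi>] functional_simps[OF \<psi>]
  define P where "P h = linear_extension scale (\<lambda>(a, b). scale (\<chi> a) b) (\<Delta> h)" for h
  define Q where "Q h = linear_extension scale (\<lambda>(a, b). scale (\<psi> b) a) (\<Delta> h)" for h
  have P: "f (P h) = sw h (\<lambda>a b. \<chi> a * f b)" and Q: "f (Q h) = sw h (\<lambda>a b. f a * \<psi> b)" if "functional f" for f h
    unfolding P_def Q_def functional_sw[OF that] by (simp_all add: functional_scale[OF that] mult.commute)
  have P_lin: "P (x + y) = P x + P y" "P (scale c x) = scale c (P x)" for x y c
  proof -
    show "P (x + y) = P x + P y"
    proof (rule functional_eqI)
      fix f assume f: "functional f" note [simp] = functional_simps[OF f]
      show "f (P (x + y)) = f (P x + P y)" by (simp add: P[OF f])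
    qed
    show "P (scale c x) = scale c (P x)"
    proof (rule functional_eqI)
      fix f assume f: "functional f" note [simp] = functional_simps[OF f]
      show "f (P (scale c x)) = f (scale c (P x))" by (simp add: P[OF f])
    qed
  qed
  \<comment> \<open>By \<open>cointegral_antipode\<close>, \<open>P h\<close> is
    \<open>(p h\<^sub>1)\<^sub>1\<close> weighted with
    \<open>l ((p h\<^sub>1)\<^sub>2 S h\<^sub>2)\<close>, and \<open>\<Delta>(p h\<^sub>1)\<close>
    has a representative on \<open>D \<times> D\<close>.\<close>
  have PD: "P h \<in> D" for h
  proof (rule subspace_memI[OF subD])
    fix f assume f: "functional f" and f0: "\<And>x. x \<in> D \<Longrightarrow> f x = 0"
    note [simp] = functional_simps[OF f]
    have "f (P h) = sw h (\<lambda>u t. sw t (\<lambda>v b. l (p u * S v) * f b))"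
      unfolding P[OF f] \<chi>_def sw_cmult_right[symmetric] by (rule sw_coassoc) simp
    also have "\<dots> = sw h (\<lambda>u t. sw (p u) (\<lambda>r s. f r * l (s * S t)))"
      by (simp only: cointegral_antipode[OF l(1) f])
    also have "\<dots> = sw h (\<lambda>u t. sw (p u) (\<lambda>r s. 0))"
      by (intro sw_cong subcoalgebra_sw_cong[OF D p(1)]) (simp_all add: f0)
    finally show "f (P h) = 0" by (simp add: sw_sum)
  qed
  have QD: "Q h \<in> D" for h
  proof (rule subspace_memI[OF subD])
    fix f assume f: "functional f" and f0: "\<And>x. x \<in> D \<Longrightarrow> f x = 0"
    note [simp] = functional_simps[OF f]
    have "f (Q h) = sw h (\<lambda>m v. sw m (\<lambda>a u. f a * l (S (S u * p v))))"
      unfolding Q[OF f] \<psi>_def sw_cmult[symmetric] by (rule sw_coassoc[symmetric]) simp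
    also have "\<dots> = sw h (\<lambda>m v. sw (p v) (\<lambda>r s. l (S (S m * r)) * f s))"
      by (simp only: cointegral_comp_antipode_right[OF l f])
    also have "\<dots> = sw h (\<lambda>m v. sw (p v) (\<lambda>r s. 0))"
      by (intro sw_cong subcoalgebra_sw_cong[OF D p(1)]) (simp_all add: f0)
    finally show "f (Q h) = 0" by (simp add: sw_sum)
  qed
  have \<chi>D: "\<chi> x = \<epsilon> x" if "x \<in> D" for x
  proof -
    have "\<chi> x = sw x (\<lambda>u v. l (u * S v))"
      unfolding \<chi>_def by (rule subcoalgebra_sw_cong[OF D that]) (simp_all add: p(2))
    then show ?thesis using sw_antipode_right[OF cointegral_functional[OF l(1)], of x] l(2) by simp
  qed
  have \<psi>D: "\<psi> x = \<epsilon> x" if "x \<in> D" for x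
  proof -
    have "\<psi> x = sw x (\<lambda>u v. l (S (S u * v)))"
      unfolding \<psi>_def by (rule subcoalgebra_sw_cong[OF D that]) (simp_all add: p(2))
    then show ?thesis using sw_antipode_left[of "\<lambda>z. l (S z)" x] l(2) by simp
  qed
  have P_id: "P x = x" and Q_id: "Q x = x" if x: "x \<in> D" for x
  proof -
    show "P x = x"
    proof (rule functional_eqI)
      fix f assume f: "functional f" note [simp] = functional_simps[OF f]
      have "f (P x) = sw x (\<lambda>a b. \<epsilon> a * f b)"
        unfolding P[OF f] by (rule subcoalgebra_sw_cong[OF D x]) (simp_all add: \<chi>D)
      then show "f (P x) = f x" using sw_counit_left[OF f] by simp
    qed
    show "Q x = x"
    proof (rule functional_eqI)
      fix f assume f: "functional f" note [simp] = functional_simps[OF f]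
      have "f (Q x) = sw x (\<lambda>a b. f a * \<epsilon> b)"
        unfolding Q[OF f] by (rule subcoalgebra_sw_cong[OF D x]) (simp_all add: \<psi>D)
      then show "f (Q x) = f x" using sw_counit_right[OF f] by (simp add: mult.commute)
    qed
  qed
  \<comment> \<open>\<open>P\<close> and \<open>Q\<close> act on opposite sides of the coalgebra, so
    they commute by coassociativity; two commuting projections onto the same subspace
    coincide.\<close>
  have PQ: "P h = Q h" for h
  proof -
    have "Q (P h) = P (Q h)"
    proof (rule functional_eqI)
      fix f assume f: "functional f" note [simp] = functional_simps[OF f]
      have "f (Q (P h)) = sw h (\<lambda>a b. \<chi> a * sw b (\<lambda>u v. f u * \<psi> v))"
        unfolding Q[OF f] by (rule P) simp
      also have "\<dots> = sw h (\<lambda>a b. sw b (\<lambda>u v. \<chi> a * (f u * \<psi> v)))"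
        by (simp only: sw_cmult)
      also have "\<dots> = sw h (\<lambda>m v. sw m (\<lambda>a u. \<chi> a * (f u * \<psi> v)))"
        by (rule sw_coassoc[symmetric]) simp
      also have "\<dots> = sw h (\<lambda>m v. sw m (\<lambda>a u. \<chi> a * f u) * \<psi> v)"
        by (simp only: sw_cmult_right[symmetric] mult.assoc)
      also have "\<dots> = f (P (Q h))"
        unfolding P[OF f] by (rule Q[symmetric]) simp
      finally show "f (Q (P h)) = f (P (Q h))" .
    qed
    then show ?thesis using Q_id[OF PD] P_id[OF QD] by simp
  qed
  \<comment> \<open>\<open>P\<close> is compatible with one coaction by its form, and with the other
    because it equals \<open>Q\<close>.\<close>
  have sw_P: "sw h (\<lambda>a b. F (P a) b) = sw (P h) F" if F: "bilinear_form F" for F h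
  proof -
    have [simp]: "F (x + y) = (\<lambda>z. F x z + F y z)" "F z (x + y) = F z x + F z y"
      "F (scale c x) = (\<lambda>y. c * F x y)" "F x (scale c y) = c * F x y" for x y z c
      using F by (auto simp: form_defs)
    have "sw h (\<lambda>a b. F (P a) b) = sw h (\<lambda>a b. sw a (\<lambda>u v. \<chi> u * F v b))"
      by (intro sw_cong P) simp
    also have "\<dots> = sw h (\<lambda>u t. sw t (\<lambda>v b. \<chi> u * F v b))"
      by (rule sw_coassoc) simp
    also have "\<dots> = sw (P h) F"
      using P[OF sw_functional[OF F], of h] by (simp only: sw_cmult)
    finally show ?thesis .
  qed
  have sw_Q: "sw h (\<lambda>a b. F a (P b)) = sw (P h) F" if F: "bilinear_form F" for F h
  proof -
    have [simp]: "F (x + y) = (\<lambda>z. F x z + F y z)" "F z (x + y) = F z x + F z y"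
      "F (scale c x) = (\<lambda>y. c * F x y)" "F x (scale c y) = c * F x y" for x y z c
      using F by (auto simp: form_defs)
    have "sw h (\<lambda>a b. F a (P b)) = sw h (\<lambda>a b. sw b (\<lambda>u v. F a u * \<psi> v))"
      unfolding PQ by (intro sw_cong Q) simp
    also have "\<dots> = sw h (\<lambda>t v. sw t (\<lambda>a u. F a u * \<psi> v))"
      by (rule sw_coassoc[symmetric]) simp
    also have "\<dots> = sw (P h) F"
      using Q[OF sw_functional[OF F], of h] by (simp only: sw_cmult_right PQ)
    finally show ?thesis .
  qed
  let ?K = "{h. P h = 0}"
  have P0: "P 0 = 0" using P_lin(2)[of 0 0] by simp
  have P_diff: "P (x - y) = P x - P y" for x y
    using P_lin(1)[of "x - y" y] by simp
  have "subspace ?K" by (simp add: subspace_def P0 P_lin)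
  moreover have "\<exists>t. Poly_Mapping.keys t \<subseteq> ?K \<times> ?K \<and>
      (\<forall>F. bilinear_form F \<longrightarrow> sw h F = linear_extension (*) (\<lambda>(a, b). F a b) t)" if h: "h \<in> ?K" for h
  proof (intro exI conjI allI impI)
    \<comment> \<open>The representative is \<open>\<Delta> h\<close> with \<open>id - P\<close>
      applied to both factors; each of the three correction terms equals
      \<open>\<Delta>(P h)\<close>, which vanishes.\<close>
    let ?t = "linear_extension formal_scale (\<lambda>(a, b). Poly_Mapping.single (a - P a, b - P b) (1::'k)) (\<Delta> h)"
    have "Poly_Mapping.keys ?t \<subseteq> (\<Union>q\<in>Poly_Mapping.keys (\<Delta> h). {(fst q - P (fst q), snd q - P (snd q))})"
      unfolding linear_extension_def by (rule order_trans[OF keys_sum]) (auto split: if_splits)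
    also have "\<dots> \<subseteq> ?K \<times> ?K" by (auto simp: P_diff P_id[OF PD])
    finally show "Poly_Mapping.keys ?t \<subseteq> ?K \<times> ?K" .
    fix F assume F: "bilinear_form F"
    have [simp]: "F (x + y) = (\<lambda>z. F x z + F y z)" "F z (x + y) = F z x + F z y"
      "F (scale c x) = (\<lambda>y. c * F x y)" "F x (scale c y) = c * F x y" for x y z c
      using F by (auto simp: form_defs)
    have FP: "bilinear_form (\<lambda>a b. F a (P b))" by (simp add: P_lin)
    have zero: "sw (P h) G = 0" if "bilinear_form G" for G
      using h functional_zero[OF sw_functional[OF that]] by simp
    have diff: "F (x - y) (u - v) = F x u + (-1) * F y u + (-1) * F x v + F y v" for x y u v
    proof -
      have "F (x - y) z = F x z - F y z" "F z (x - y) = F z x - F z y" for x y z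
        using F by (auto simp: bilinear_form_def intro: functional_diff[of "\<lambda>x. F x z"] functional_diff)
      then show ?thesis by simp
    qed
    have "linear_extension (*) (\<lambda>(a, b). F a b) ?t = sw h (\<lambda>a b. F (a - P a) (b - P b))"
      using linear_comp_linear_extension[OF field_vs.linear_extension_linear[of "\<lambda>(a, b). F a b"],
          of "\<lambda>(a, b). Poly_Mapping.single (a - P a, b - P b) 1" "\<Delta> h"]
      by (simp add: sw_def case_prod_beta')
    also have "\<dots> = sw h F + (-1) * sw h (\<lambda>a b. F (P a) b) + (-1) * sw h (\<lambda>a b. F a (P b))
        + sw h (\<lambda>a b. F (P a) (P b))"
      by (simp only: diff sw_distrib sw_cmult)
    also have "\<dots> = sw h F"
      by (simp only: sw_P[OF F] sw_Q[OF F] sw_P[OF FP] P_id[OF PD] zero[OF F]) simp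
    finally show "sw h F = linear_extension (*) (\<lambda>(a, b). F a b) ?t" ..
  qed
  ultimately have "subcoalgebra scale \<Delta> ?K" unfolding subcoalgebra_iff by blast
  moreover have "D \<inter> ?K = {0}"
    using P_id subspace_0[OF subD] P0 by force
  moreover have "\<exists>a\<in>D. \<exists>b\<in>?K. x = a + b" for x
    by (rule bexI[OF _ PD[of x]], rule bexI[of _ "x - P x"]) (simp_all add: P_diff P_id[OF PD])
  ultimately show ?thesis by (rule that)
qed

text \<open>A nonzero subcoalgebra of least dimension inside \<open>K\<close> is simple.\<close>

lemma subcoalgebra_simple_exists:
  assumes "subcoalgebra scale \<Delta> K" "K \<noteq> {0}"
  obtains D where "simple_subcoalgebra scale \<Delta> D" "D \<subseteq> K"
proof -
  let ?P = "\<lambda>D. subcoalgebra scale \<Delta> D \<and> D \<subseteq> K \<and> D \<noteq> {0}"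
  have "?P (arg_min dim ?P)" and min: "?P E \<Longrightarrow> dim (arg_min dim ?P) \<le> dim E" for E
    using arg_min_nat_lemma[of ?P K dim] assms by blast+
  then show ?thesis
    using that[of "arg_min dim ?P"] subspace_dim_equal[OF subcoalgebra_subspace subcoalgebra_subspace]
    unfolding simple_subcoalgebra_def by (metis (no_types, lifting) order_trans)
qed

text \<open>A nonzero complement of the coradical would contain a simple subcoalgebra, which lies in
  the coradical as well.\<close>

lemma cointegral_cosemisimple:
  assumes l: "cointegral l" "l 1 = 1"
  shows "cosemisimple scale \<Delta>"
  unfolding cosemisimple_def
proof (rule ccontr)
  let ?C = "span (\<Union>{D. simple_subcoalgebra scale \<Delta> D})"
  assume ne: "?C \<noteq> UNIV"
  have "subcoalgebra scale \<Delta> ?C"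
    by (rule subcoalgebra_span_Union) (auto simp: simple_subcoalgebra_def)
  then obtain K where K: "subcoalgebra scale \<Delta> K" "?C \<inter> K = {0}" "\<And>x. \<exists>a\<in>?C. \<exists>b\<in>K. x = a + b"
    using subcoalgebra_complement[OF l] by blast
  have "K \<noteq> {0}" using K(3) ne by fastforce
  then obtain D where D: "simple_subcoalgebra scale \<Delta> D" "D \<subseteq> K"
    using subcoalgebra_simple_exists[OF K(1)] by blast
  have "D \<subseteq> ?C" using D(1) by (auto intro!: span_base)
  then have "D \<subseteq> {0}" using D(2) K(2) by blast
  moreover have "0 \<in> D"
    using D(1) by (simp add: simple_subcoalgebra_def subspace_0 subcoalgebra_subspace)
  ultimately show False using D(1) by (auto simp: simple_subcoalgebra_def)
qed

theorem cosemisimple_unimodular_iff: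
  "cosemisimple scale \<Delta> \<and> unimodular_hopf scale \<epsilon> \<longleftrightarrow>
    (\<exists>l. cointegral l \<and> l 1 = 1 \<and> ad_invariant l)"
  using cosemisimple_cointegral cointegral_cosemisimple unimodular_ad_invariant ad_invariant_unimodular
  by metis

end

section \<open>Kronecker products\<close>

no_notation mult (infixl \<open>\<otimes>\<index>\<close> 70)
notation kronecker (infixr \<open>\<otimes>\<close> 75)

abbreviation identity_mat (\<open>\<I>\<close>) where "\<I> \<equiv> one_mat"

lemma dim_kronecker [simp]:
  "dim_row (A \<otimes> B) = dim_row A * dim_row B" "dim_col (A \<otimes> B) = dim_col A * dim_col B"
  by (simp_all add: kronecker_def)

lemma kronecker_index:
  "i < dim_row A * dim_row B \<Longrightarrow> j < dim_col A * dim_col B \<Longrightarrow> (A \<otimes> B) $$ (i, j) =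
    A $$ (i div dim_row B, j div dim_col B) * B $$ (i mod dim_row B, j mod dim_col B)"
  by (simp add: kronecker_def)

lemma kronecker_carrier [intro, simp]:
  "A \<in> carrier_mat n m \<Longrightarrow> B \<in> carrier_mat p q \<Longrightarrow> A \<otimes> B \<in> carrier_mat (n * p) (m * q)"
  by (metis carrier_matD carrier_matI dim_kronecker)

lemma div_less_factor: "i < n * m \<Longrightarrow> i div m < (n::nat)"
  by (simp add: less_mult_imp_div_less)

lemma mod_less_factor: "i < n * m \<Longrightarrow> i mod m < (m::nat)"
  by (metis mod_less_divisor mult_0_right not_gr_zero not_less_zero)

lemma nat_pair_less: "i < n \<Longrightarrow> j < m \<Longrightarrow> i * m + j < n * (m::nat)"
proof -
  assume "i < n" "j < m"
  then have "i * m + j < Suc i * m" "Suc i * m \<le> n * m"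
    by simp (metis Suc_leI \<open>i < n\<close> mult_le_mono1)
  then show ?thesis by linarith
qed

lemma sum_div_mod: "(\<Sum>k<n * m. f (k div m) (k mod m)) = (\<Sum>i<n. \<Sum>j<m. f i (j::nat))"
proof (cases "m = 0")
  case False
  have "(\<Sum>k<n * m. f (k div m) (k mod m)) = (\<Sum>(i, j)\<in>{..<n} \<times> {..<m}. f i j)"
    by (rule sum.reindex_bij_witness[of _ "\<lambda>(i, j). i * m + j" "\<lambda>k. (k div m, k mod m)"])
      (use False in \<open>auto simp: div_less_factor nat_pair_less\<close>)
  then show ?thesis by (simp add: sum.cartesian_product)
qed simp

lemma mat_mult_index_sum:
  "i < dim_row A \<Longrightarrow> j < dim_col B \<Longrightarrow> dim_col A = dim_row B \<Longrightarrow>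
    (A * B) $$ (i, j) = (\<Sum>k<dim_row B. A $$ (i, k) * B $$ (k, j))"
  by (simp add: scalar_prod_def atLeast0LessThan)

lemma kronecker_mult:
  fixes A :: "'a::comm_semiring_0 mat"
  assumes "dim_col A = dim_row B" "dim_col C = dim_row D"
  shows "(A \<otimes> C) * (B \<otimes> D) = (A * B) \<otimes> (C * D)"
    (is "?l = ?r")
proof (rule eq_matI)
  fix i j
  assume "i < dim_row ?r" "j < dim_col ?r"
  then have ij: "i < dim_row A * dim_row C" "j < dim_col B * dim_col D" by simp_all
  note b = div_less_factor[OF ij(1)] mod_less_factor[OF ij(1)] div_less_factor[OF ij(2)] mod_less_factor[OF ij(2)]
  let ?i1 = "i div dim_row C" and ?i2 = "i mod dim_row C"
  let ?j1 = "j div dim_col D" and ?j2 = "j mod dim_col D"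
  have "?l $$ (i, j)
      = (\<Sum>k<dim_row B * dim_row D. (A \<otimes> C) $$ (i, k) * (B \<otimes> D) $$ (k, j))"
    using ij assms by (subst mat_mult_index_sum) simp_all
  also have "\<dots> = (\<Sum>k<dim_row B * dim_row D.
      (\<lambda>k1 k2. A $$ (?i1, k1) * C $$ (?i2, k2) * (B $$ (k1, ?j1) * D $$ (k2, ?j2)))
        (k div dim_row D) (k mod dim_row D))"
    using ij assms by (intro sum.cong) (simp_all add: kronecker_index)
  also have "\<dots> = (\<Sum>k1<dim_row B. \<Sum>k2<dim_row D.
      A $$ (?i1, k1) * C $$ (?i2, k2) * (B $$ (k1, ?j1) * D $$ (k2, ?j2)))"
    by (rule sum_div_mod)
  also have "\<dots> = (\<Sum>k1<dim_row B. A $$ (?i1, k1) * B $$ (k1, ?j1)) * (\<Sum>k2<dim_row D. C $$ (?i2, k2) * D $$ (k2, ?j2))"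
    by (simp add: sum_product ac_simps)
  also have "\<dots> = ?r $$ (i, j)"
    using ij b assms by (simp add: kronecker_index mat_mult_index_sum del: index_mult_mat(1))
  finally show "?l $$ (i, j) = ?r $$ (i, j)" .
qed simp_all

lemma kronecker_assoc:
  fixes A :: "'a::semiring_0 mat"
  shows "(A \<otimes> B) \<otimes> C = A \<otimes> B \<otimes> C"
    (is "?l = ?r")
proof (rule eq_matI)
  fix i j
  assume "i < dim_row ?r" "j < dim_col ?r"
  then have ij: "i < (dim_row A * dim_row B) * dim_row C" "j < (dim_col A * dim_col B) * dim_col C"
    and ij': "i < dim_row A * (dim_row B * dim_row C)" "j < dim_col A * (dim_col B * dim_col C)"
    by (simp_all add: mult.assoc)
  note b = div_less_factor[OF ij(1)] div_less_factor[OF ij(2)] mod_less_factor[OF ij'(1)] mod_less_factor[OF ij'(2)]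
  have *: "x div c div b = x div (b * c)" "x div c mod b = x mod (b * c) div c"
    "x mod c = x mod (b * c) mod c" for x b c :: nat
    by (cases "c = 0"; simp add: div_mult2_eq mod_mult2_eq mult.commute[of b c])+
  show "?l $$ (i, j) = ?r $$ (i, j)"
    using ij ij' b by (simp add: kronecker_index *[of i "dim_row C" "dim_row B"] *[of j "dim_col C" "dim_col B"] mult.assoc)
qed (simp_all add: mult.assoc)

lemma kronecker_one_one [simp]: "(\<I> n :: 'a::semiring_1 mat) \<otimes> \<I> m = \<I> (n * m)"
proof (rule eq_matI)
  fix i j assume "i < dim_row (\<I> (n * m) :: 'a mat)" "j < dim_col (\<I> (n * m) :: 'a mat)"
  then have "i < n * m" "j < n * m" by simp_all
  note b = this div_less_factor[OF this(1)] mod_less_factor[OF this(1)] div_less_factor[OF this(2)] mod_less_factor[OF this(2)]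
  have "(i div m = j div m \<and> i mod m = j mod m) \<longleftrightarrow> i = j" by (metis div_mult_mod_eq)
  then show "(\<I> n \<otimes> \<I> m) $$ (i, j) = (\<I> (n * m) :: 'a mat) $$ (i, j)"
    using b by (auto simp: kronecker_index)
qed simp_all

lemma kronecker_one_left [simp]: "(\<I> 1 :: 'a::semiring_1 mat) \<otimes> A = A"
  by (rule eq_matI) (simp_all add: kronecker_index)

lemma kronecker_one_right [simp]: "A \<otimes> (\<I> 1 :: 'a::semiring_1 mat) = A"
  by (rule eq_matI) (simp_all add: kronecker_index)

lemma kronecker_one_right_Suc [simp]: "A \<otimes> (\<I> (Suc 0) :: 'a::semiring_1 mat) = A"
  and kronecker_one_left_Suc [simp]: "(\<I> (Suc 0) :: 'a::semiring_1 mat) \<otimes> A = A"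
  unfolding One_nat_def[symmetric] by (rule kronecker_one_right kronecker_one_left)+

lemma kronecker_transpose:
  "(A \<otimes> B)\<^sup>T = A\<^sup>T \<otimes> B\<^sup>T"
  by (rule eq_matI) (simp_all add: kronecker_index div_less_factor mod_less_factor)

lemma mat_assoc:
  fixes A :: "'a::semiring_0 mat"
  shows "dim_col A = dim_row B \<Longrightarrow> dim_col B = dim_row C \<Longrightarrow> A * B * C = A * (B * C)"
  by (rule assoc_mult_mat[of _ "dim_row A" "dim_col A" _ "dim_col B" _ "dim_col C"]; intro carrier_matI; simp)

lemma one_mat_mult [simp]:
  fixes A :: "'a::semiring_1 mat"
  shows "dim_row A = n \<Longrightarrow> \<I> n * A = A" "dim_col A = n \<Longrightarrow> A * \<I> n = A"
  by (metis carrier_matI left_mult_one_mat, metis carrier_matI right_mult_one_mat)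

definition ucol :: "nat \<Rightarrow> nat \<Rightarrow> 'a::{zero,one} mat" where
  "ucol n k = mat n 1 (\<lambda>(i, _). if i = k then 1 else 0)"

lemma dim_ucol [simp]: "dim_row (ucol n k) = n" "dim_col (ucol n k) = 1"
  by (simp_all add: ucol_def)

lemma ucol_index [simp]: "i < n \<Longrightarrow> ucol n k $$ (i, 0) = (if i = k then 1 else 0)"
  by (simp add: ucol_def)

text \<open>Left multiplication by \<open>\<I> N \<otimes> x\<^sup>T\<close> contracts the last
  tensor factor of the target with the vector \<open>x\<close>. Such contractions replace index
  computations in most matrix identities below.\<close>

lemma contract_rows_index:
  fixes M :: "'a::comm_semiring_1 mat"
  assumes "dim_row M = N * n" "i < N" "j < dim_col M" "dim_col x = 1" "dim_row x = n"
  shows "((\<I> N \<otimes> x\<^sup>T) * M) $$ (i, j) = (\<Sum>k<n. x $$ (k, 0) * M $$ (i * n + k, j))"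
proof -
  have "((\<I> N \<otimes> x\<^sup>T) * M) $$ (i, j)
      = (\<Sum>k<N * n. (\<lambda>k1 k2. (if i = k1 then 1 else 0) * x $$ (k2, 0) * M $$ (k1 * n + k2, j)) (k div n) (k mod n))"
    using assms by (subst mat_mult_index_sum)
      (auto intro!: sum.cong simp: kronecker_index div_less_factor mod_less_factor)
  also have "\<dots> = (\<Sum>k1<N. \<Sum>k2<n. (if i = k1 then 1 else 0) * x $$ (k2, 0) * M $$ (k1 * n + k2, j))"
    by (rule sum_div_mod)
  also have "\<dots> = (\<Sum>k1<N. if i = k1 then (\<Sum>k2<n. x $$ (k2, 0) * M $$ (k1 * n + k2, j)) else 0)"
    by (intro sum.cong) auto
  finally show ?thesis using assms by simp
qed

text \<open>Contracting with the unit column at \<open>i mod n\<close> and reading row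
  \<open>i div n\<close> recovers row \<open>i\<close> of the original matrix.\<close>

lemma contract_rows_eqI:
  fixes M :: "'a::comm_semiring_1 mat"
  assumes "dim_row M = N * n" "dim_row M' = N * n" "dim_col M = dim_col M'"
    and "\<And>x. dim_row x = n \<Longrightarrow> dim_col x = 1 \<Longrightarrow>
      (\<I> N \<otimes> x\<^sup>T) * M = (\<I> N \<otimes> x\<^sup>T) * M'"
  shows "M = M'"
proof (rule eq_matI)
  fix i j assume ij: "i < dim_row M'" "j < dim_col M'"
  then have i: "i div n < N" "i mod n < n" using assms div_less_factor mod_less_factor by force+
  have *: "((\<I> N \<otimes> (ucol n (i mod n))\<^sup>T) * X) $$ (i div n, j) = X $$ (i, j)"
    if "dim_row X = N * n" "dim_col X = dim_col M'" for X :: "'a mat"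
  proof -
    have "((\<I> N \<otimes> (ucol n (i mod n))\<^sup>T) * X) $$ (i div n, j)
        = (\<Sum>k<n. ucol n (i mod n) $$ (k, 0) * X $$ (i div n * n + k, j))"
      by (rule contract_rows_index) (use that i ij in simp_all)
    also have "\<dots> = (\<Sum>k<n. if k = i mod n then X $$ (i div n * n + k, j) else 0)"
      by (intro sum.cong) auto
    finally show ?thesis using i by simp
  qed
  show "M $$ (i, j) = M' $$ (i, j)"
    using *[of M] *[of M'] assms by simp
qed (use assms in auto)

lemma contract_cols_eqI:
  fixes M :: "'a::comm_semiring_1 mat"
  assumes "dim_col M = N * n" "dim_col M' = N * n" "dim_row M = dim_row M'"
    and "\<And>x. dim_row x = n \<Longrightarrow> dim_col x = 1 \<Longrightarrow> M * (\<I> N \<otimes> x) = M' * (\<I> N \<otimes> x)"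
  shows "M = M'"
proof -
  have "M\<^sup>T = M'\<^sup>T"
  proof (rule contract_rows_eqI[of _ N n])
    fix x :: "'a mat" assume x: "dim_row x = n" "dim_col x = 1"
    have "(\<I> N \<otimes> x\<^sup>T) * X\<^sup>T = (X * (\<I> N \<otimes> x))\<^sup>T"
      if "dim_col X = N * n" for X :: "'a mat"
      using that x by (subst transpose_mult[of _ "dim_row X" "N * n" _ N])
        (auto intro!: carrier_matI simp: kronecker_transpose)
    then show "(\<I> N \<otimes> x\<^sup>T) * M\<^sup>T = (\<I> N \<otimes> x\<^sup>T) * M'\<^sup>T"
      using assms(1,2,4) x by simp
  qed (use assms in auto)
  then show ?thesis by (metis transpose_transpose)
qed

definition evm :: "nat \<Rightarrow> 'a::{zero,one} mat" where
  "evm n = mat 1 (n * n) (\<lambda>(_, j). if j div n = j mod n then 1 else 0)"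

definition coevm :: "nat \<Rightarrow> 'a::{zero,one} mat" where
  "coevm n = mat (n * n) 1 (\<lambda>(i, _). if i div n = i mod n then 1 else 0)"

lemma dim_evm [simp]: "dim_row (evm n) = 1" "dim_col (evm n) = n * n"
  and dim_coevm [simp]: "dim_row (coevm n) = n * n" "dim_col (coevm n) = 1"
  by (simp_all add: evm_def coevm_def)

lemma transpose_coevm: "(coevm n)\<^sup>T = evm n"
  by (rule eq_matI) (auto simp: coevm_def evm_def)

text \<open>\<open>coevm\<close> is the sum of all \<open>e\<^sub>i \<otimes> e\<^sup>i\<close>, the
  tensor of the identity map; this contraction property is how it is used.\<close>

lemma coevm_contract:
  fixes x :: "'a::comm_semiring_1 mat"
  assumes "dim_row x = n" "dim_col x = 1"
  shows "(\<I> n \<otimes> x\<^sup>T) * coevm n = x"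
proof (rule eq_matI)
  fix i j assume "i < dim_row x" "j < dim_col x"
  then show "((\<I> n \<otimes> x\<^sup>T) * coevm n) $$ (i, j) = x $$ (i, j)"
    using assms by (subst contract_rows_index)
      (auto simp: coevm_def nat_pair_less if_distrib[of "\<lambda>c. _ * c"] cong: if_cong)
qed (use assms in auto)

lemma evm_contract:
  fixes x :: "'a::comm_semiring_1 mat"
  assumes "dim_row x = n" "dim_col x = 1"
  shows "evm n * (\<I> n \<otimes> x) = x\<^sup>T"
proof -
  have "evm n * (\<I> n \<otimes> x) = ((\<I> n \<otimes> x\<^sup>T) * coevm n)\<^sup>T"
    using assms by (subst transpose_mult[of _ n "n * n" _ 1])
      (auto intro!: carrier_matI simp: kronecker_transpose transpose_coevm)
  then show ?thesis using assms by (simp add: coevm_contract)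
qed

text \<open>The matrix \<open>(evm n \<otimes> \<I> m) * (\<I> n \<otimes> t)\<close> is the partial transpose of the tensor \<open>t\<close>.\<close>

lemma partial_transpose_contract:
  fixes t :: "'a::comm_semiring_1 mat"
  assumes "dim_row x = m" "dim_col x = 1" "dim_row t = n * m" "dim_col t = 1"
  shows "x\<^sup>T * ((evm n \<otimes> \<I> m) * (\<I> n \<otimes> t))
    = ((\<I> n \<otimes> x\<^sup>T) * t)\<^sup>T"
proof -
  have "x\<^sup>T * ((evm n \<otimes> \<I> m) * (\<I> n \<otimes> t))
      = ((\<I> 1 \<otimes> x\<^sup>T) * (evm n \<otimes> \<I> m)) * (\<I> n \<otimes> t)"
    using assms by (simp add: mat_assoc)
  also have "(\<I> 1 \<otimes> x\<^sup>T) * (evm n \<otimes> \<I> m) = (evm n \<otimes> \<I> 1) * (\<I> (n * n) \<otimes> x\<^sup>T)"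
    using assms kronecker_mult[of "\<I> 1" "evm n" "x\<^sup>T" "\<I> m"]
      kronecker_mult[of "evm n" "\<I> (n * n)" "\<I> 1" "x\<^sup>T"] by simp
  also have "\<dots> * (\<I> n \<otimes> t) = evm n * ((\<I> n \<otimes> (\<I> n \<otimes> x\<^sup>T)) * (\<I> n \<otimes> t))"
    using assms by (simp add: mat_assoc flip: kronecker_assoc)
  also have "\<dots> = evm n * (\<I> n \<otimes> ((\<I> n \<otimes> x\<^sup>T) * t))"
    using assms by (subst kronecker_mult) simp_all
  also have "\<dots> = ((\<I> n \<otimes> x\<^sup>T) * t)\<^sup>T"
    using assms by (subst evm_contract) simp_all
  finally show ?thesis .
qed

section \<open>Matrix representations\<close>

lemma fst_rep_tensor [simp]: "fst (rep_tensor \<Delta> X Y) = fst X * fst Y"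
  by (simp add: rep_tensor_def case_prod_beta')

lemma fst_rep_dual [simp]: "fst (rep_dual S X) = fst X"
  and snd_rep_dual [simp]: "snd (rep_dual S X) x = (snd X (S x))\<^sup>T"
  by (simp_all add: rep_dual_def case_prod_beta')

lemma intertwiners_iff:
  "A \<in> intertwiners X Y \<longleftrightarrow>
    dim_row A = fst Y \<and> dim_col A = fst X \<and> (\<forall>x. A * snd X x = snd Y x * A)"
  by (auto simp: intertwiners_def case_prod_beta')

text \<open>The transpose is the adjoint for the evaluation pairing. This moves \<open>S a\<close>,
  acting on the dual, next to \<open>b\<close> when evaluation is shown to be a module map.\<close>

lemma evm_slide:
  fixes A :: "'a::comm_semiring_1 mat"
  assumes "A \<in> carrier_mat n n"
  shows "evm n * (A\<^sup>T \<otimes> \<I> n) = evm n * (\<I> n \<otimes> A)"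
    (is "?l = ?r")
proof (rule contract_cols_eqI[of _ n n])
  have [simp]: "dim_row A = n" "dim_col A = n" using assms by auto
  fix x :: "'a mat" assume [simp]: "dim_row x = n" "dim_col x = 1"
  have "?l * (\<I> n \<otimes> x) = evm n * ((\<I> n \<otimes> x) * (A\<^sup>T \<otimes> \<I> 1))"
    using kronecker_mult[of "A\<^sup>T" "\<I> n" "\<I> n" x]
      kronecker_mult[of "\<I> n" "A\<^sup>T" x "\<I> 1"] by (simp add: mat_assoc)
  also have "\<dots> = (evm n * (\<I> n \<otimes> x)) * A\<^sup>T"
    by (simp add: mat_assoc)
  also have "\<dots> = (A * x)\<^sup>T"
    by (simp add: evm_contract transpose_mult[of A n n x 1] carrier_matI)
  also have "\<dots> = evm n * (\<I> n \<otimes> (A * x))"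
    by (rule evm_contract[symmetric]) simp_all
  also have "\<dots> = ?r * (\<I> n \<otimes> x)"
    using kronecker_mult[of "\<I> n" "\<I> n" A x] by (simp add: mat_assoc)
  finally show "?l * (\<I> n \<otimes> x) = ?r * (\<I> n \<otimes> x)" .
qed (use assms in auto)

lemma coevm_slide:
  fixes A :: "'a::comm_semiring_1 mat"
  assumes "A \<in> carrier_mat n n"
  shows "(\<I> n \<otimes> A\<^sup>T) * coevm n = (A \<otimes> \<I> n) * coevm n"
    (is "?l = ?r")
proof -
  have [simp]: "dim_row A = n" "dim_col A = n" using assms by auto
  have "?l\<^sup>T = evm n * (\<I> n \<otimes> A)"
    by (subst transpose_mult[of _ "n * n" "n * n" _ 1])
      (auto intro!: carrier_matI simp: kronecker_transpose transpose_coevm)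
  also have "\<dots> = evm n * (A\<^sup>T \<otimes> \<I> n)"
    by (rule evm_slide[OF assms, symmetric])
  also have "\<dots> = ?r\<^sup>T"
    by (subst transpose_mult[of _ "n * n" "n * n" _ 1])
      (auto intro!: carrier_matI simp: kronecker_transpose transpose_coevm)
  finally show ?thesis by (metis transpose_transpose)
qed

section \<open>Representations and their tensor products\<close>

context hopf_algebra
begin

definition rep :: "('h, 'k) matrix_rep \<Rightarrow> bool" where
  "rep X \<longleftrightarrow> is_matrix_rep scale (fst X) (snd X)"

abbreviation tp (infixr \<open>\<odot>\<close> 75) where "X \<odot> Y \<equiv> rep_tensor \<Delta> X Y"

definition unit_rep :: "('h, 'k) matrix_rep" where
  "unit_rep = (1, \<lambda>x. mat 1 1 (\<lambda>_. \<epsilon> x))"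

lemma fst_unit_rep [simp]: "fst unit_rep = 1"
  and snd_unit_rep [simp]: "snd unit_rep x = mat 1 1 (\<lambda>_. \<epsilon> x)"
  by (simp_all add: unit_rep_def)

abbreviation dual_rep :: "('h, 'k) matrix_rep \<Rightarrow> ('h, 'k) matrix_rep" where
  "dual_rep \<equiv> rep_dual S"

lemma rep_carrier: "rep X \<Longrightarrow> snd X x \<in> carrier_mat (fst X) (fst X)"
  by (simp add: rep_def is_matrix_rep_def)

lemma rep_dims: "rep X \<Longrightarrow> dim_row (snd X x) = fst X" "rep X \<Longrightarrow> dim_col (snd X x) = fst X"
  using rep_carrier by blast+

lemma rep_add: "rep X \<Longrightarrow> snd X (x + y) = snd X x + snd X y"
  and rep_scale: "rep X \<Longrightarrow> snd X (scale c x) = c \<cdot>\<^sub>m snd X x"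
  and rep_one: "rep X \<Longrightarrow> snd X 1 = \<I> (fst X)"
  and rep_mult: "rep X \<Longrightarrow> snd X (x * y) = snd X x * snd X y"
  by (simp_all add: rep_def is_matrix_rep_def)

lemma rep_entry_functional:
  "rep X \<Longrightarrow> i < fst X \<Longrightarrow> j < fst X \<Longrightarrow> functional (\<lambda>a. snd X a $$ (i, j))"
  by (simp add: functional_def rep_add rep_scale rep_dims)

text \<open>A matrix-valued Sweedler sum, taken entrywise. The size is a parameter because an empty
  formal sum does not determine the size of the zero matrix.\<close>

definition swm :: "'h \<Rightarrow> nat \<Rightarrow> nat \<Rightarrow> ('h \<Rightarrow> 'h \<Rightarrow> 'k mat) \<Rightarrow> 'k mat" where
  "swm x r c M = mat r c (\<lambda>ij. sw x (\<lambda>a b. M a b $$ ij))"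

lemma dim_swm [simp]: "dim_row (swm x r c M) = r" "dim_col (swm x r c M) = c"
  by (simp_all add: swm_def)

lemma swm_index: "i < r \<Longrightarrow> j < c \<Longrightarrow> swm x r c M $$ (i, j) = sw x (\<lambda>a b. M a b $$ (i, j))"
  by (simp add: swm_def)

lemma swm_mult_left:
  assumes "\<And>a b. M a b \<in> carrier_mat r c" "dim_col A = r" "dim_row A = s"
  shows "A * swm x r c M = swm x s c (\<lambda>a b. A * M a b)"
    (is "?l = ?r")
proof (rule eq_matI)
  fix i j assume "i < dim_row ?r" "j < dim_col ?r"
  then have ij: "i < s" "j < c" by simp_all
  have dims: "dim_row (M a b) = r" "dim_col (M a b) = c" for a b using assms(1)[of a b] by auto
  show "?l $$ (i, j) = swm x s c (\<lambda>a b. A * M a b) $$ (i, j)"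
    using ij assms by (simp add: mat_mult_index_sum swm_index dims sw_sum_distrib sw_cmult del: index_mult_mat(1))
qed (use assms in auto)

lemma swm_mult_right:
  assumes "\<And>a b. M a b \<in> carrier_mat r c" "dim_row A = c" "dim_col A = s"
  shows "swm x r c M * A = swm x r s (\<lambda>a b. M a b * A)"
    (is "?l = ?r")
proof (rule eq_matI)
  fix i j assume "i < dim_row ?r" "j < dim_col ?r"
  then have ij: "i < r" "j < s" by simp_all
  have dims: "dim_row (M a b) = r" "dim_col (M a b) = c" for a b using assms(1)[of a b] by auto
  show "?l $$ (i, j) = swm x r s (\<lambda>a b. M a b * A) $$ (i, j)"
    using ij assms by (simp add: mat_mult_index_sum swm_index dims sw_sum_distrib sw_cmult_right del: index_mult_mat(1))
qed (use assms in auto)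

lemma snd_rep_tensor:
  assumes "rep X" "rep Y"
  shows "snd (X \<odot> Y) x = swm x (fst X * fst Y) (fst X * fst Y) (\<lambda>a b. snd X a \<otimes> snd Y b)"
  using assms by (intro eq_matI) (auto simp: swm_def rep_tensor_def case_prod_beta' sw_def)

lemma kron_rep_carrier:
  "rep X \<Longrightarrow> rep Y \<Longrightarrow> snd X a \<otimes> snd Y b \<in> carrier_mat (fst X * fst Y) (fst X * fst Y)"
  by (auto intro: rep_carrier)

lemma rep_tensor_index:
  assumes "rep X" "rep Y" "i < fst X * fst Y" "j < fst X * fst Y"
  shows "snd (X \<odot> Y) x $$ (i, j) =
    sw x (\<lambda>a b. snd X a $$ (i div fst Y, j div fst Y) * snd Y b $$ (i mod fst Y, j mod fst Y))"
  using assms by (simp add: snd_rep_tensor swm_index kronecker_index rep_dims)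

lemma bilinear_entries:
  assumes "rep X" "rep Y" "i < fst X * fst Y" "j < fst X * fst Y"
  shows "bilinear_form (\<lambda>a b. (snd X a \<otimes> snd Y b) $$ (i, j))"
proof -
  have "functional (\<lambda>a. snd X a $$ (i div fst Y, j div fst Y))" "functional (\<lambda>b. snd Y b $$ (i mod fst Y, j mod fst Y))"
    using assms by (auto intro!: rep_entry_functional simp: div_less_factor mod_less_factor)
  note [simp] = this[THEN functional_add] this[THEN functional_scale]
  show ?thesis using assms
    by (simp add: kronecker_index rep_dims bilinear_form_def functional_def algebra_simps)
qed

lemma rep_tensor_rep [simp, intro]:
  assumes X: "rep X" and Y: "rep Y"
  shows "rep (X \<odot> Y)"
  unfolding rep_def is_matrix_rep_def
proof (intro conjI allI)
  let ?n = "fst X * fst Y"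
  note T = snd_rep_tensor[OF X Y] and bil = bilinear_entries[OF X Y]
  show "snd (X \<odot> Y) x \<in> carrier_mat (fst (X \<odot> Y)) (fst (X \<odot> Y))" for x
    by (auto simp: T intro!: carrier_matI)
  show "snd (X \<odot> Y) (x + y) = snd (X \<odot> Y) x + snd (X \<odot> Y) y" for x y
    by (rule eq_matI) (simp_all add: T swm_index sw_add bil)
  show "snd (X \<odot> Y) (scale c x) = c \<cdot>\<^sub>m snd (X \<odot> Y) x" for c x
    by (rule eq_matI) (simp_all add: T swm_index sw_scale bil)
  show "snd (X \<odot> Y) 1 = \<I> (fst (X \<odot> Y))"
    by (rule eq_matI) (simp_all add: T swm_index sw_one bil rep_one[OF X] rep_one[OF Y])
  show "snd (X \<odot> Y) (x * y) = snd (X \<odot> Y) x * snd (X \<odot> Y) y" for x y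
  proof -
    have "snd (X \<odot> Y) x * snd (X \<odot> Y) y = swm x ?n ?n (\<lambda>a b. (snd X a \<otimes> snd Y b) * snd (X \<odot> Y) y)"
      unfolding T[of x] by (rule swm_mult_right[OF kron_rep_carrier[OF X Y]]) (simp_all add: T)
    also have "\<dots> = swm x ?n ?n (\<lambda>a b. swm y ?n ?n (\<lambda>c e. (snd X a \<otimes> snd Y b) * (snd X c \<otimes> snd Y e)))"
      unfolding T[of y] by (subst swm_mult_left[OF kron_rep_carrier[OF X Y]]) (simp_all add: rep_dims X Y)
    also have "\<dots> = swm x ?n ?n (\<lambda>a b. swm y ?n ?n (\<lambda>c e. snd X (a * c) \<otimes> snd Y (b * e)))"
      by (simp add: kronecker_mult rep_dims rep_mult X Y)
    also have "\<dots> = snd (X \<odot> Y) (x * y)"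
      by (rule eq_matI) (simp_all add: T swm_index sw_mult bil)
    finally show ?thesis ..
  qed
qed

lemma hom_dims: "f \<in> intertwiners X Y \<Longrightarrow> dim_row f = fst Y" "f \<in> intertwiners X Y \<Longrightarrow> dim_col f = fst X"
  by (simp_all add: intertwiners_iff)

lemma hom_comm: "f \<in> intertwiners X Y \<Longrightarrow> f * snd X x = snd Y x * f"
  by (simp add: intertwiners_iff)

lemma hom_id [intro]: "rep X \<Longrightarrow> \<I> (fst X) \<in> intertwiners X X"
  by (simp add: intertwiners_iff rep_dims)

lemma hom_comp [intro]:
  assumes "f \<in> intertwiners X Y" "g \<in> intertwiners Y Z" "rep X" "rep Y" "rep Z"
  shows "g * f \<in> intertwiners X Z"
proof -
  note d = hom_dims[OF assms(1)] hom_dims[OF assms(2)] rep_dims[OF assms(3)] rep_dims[OF assms(4)] rep_dims[OF assms(5)]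
  have "g * f * snd X x = snd Z x * (g * f)" for x
  proof -
    have "g * f * snd X x = g * (snd Y x * f)" by (simp add: mat_assoc d hom_comm[OF assms(1)])
    also have "\<dots> = g * snd Y x * f" by (simp add: mat_assoc d)
    finally show ?thesis by (simp add: mat_assoc d hom_comm[OF assms(2)])
  qed
  then show ?thesis by (simp add: intertwiners_iff d)
qed

lemma hom_tensor [intro]:
  assumes "f \<in> intertwiners X X'" "g \<in> intertwiners Y Y'" "rep X" "rep Y" "rep X'" "rep Y'"
  shows "f \<otimes> g \<in> intertwiners (X \<odot> Y) (X' \<odot> Y')"
proof -
  note d = hom_dims[OF assms(1)] hom_dims[OF assms(2)] rep_dims[OF assms(3)] rep_dims[OF assms(4)]
    rep_dims[OF assms(5)] rep_dims[OF assms(6)]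
  have "(f \<otimes> g) * snd (X \<odot> Y) x = snd (X' \<odot> Y') x * (f \<otimes> g)" for x
  proof -
    have "(f \<otimes> g) * snd (X \<odot> Y) x
        = swm x (fst X' * fst Y') (fst X * fst Y) (\<lambda>a b. (f \<otimes> g) * (snd X a \<otimes> snd Y b))"
      unfolding snd_rep_tensor[OF assms(3,4)]
      by (rule swm_mult_left[OF kron_rep_carrier[OF assms(3,4)]]) (simp_all add: d)
    also have "\<dots> = swm x (fst X' * fst Y') (fst X * fst Y) (\<lambda>a b. (snd X' a \<otimes> snd Y' b) * (f \<otimes> g))"
      by (simp add: kronecker_mult d hom_comm[OF assms(1)] hom_comm[OF assms(2)])
    also have "\<dots> = snd (X' \<odot> Y') x * (f \<otimes> g)"
      unfolding snd_rep_tensor[OF assms(5,6)]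
      by (rule swm_mult_right[OF kron_rep_carrier[OF assms(5,6)], symmetric]) (simp_all add: d)
    finally show ?thesis .
  qed
  then show ?thesis by (simp add: intertwiners_iff d)
qed

lemma matrix_rep_eqI:
  assumes "fst X = fst Y" "\<And>x. snd X x = snd Y x"
  shows "X = (Y :: ('h, 'k) matrix_rep)"
  using assms by (simp add: prod_eq_iff fun_eq_iff)

text \<open>In the lexicographic order the position of a triple of indices does not depend on the
  bracketing (the facts \<open>*\<close>), so what is left of strict associativity is
  coassociativity, entry by entry.\<close>

lemma tensor_assoc:
  assumes X: "rep X" and Y: "rep Y" and Z: "rep Z"
  shows "(X \<odot> Y) \<odot> Z = X \<odot> Y \<odot> Z"
proof (rule matrix_rep_eqI)
  fix x
  let ?p = "fst X" and ?q = "fst Y" and ?r = "fst Z"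
  have XY: "rep (X \<odot> Y)" and YZ: "rep (Y \<odot> Z)" using X Y Z by auto
  show "snd ((X \<odot> Y) \<odot> Z) x = snd (X \<odot> Y \<odot> Z) x"
  proof (rule eq_matI)
    fix i j assume "i < dim_row (snd (X \<odot> Y \<odot> Z) x)" "j < dim_col (snd (X \<odot> Y \<odot> Z) x)"
    then have ij: "i < ?p * (?q * ?r)" "j < ?p * (?q * ?r)" by (simp_all add: rep_dims X YZ)
    then have ij': "i < (?p * ?q) * ?r" "j < (?p * ?q) * ?r" by (simp_all add: mult.assoc)
    note b = div_less_factor[OF ij'(1)] div_less_factor[OF ij'(2)] mod_less_factor[OF ij(1)] mod_less_factor[OF ij(2)]
    note b' = div_less_factor[OF b(1)] div_less_factor[OF b(2)] mod_less_factor[OF b(1)] mod_less_factor[OF b(2)]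
      mod_less_factor[OF ij'(1)] mod_less_factor[OF ij'(2)]
    have *: "x div ?r div ?q = x div (?q * ?r)" "x div ?r mod ?q = x mod (?q * ?r) div ?r"
      "x mod (?q * ?r) mod ?r = x mod ?r" for x
      by (cases "?r = 0"; simp add: div_mult2_eq mod_mult2_eq mult.commute[of ?q ?r])+
    let ?F = "\<lambda>a b c. snd X a $$ (i div ?r div ?q, j div ?r div ?q) *
      (snd Y b $$ (i div ?r mod ?q, j div ?r mod ?q) * snd Z c $$ (i mod ?r, j mod ?r))"
    have entries: "functional (\<lambda>a. snd X a $$ (i div ?r div ?q, j div ?r div ?q))"
      "functional (\<lambda>b. snd Y b $$ (i div ?r mod ?q, j div ?r mod ?q))"
      "functional (\<lambda>c. snd Z c $$ (i mod ?r, j mod ?r))"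
      using b' X Y Z by (auto intro!: rep_entry_functional)
    note [simp] = this[THEN functional_add] this[THEN functional_scale]
    have tri: "trilinear_form ?F"
      by (simp add: trilinear_form_def functional_def algebra_simps)
    have "snd ((X \<odot> Y) \<odot> Z) x $$ (i, j) = sw x (\<lambda>a b. sw a (\<lambda>c d. ?F c d b))"
      using ij' b by (simp add: rep_tensor_index X Y Z XY mult.assoc flip: sw_cmult_right)
    also have "\<dots> = sw x (\<lambda>a b. sw b (\<lambda>c d. ?F a c d))"
      by (rule sw_coassoc[OF tri])
    also have "\<dots> = snd (X \<odot> Y \<odot> Z) x $$ (i, j)"
      using ij b by (simp add: rep_tensor_index X Y Z YZ * flip: sw_cmult)
    finally show "snd ((X \<odot> Y) \<odot> Z) x $$ (i, j) = snd (X \<odot> Y \<odot> Z) x $$ (i, j)" .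
  qed (simp_all add: rep_dims X Y Z XY YZ mult.assoc)
qed (simp add: mult.assoc)

lemma unit_rep [simp, intro]: "rep unit_rep"
proof -
  have "mat 1 1 (\<lambda>_. \<epsilon> (x * y)) = mat 1 1 (\<lambda>_. \<epsilon> x) * mat 1 1 (\<lambda>_. \<epsilon> y)" for x y
    by (rule eq_matI) (simp_all add: counit_mult scalar_prod_def)
  moreover have "mat 1 1 (\<lambda>_. \<epsilon> 1) = (\<I> 1 :: 'k mat)"
    by (rule eq_matI) (simp_all add: counit_one)
  moreover have "mat 1 1 (\<lambda>_. \<epsilon> (x + y)) = mat 1 1 (\<lambda>_. \<epsilon> x) + mat 1 1 (\<lambda>_. \<epsilon> y)" for x y
    by (rule eq_matI) (simp_all add: counit_add)
  moreover have "mat 1 1 (\<lambda>_. \<epsilon> (scale c x)) = c \<cdot>\<^sub>m mat 1 1 (\<lambda>_. \<epsilon> x)" for c x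
    by (rule eq_matI) (simp_all add: counit_scale)
  ultimately show ?thesis by (simp add: rep_def is_matrix_rep_def)
qed

lemma unit_tensor [simp]:
  assumes X: "rep X" shows "unit_rep \<odot> X = X" "X \<odot> unit_rep = X"
proof -
  show "unit_rep \<odot> X = X"
  proof (rule matrix_rep_eqI)
    fix x show "snd (unit_rep \<odot> X) x = snd X x"
      by (rule eq_matI)
        (simp_all add: rep_tensor_index[OF unit_rep X] rep_dims[OF X] rep_dims[OF rep_tensor_rep[OF unit_rep X]]
          sw_counit_left[OF rep_entry_functional[OF X]])
  qed simp
  show "X \<odot> unit_rep = X"
  proof (rule matrix_rep_eqI)
    fix x show "snd (X \<odot> unit_rep) x = snd X x"
      using sw_counit_right[OF rep_entry_functional[OF X]]
      by (intro eq_matI)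
        (simp_all add: rep_tensor_index[OF X unit_rep] rep_dims[OF X] rep_dims[OF rep_tensor_rep[OF X unit_rep]]
          mult.commute[of _ "\<epsilon> _"])
  qed simp
qed


end

section \<open>Dual representations, evaluation and coevaluation\<close>

context fd_hopf_algebra
begin

lemma dual_rep_rep [simp, intro]:
  assumes X: "rep X" shows "rep (dual_rep X)"
proof -
  have [simp]: "dim_row (snd X x) = fst X" "dim_col (snd X x) = fst X" for x
    using X by (simp_all add: rep_dims)
  have "(snd X (S (x * y)))\<^sup>T = (snd X (S x))\<^sup>T * (snd X (S y))\<^sup>T" for x y
    unfolding S_mult rep_mult[OF X] by (rule transpose_mult[OF rep_carrier[OF X] rep_carrier[OF X]])
  moreover have "(snd X (S x))\<^sup>T \<in> carrier_mat (fst X) (fst X)" for x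
    by (auto intro!: carrier_matI)
  moreover have "(snd X (S (x + y)))\<^sup>T = (snd X (S x))\<^sup>T + (snd X (S y))\<^sup>T" for x y
    by (rule eq_matI) (simp_all add: S_add rep_add X)
  moreover have "(snd X (S (scale c x)))\<^sup>T = c \<cdot>\<^sub>m (snd X (S x))\<^sup>T" for c x
    by (rule eq_matI) (simp_all add: S_scale rep_scale X)
  ultimately show ?thesis by (simp add: rep_def is_matrix_rep_def rep_one[OF X])
qed

lemma dual_unit [simp]: "dual_rep unit_rep = unit_rep"
  by (rule matrix_rep_eqI) (auto intro!: eq_matI)

lemma dual_hom [intro]:
  assumes "f \<in> intertwiners X Y" "rep X" "rep Y"
  shows "f\<^sup>T \<in> intertwiners (dual_rep Y) (dual_rep X)"
proof -
  note d = hom_dims[OF assms(1)]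
  have "f\<^sup>T * (snd Y x)\<^sup>T = (snd X x)\<^sup>T * f\<^sup>T" for x
    using hom_comm[OF assms(1), of x] assms(2,3) d
      transpose_mult[of f "fst Y" "fst X" "snd X x" "fst X"] transpose_mult[of "snd Y x" "fst Y" "fst Y" f "fst X"]
    by (metis carrier_matI rep_carrier)
  then show ?thesis using d by (simp add: intertwiners_iff)
qed

text \<open>The element \<open>x\<close> acts through \<open>S x\<^sub>1\<close> on the dual and
  through \<open>x\<^sub>2\<close> on \<open>X\<close>; sliding the first across the evaluation
  leaves \<open>S x\<^sub>1 x\<^sub>2\<close> acting on \<open>X\<close>, which is the scalar
  \<open>\<epsilon> x\<close>.\<close>

lemma evm_hom [intro]:
  assumes X: "rep X" shows "evm (fst X) \<in> intertwiners (dual_rep X \<odot> X) unit_rep"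
proof -
  let ?n = "fst X"
  have [simp]: "dim_row (snd X x) = ?n" "dim_col (snd X x) = ?n" for x
    using X by (simp_all add: rep_dims)
  have "evm ?n * snd (dual_rep X \<odot> X) x = mat 1 1 (\<lambda>_. \<epsilon> x) * evm ?n" for x
  proof -
    have "evm ?n * snd (dual_rep X \<odot> X) x
        = swm x 1 (?n * ?n) (\<lambda>a b. evm ?n * ((snd X (S a))\<^sup>T \<otimes> snd X b))"
      using X by (subst snd_rep_tensor, simp, simp, subst swm_mult_left) (auto intro!: carrier_matI)
    also have "(\<lambda>a b. evm ?n * ((snd X (S a))\<^sup>T \<otimes> snd X b)) = (\<lambda>a b. evm ?n * (\<I> ?n \<otimes> snd X (S a * b)))"
    proof (intro ext)
      fix a b
      have "evm ?n * ((snd X (S a))\<^sup>T \<otimes> snd X b)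
          = (evm ?n * ((snd X (S a))\<^sup>T \<otimes> \<I> ?n)) * (\<I> ?n \<otimes> snd X b)"
        by (simp add: mat_assoc kronecker_mult)
      also have "\<dots> = evm ?n * (\<I> ?n \<otimes> snd X (S a * b))"
        unfolding evm_slide[OF rep_carrier[OF X]] by (simp add: mat_assoc kronecker_mult rep_mult X)
      finally show "evm ?n * ((snd X (S a))\<^sup>T \<otimes> snd X b) = evm ?n * (\<I> ?n \<otimes> snd X (S a * b))" .
    qed
    also have "swm x 1 (?n * ?n) (\<lambda>a b. evm ?n * (\<I> ?n \<otimes> snd X (S a * b))) = mat 1 1 (\<lambda>_. \<epsilon> x) * evm ?n"
    proof (rule eq_matI)
      fix i j assume "i < dim_row (mat 1 1 (\<lambda>_. \<epsilon> x) * evm ?n)" "j < dim_col (mat 1 1 (\<lambda>_. \<epsilon> x) * evm ?n)"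
      then have ij: "i = 0" "j < ?n * ?n" by simp_all
      note b = div_less_factor[OF ij(2)] mod_less_factor[OF ij(2)]
      have "functional (\<lambda>z. (\<I> ?n \<otimes> snd X z) $$ (k, j))" if "k < ?n * ?n" for k
        using that ij b by (simp add: functional_def kronecker_index rep_add rep_scale X div_less_factor mod_less_factor algebra_simps)
      note [simp] = functional_simps[OF this]
      have f: "functional (\<lambda>z. (evm ?n * (\<I> ?n \<otimes> snd X z)) $$ (0, j))"
        using ij by (simp add: functional_def mat_mult_index_sum sum_distrib_left distrib_left sum.distrib mult.left_commute del: index_mult_mat(1))
      show "swm x 1 (?n * ?n) (\<lambda>a b. evm ?n * (\<I> ?n \<otimes> snd X (S a * b))) $$ (i, j) = (mat 1 1 (\<lambda>_. \<epsilon> x) * evm ?n) $$ (i, j)"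
        using ij sw_antipode_left[OF f, of x]
        by (simp add: swm_index rep_one X scalar_prod_def del: index_mult_mat(1)) (simp add: mat_mult_index_sum del: index_mult_mat(1))
    qed simp_all
    finally show ?thesis .
  qed
  then show ?thesis by (simp add: intertwiners_iff)
qed

lemma coevm_hom [intro]:
  assumes X: "rep X" shows "coevm (fst X) \<in> intertwiners unit_rep (X \<odot> dual_rep X)"
proof -
  let ?n = "fst X"
  have [simp]: "dim_row (snd X x) = ?n" "dim_col (snd X x) = ?n" for x
    using X by (simp_all add: rep_dims)
  have "snd (X \<odot> dual_rep X) x * coevm ?n = coevm ?n * mat 1 1 (\<lambda>_. \<epsilon> x)" for x
  proof -
    have "snd (X \<odot> dual_rep X) x * coevm ?n
        = swm x (?n * ?n) 1 (\<lambda>a b. (snd X a \<otimes> (snd X (S b))\<^sup>T) * coevm ?n)"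
      using X by (subst snd_rep_tensor, simp, simp, subst swm_mult_right) (auto intro!: carrier_matI)
    also have "(\<lambda>a b. (snd X a \<otimes> (snd X (S b))\<^sup>T) * coevm ?n) = (\<lambda>a b. (snd X (a * S b) \<otimes> \<I> ?n) * coevm ?n)"
    proof (intro ext)
      fix a b
      have "(snd X a \<otimes> (snd X (S b))\<^sup>T) * coevm ?n
          = (snd X a \<otimes> \<I> ?n) * ((\<I> ?n \<otimes> (snd X (S b))\<^sup>T) * coevm ?n)"
        by (simp add: kronecker_mult flip: mat_assoc)
      also have "\<dots> = (snd X (a * S b) \<otimes> \<I> ?n) * coevm ?n"
        unfolding coevm_slide[OF rep_carrier[OF X]] by (simp add: kronecker_mult rep_mult X flip: mat_assoc)
      finally show "(snd X a \<otimes> (snd X (S b))\<^sup>T) * coevm ?n = (snd X (a * S b) \<otimes> \<I> ?n) * coevm ?n" .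
    qed
    also have "swm x (?n * ?n) 1 (\<lambda>a b. (snd X (a * S b) \<otimes> \<I> ?n) * coevm ?n) = coevm ?n * mat 1 1 (\<lambda>_. \<epsilon> x)"
    proof (rule eq_matI)
      fix i j assume "i < dim_row (coevm ?n * mat 1 1 (\<lambda>_. \<epsilon> x))" "j < dim_col (coevm ?n * mat 1 1 (\<lambda>_. \<epsilon> x))"
      then have ij: "j = 0" "i < ?n * ?n" by simp_all
      note b = div_less_factor[OF ij(2)] mod_less_factor[OF ij(2)]
      have "functional (\<lambda>z. (snd X z \<otimes> \<I> ?n) $$ (i, k))" if "k < ?n * ?n" for k
        using that ij b by (simp add: functional_def kronecker_index rep_add rep_scale X div_less_factor mod_less_factor algebra_simps)
      note [simp] = functional_simps[OF this]
      have f: "functional (\<lambda>z. ((snd X z \<otimes> \<I> ?n) * coevm ?n) $$ (i, 0))"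
        using ij by (simp add: functional_def mat_mult_index_sum sum_distrib_left distrib_right sum.distrib mult.assoc del: index_mult_mat(1))
      show "swm x (?n * ?n) 1 (\<lambda>a b. (snd X (a * S b) \<otimes> \<I> ?n) * coevm ?n) $$ (i, j) = (coevm ?n * mat 1 1 (\<lambda>_. \<epsilon> x)) $$ (i, j)"
        using ij sw_antipode_right[OF f, of x]
        by (simp add: swm_index rep_one X scalar_prod_def del: index_mult_mat(1)) (simp add: mat_mult_index_sum mult.commute del: index_mult_mat(1))
    qed simp_all
    finally show ?thesis .
  qed
  then show ?thesis by (simp add: intertwiners_iff)
qed

end

section \<open>The regular representation\<close>

lemma kronecker_one_nest [simp]:
  "(\<I> a :: 'a::semiring_1 mat) \<otimes> \<I> b \<otimes> A = \<I> (a * b) \<otimes> A"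
  by (simp flip: kronecker_assoc)

lemma kronecker_one_split:
  "A \<otimes> \<I> (m * n) = (A \<otimes> \<I> m) \<otimes> (\<I> n :: 'a::semiring_1 mat)"
  by (simp add: kronecker_assoc)

text \<open>Maps acting on different tensor factors commute.\<close>

lemma contract_commute:
  fixes A :: "'a::comm_semiring_1 mat"
  assumes "dim_row A = M" "dim_col A = N" "dim_row x = n" "dim_col x = 1"
  shows "(\<I> M \<otimes> x\<^sup>T) * (A \<otimes> \<I> n) = A * (\<I> N \<otimes> x\<^sup>T)"
  using assms kronecker_mult[of "\<I> M" A "x\<^sup>T" "\<I> n"]
    kronecker_mult[of A "\<I> N" "\<I> 1" "x\<^sup>T"] by simp

lemma mat_transpose_mult:
  fixes A :: "'a::comm_semiring_0 mat"
  shows "dim_col A = dim_row B \<Longrightarrow> (A * B)\<^sup>T = B\<^sup>T * A\<^sup>T"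
  by (rule transpose_mult[of _ "dim_row A" "dim_col A" _ "dim_col B"]) (auto intro!: carrier_matI)

lemma contract_transpose:
  fixes x f :: "'a::comm_semiring_1 mat"
  assumes "dim_row x = n" "dim_col f = n"
  shows "(\<I> N \<otimes> x\<^sup>T) * (\<I> N \<otimes> f\<^sup>T) = \<I> N \<otimes> (f * x)\<^sup>T"
  using assms kronecker_mult[of "\<I> N" "\<I> N" "x\<^sup>T" "f\<^sup>T"]
  by (simp add: mat_transpose_mult)

lemma column_commute:
  fixes A :: "'a::comm_semiring_1 mat"
  assumes "dim_row A = M" "dim_col A = N" "dim_row x = n" "dim_col x = 1"
  shows "(A \<otimes> \<I> n) * (\<I> N \<otimes> x) = (\<I> M \<otimes> x) * A"
  using assms kronecker_mult[of "\<I> M" A x "\<I> 1"] kronecker_mult[of A "\<I> N" "\<I> n" x] by simp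

context fd_hopf_algebra
begin

definition colv :: "'h \<Rightarrow> 'k mat" where
  "colv h = mat d 1 (\<lambda>(i, _). crd i h)"

definition rowf :: "('h \<Rightarrow> 'k) \<Rightarrow> 'k mat" where
  "rowf f = mat 1 d (\<lambda>(_, i). f (bas i))"

definition reg :: "('h, 'k) matrix_rep" where
  "reg = (d, \<lambda>x. mat d d (\<lambda>(i, j). crd i (x * bas j)))"

text \<open>The matrix of \<open>h \<mapsto> h x\<close>, the module map from the regular
  representation to \<open>X\<close> that takes 1 to \<open>x\<close>. Naturality in
  \<open>X\<close> is exploited through these maps.\<close>

definition phi :: "('h, 'k) matrix_rep \<Rightarrow> 'k mat \<Rightarrow> 'k mat" where
  "phi X x = mat (fst X) d (\<lambda>(i, p). (snd X (bas p) * x) $$ (i, 0))"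

text \<open>\<open>\<Delta>\<close> as a matrix from \<open>k\<^sup>d\<close> to
  \<open>k\<^sup>d \<otimes> k\<^sup>d\<close>, with the rows in lexicographic order.\<close>

definition comat :: "'k mat" where
  "comat = mat (d * d) d (\<lambda>(r, p). sw (bas p) (\<lambda>a b. crd (r div d) a * crd (r mod d) b))"

abbreviation uvec :: "'k mat" where "uvec \<equiv> colv 1"

lemma dim_colv [simp]: "dim_row (colv h) = d" "dim_col (colv h) = 1"
  and dim_rowf [simp]: "dim_row (rowf f) = 1" "dim_col (rowf f) = d"
  and dim_phi [simp]: "dim_row (phi X x) = fst X" "dim_col (phi X x) = d"
  and dim_comat [simp]: "dim_row comat = d * d" "dim_col comat = d"
  and fst_reg [simp]: "fst reg = d"
  by (simp_all add: colv_def rowf_def phi_def comat_def reg_def)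

lemma colv_index [simp]: "i < d \<Longrightarrow> colv h $$ (i, 0) = crd i h"
  by (simp add: colv_def)

lemma colv_surj:
  assumes "dim_row x = d" "dim_col x = 1"
  obtains h where "x = colv h"
proof -
  let ?h = "\<Sum>j<d. scale (x $$ (j, 0)) (bas j)"
  have "crd i ?h = x $$ (i, 0)" if "i < d" for i
  proof -
    have "crd i ?h = (\<Sum>j<d. x $$ (j, 0) * crd i (bas j))"
      by (simp add: functional_sum functional_simps[OF crd_functional])
    also have "\<dots> = (\<Sum>j<d. if j = i then x $$ (j, 0) else 0)"
      using that by (intro sum.cong) auto
    finally show ?thesis using that by simp
  qed
  then have "x = colv ?h" using assms by (intro eq_matI) auto
  then show ?thesis by (rule that)
qed

lemma mat_eq_colvI:
  fixes M :: "'k mat"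
  assumes "dim_col M = d" "dim_col M' = d" "dim_row M = dim_row M'" "\<And>h. M * colv h = M' * colv h"
  shows "M = M'"
proof (rule contract_cols_eqI[of _ 1 d])
  fix x :: "'k mat" assume "dim_row x = d" "dim_col x = 1"
  then show "M * (\<I> 1 \<otimes> x) = M' * (\<I> 1 \<otimes> x)"
    using assms(4) colv_surj[of x] by (metis kronecker_one_left)
qed (use assms in auto)

lemma mat_mult_colv:
  assumes "dim_row M = r" "dim_col M = d" "\<And>i. i < r \<Longrightarrow> functional (f i)"
    "\<And>i p. i < r \<Longrightarrow> p < d \<Longrightarrow> M $$ (i, p) = f i (bas p)"
  shows "M * colv h = mat r 1 (\<lambda>(i, _). f i h)"
    (is "_ = ?r")
proof (rule eq_matI)
  fix i j assume "i < dim_row ?r" "j < dim_col ?r"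
  then have ij: "i < r" "j = 0" by auto
  then show "(M * colv h) $$ (i, j) = mat r 1 (\<lambda>(i, _). f i h) $$ (i, j)"
    using assms functional_expand[OF assms(3)[OF ij(1)], of h]
    by (simp add: mat_mult_index_sum mult.commute del: index_mult_mat(1))
qed (use assms in auto)

lemma rowf_colv: "functional f \<Longrightarrow> rowf f * colv h = mat 1 1 (\<lambda>_. f h)"
  by (subst mat_mult_colv[of _ 1 "\<lambda>_. f"]) (auto simp: rowf_def)

lemma reg_colv: "snd reg x * colv h = colv (x * h)"
  unfolding colv_def[of "x * h"]
  by (rule mat_mult_colv)
    (simp_all add: reg_def functional_def form_simps functional_simps[OF crd_functional])

lemma reg_dims [simp]: "dim_row (snd reg x) = d" "dim_col (snd reg x) = d"
  by (simp_all add: reg_def)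

lemma rep_reg [simp, intro]: "rep reg"
proof -
  have "snd reg (x * y) = snd reg x * snd reg y" for x y
    by (rule mat_eq_colvI) (simp_all add: mat_assoc reg_colv mult.assoc)
  moreover have "snd reg 1 = \<I> d"
    by (rule mat_eq_colvI) (simp_all add: reg_colv)
  moreover have "snd reg (x + y) = snd reg x + snd reg y" for x y
    by (rule eq_matI) (simp_all add: reg_def distrib_right functional_simps[OF crd_functional])
  moreover have "snd reg (scale c x) = c \<cdot>\<^sub>m snd reg x" for c x
    by (rule eq_matI) (simp_all add: reg_def scale_mult_left functional_simps[OF crd_functional])
  ultimately show ?thesis by (auto simp: rep_def is_matrix_rep_def intro!: carrier_matI)
qed

lemma rep_vector_functional:
  assumes "rep X" "dim_row x = fst X" "dim_col x = 1" "i < fst X"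
  shows "functional (\<lambda>h. (snd X h * x) $$ (i, 0))"
  using assms by (simp add: functional_def mat_mult_index_sum rep_dims rep_add rep_scale
    distrib_right sum.distrib sum_distrib_left mult.assoc del: index_mult_mat(1))

lemma phi_colv:
  assumes "rep X" "dim_row x = fst X" "dim_col x = 1"
  shows "phi X x * colv h = snd X h * x"
proof -
  have "phi X x * colv h = mat (fst X) 1 (\<lambda>(i, _). (snd X h * x) $$ (i, 0))"
    by (rule mat_mult_colv) (simp_all add: rep_vector_functional[OF assms] phi_def)
  then show ?thesis using assms by (intro eq_matI) (auto simp: rep_dims)
qed

lemma phi_hom [intro]:
  assumes "rep X" "dim_row x = fst X" "dim_col x = 1"
  shows "phi X x \<in> intertwiners reg X"
proof -
  have "phi X x * snd reg h = snd X h * phi X x" for h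
    by (rule mat_eq_colvI) (simp_all add: rep_dims[OF assms(1)] mat_assoc reg_colv phi_colv[OF assms]
      rep_mult[OF assms(1)] assms)
  then show ?thesis by (simp add: intertwiners_iff)
qed

lemma phi_uvec:
  assumes "rep X" "dim_row x = fst X" "dim_col x = 1"
  shows "phi X x * uvec = x"
  using assms by (simp add: phi_colv rep_one)

lemma hom_phi:
  assumes "f \<in> intertwiners X Y" "rep X" "rep Y" "dim_row x = fst X" "dim_col x = 1"
  shows "f * phi X x = phi Y (f * x)"
proof (rule mat_eq_colvI)
  fix h
  show "f * phi X x * colv h = phi Y (f * x) * colv h"
    using assms hom_dims[OF assms(1)] hom_comm[OF assms(1), of h]
    by (simp add: mat_assoc phi_colv rep_dims) (simp flip: mat_assoc add: rep_dims)
qed (use hom_dims[OF assms(1)] in auto)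

lemma phi_reg_uvec: "phi reg uvec = \<I> d"
  by (rule mat_eq_colvI) (simp_all add: phi_colv reg_colv)

lemma swm_colv_index:
  "i < d * d \<Longrightarrow> (colv a \<otimes> colv b) $$ (i, 0) = crd (i div d) a * crd (i mod d) b"
  by (simp add: kronecker_index div_less_factor mod_less_factor)

lemma bilinear_crd: "bilinear_form (\<lambda>a b. crd i a * crd j b)"
  by (simp add: bilinear_form_def functional_def functional_simps[OF crd_functional] algebra_simps)

lemma comat_colv: "comat * colv h = swm h (d * d) 1 (\<lambda>a b. colv a \<otimes> colv b)"
    (is "?l = ?r")
proof -
  have "?l = mat (d * d) 1 (\<lambda>(i, _). sw h (\<lambda>a b. crd (i div d) a * crd (i mod d) b))"
    by (rule mat_mult_colv) (simp_all add: comat_def sw_functional bilinear_crd)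
  also have "\<dots> = ?r"
    by (rule eq_matI) (simp_all add: swm_index swm_colv_index)
  finally show ?thesis .
qed

lemma kron_comat_colv:
  assumes "dim_col A = d" "dim_col B = d"
  shows "(A \<otimes> B) * (comat * colv h)
    = swm h (dim_row A * dim_row B) 1 (\<lambda>a b. (A * colv a) \<otimes> (B * colv b))"
proof -
  have "colv a \<otimes> colv b \<in> carrier_mat (d * d) 1" for a b by (auto intro!: carrier_matI)
  then have "(A \<otimes> B) * (comat * colv h) = swm h (dim_row A * dim_row B) 1 (\<lambda>a b. (A \<otimes> B) * (colv a \<otimes> colv b))"
    unfolding comat_colv by (rule swm_mult_left) (simp_all add: assms)
  then show ?thesis using assms by (simp add: kronecker_mult)
qed

text \<open>On a tensor product \<open>h\<close> acts through \<open>\<Delta> h\<close>. This is how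
  the comultiplication of \<open>H\<close> enters the comonad and the half-braidings.\<close>

lemma phi_tensor:
  assumes "rep X" "dim_row x = fst X" "dim_col x = 1" "rep Y" "dim_row y = fst Y" "dim_col y = 1"
  shows "phi (X \<odot> Y) (x \<otimes> y) = (phi X x \<otimes> phi Y y) * comat"
proof (rule mat_eq_colvI)
  fix h
  have "phi (X \<odot> Y) (x \<otimes> y) * colv h = snd (X \<odot> Y) h * (x \<otimes> y)"
    by (rule phi_colv) (use assms in auto)
  also have "\<dots> = swm h (fst X * fst Y) 1 (\<lambda>a b. (snd X a * x) \<otimes> (snd Y b * y))"
    using assms by (simp add: snd_rep_tensor swm_mult_right[OF kron_rep_carrier] kronecker_mult rep_dims)
  also have "\<dots> = (phi X x \<otimes> phi Y y) * (comat * colv h)"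
    using assms by (simp add: kron_comat_colv phi_colv)
  finally show "phi (X \<odot> Y) (x \<otimes> y) * colv h = (phi X x \<otimes> phi Y y) * comat * colv h"
    by (simp add: mat_assoc)
qed simp_all

lemma comat_coassoc: "(comat \<otimes> \<I> d) * comat = (\<I> d \<otimes> comat) * comat"
proof (rule mat_eq_colvI)
  fix h
  have "(comat \<otimes> \<I> d) * (comat * colv h) = (\<I> d \<otimes> comat) * (comat * colv h)"
  proof (rule eq_matI)
    fix i j
    assume "i < dim_row ((\<I> d \<otimes> comat) * (comat * colv h))" "j < dim_col ((\<I> d \<otimes> comat) * (comat * colv h))"
    then have i: "i < d * (d * d)" "i < (d * d) * d" and j: "j = 0" by (simp_all add: mult.assoc)
    note b = div_less_factor[OF i(2)] mod_less_factor[OF i(1)] div_less_factor[OF i(1)] mod_less_factor[OF i(2)]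
      div_less_factor[OF div_less_factor[OF i(2)]] div_less_factor[OF mod_less_factor[OF i(1)]]
    have *: "i div d div d = i div (d * d)" "i div d mod d = i mod (d * d) div d"
      "i mod (d * d) mod d = i mod d"
      by (cases "d = 0"; simp add: div_mult2_eq mod_mult2_eq)+
    have tri: "trilinear_form (\<lambda>a b c. crd (i div d div d) a * (crd (i div d mod d) b * crd (i mod d) c))"
      by (simp add: trilinear_form_def functional_def functional_simps[OF crd_functional] algebra_simps)
    have "((comat \<otimes> \<I> d) * (comat * colv h)) $$ (i, 0)
        = sw h (\<lambda>a b. sw a (\<lambda>c e. crd (i div d div d) c * (crd (i div d mod d) e * crd (i mod d) b)))"
      using i b by (subst kron_comat_colv)
        (simp_all add: comat_colv swm_index kronecker_index swm_colv_index mult.assoc flip: sw_cmult_right)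
    also have "\<dots> = sw h (\<lambda>a b. sw b (\<lambda>c e. crd (i div d div d) a * (crd (i div d mod d) c * crd (i mod d) e)))"
      by (rule sw_coassoc[OF tri])
    also have "\<dots> = ((\<I> d \<otimes> comat) * (comat * colv h)) $$ (i, 0)"
      using i b by (subst kron_comat_colv)
        (simp_all add: comat_colv swm_index kronecker_index swm_colv_index * flip: sw_cmult)
    finally show "((comat \<otimes> \<I> d) * (comat * colv h)) $$ (i, j) = ((\<I> d \<otimes> comat) * (comat * colv h)) $$ (i, j)"
      by (simp only: j)
  qed (simp_all add: mult.assoc)
  then show "(comat \<otimes> \<I> d) * comat * colv h = (\<I> d \<otimes> comat) * comat * colv h"
    by (simp add: mat_assoc)
qed (simp_all add: mult.assoc)

lemma counit_comat: "(rowf \<epsilon> \<otimes> \<I> d) * comat = \<I> d" "(\<I> d \<otimes> rowf \<epsilon>) * comat = \<I> d"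
proof -
  have left: "(rowf \<epsilon> \<otimes> \<I> d) * (comat * colv h) = colv h" for h
    by (rule eq_matI) (simp_all add: kron_comat_colv rowf_colv[OF counit_functional] swm_index
      kronecker_index sw_counit_left[OF crd_functional])
  show "(rowf \<epsilon> \<otimes> \<I> d) * comat = \<I> d"
    by (rule mat_eq_colvI) (simp_all add: mat_assoc left)
  have right: "(\<I> d \<otimes> rowf \<epsilon>) * (comat * colv h) = colv h" for h
    using sw_counit_right[OF crd_functional]
    by (intro eq_matI) (simp_all add: kron_comat_colv rowf_colv[OF counit_functional] swm_index
      kronecker_index mult.commute[of _ "\<epsilon> _"])
  show "(\<I> d \<otimes> rowf \<epsilon>) * comat = \<I> d"
    by (rule mat_eq_colvI) (simp_all add: mat_assoc right)
qed

text \<open>The matrix form in which the law meets the categorical cointegral equation and the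
  half-braiding of \<open>cen\<close>. Testing on coordinate functionals suffices, since every
  \<open>f\<close> is a combination of them.\<close>

lemma cointegral_iff_comat:
  assumes l: "functional l"
  shows "cointegral l \<longleftrightarrow> (\<I> d \<otimes> rowf l) * comat = uvec * rowf l"
proof -
  have entry: "((\<I> d \<otimes> rowf l) * (comat * colv h)) $$ (i, 0) = sw h (\<lambda>a b. crd i a * l b)"
    "(uvec * (rowf l * colv h)) $$ (i, 0) = l h * crd i 1" if "i < d" for i h
  proof -
    show "((\<I> d \<otimes> rowf l) * (comat * colv h)) $$ (i, 0) = sw h (\<lambda>a b. crd i a * l b)"
      using that by (simp add: kron_comat_colv rowf_colv[OF l] swm_index kronecker_index)
    show "(uvec * (rowf l * colv h)) $$ (i, 0) = l h * crd i 1"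
      using that by (simp add: rowf_colv[OF l] scalar_prod_def)
  qed
  show ?thesis
  proof
    assume coint: "cointegral l"
    have *: "(\<I> d \<otimes> rowf l) * comat * colv h = uvec * rowf l * colv h" for h
      by (intro eq_matI) (simp_all add: mat_assoc entry cointegral_sw[OF coint crd_functional] del: index_mult_mat(1))
    show "(\<I> d \<otimes> rowf l) * comat = uvec * rowf l"
      by (rule mat_eq_colvI[OF _ _ _ *]) simp_all
  next
    assume eq: "(\<I> d \<otimes> rowf l) * comat = uvec * rowf l"
    have crd_eq: "sw h (\<lambda>a b. crd i a * l b) = l h * crd i 1" if "i < d" for h i
    proof -
      have "(\<I> d \<otimes> rowf l) * (comat * colv h) = uvec * (rowf l * colv h)"
        using arg_cong[OF eq, of "\<lambda>M. M * colv h"] by (simp add: mat_assoc)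
      then show ?thesis using entry[OF that, of h] by metis
    qed
    show "cointegral l" unfolding cointegral_def
    proof (intro conjI allI impI l)
      fix f x assume f: "functional f"
      have "sw x (\<lambda>a b. f a * l b) = sw x (\<lambda>a b. \<Sum>i<d. f (bas i) * (crd i a * l b))"
      proof (intro sw_cong)
        fix a b show "f a * l b = (\<Sum>i<d. f (bas i) * (crd i a * l b))"
          by (subst functional_expand[OF f]) (simp add: sum_distrib_left ac_simps)
      qed
      also have "\<dots> = (\<Sum>i<d. f (bas i) * (l x * crd i 1))"
        by (simp add: sw_sum_distrib sw_cmult crd_eq)
      also have "\<dots> = l x * f 1"
        by (subst functional_expand[OF f, of 1]) (simp add: sum_distrib_left ac_simps)
      finally show "sw x (\<lambda>a b. f a * l b) = l x * f 1" .
    qed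
  qed
qed

end

section \<open>The central Hopf comonad on modules\<close>

text \<open>
  \<open>\<integral>\<^sub>X X \<otimes> V \<otimes> X\<^sup>*\<close> is realised on \<open>H \<otimes> V\<close>. The component \<open>cmp_end X m\<close> of the universal dinatural
  transformation sends \<open>h \<otimes> v\<close> to the sum of the \<open>h e\<^sub>i \<otimes> v \<otimes> e\<^sup>i\<close>, that is, contracting
  \<open>X\<^sup>*\<close> with \<open>x\<close> gives \<open>h x \<otimes> v\<close>. The component at the regular representation is injective with
  left inverse \<open>evl\<close>, the contraction with \<open>1 \<in> H\<close>; this determines the action on \<open>H \<otimes> V\<close>.
\<close>

context fd_hopf_algebra
begin

definition cmp_end :: "('h, 'k) matrix_rep \<Rightarrow> nat \<Rightarrow> 'k mat" where
  "cmp_end X m = mat (fst X * (m * fst X)) (d * m) (\<lambda>(r, c).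
     snd X (bas (c div m)) $$ (r div (m * fst X), r mod fst X) *
     (if r div fst X mod m = c mod m then 1 else 0))"

definition evl :: "nat \<Rightarrow> 'k mat" where
  "evl m = \<I> (d * m) \<otimes> uvec\<^sup>T"

lemma dim_cmp_end [simp]:
  "dim_row (cmp_end X m) = fst X * (m * fst X)" "dim_col (cmp_end X m) = d * m"
  by (simp_all add: cmp_end_def)

lemma dim_evl [simp]: "dim_row (evl m) = d * m" "dim_col (evl m) = d * (m * d)"
  by (simp_all add: evl_def mult.assoc)

text \<open>The entries of \<open>cmp_end\<close> are evaluated only here; later arguments go
  through this contraction.\<close>

lemma cmp_end_contract:
  assumes X: "rep X" "dim_row x = fst X" "dim_col x = 1"
  shows "(\<I> (fst X * m) \<otimes> x\<^sup>T) * cmp_end X m = phi X x \<otimes> \<I> m"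
    (is "_ = ?r")
proof (rule eq_matI)
  let ?n = "fst X"
  fix r c assume "r < dim_row ?r" "c < dim_col ?r"
  then have rc: "r < ?n * m" "c < d * m" by simp_all
  note b = div_less_factor[OF rc(1)] mod_less_factor[OF rc(1)] div_less_factor[OF rc(2)] mod_less_factor[OF rc(2)]
  have k: "(r * ?n + k) div (m * ?n) = r div m" "(r * ?n + k) div ?n mod m = r mod m"
    "(r * ?n + k) mod ?n = k" "r * ?n + k < ?n * (m * ?n)" if "k < ?n" for k
  proof -
    have "(r * ?n + k) div ?n = r" using that by simp
    then show "(r * ?n + k) div (m * ?n) = r div m" "(r * ?n + k) div ?n mod m = r mod m"
      by (simp_all add: mult.commute[of m] div_mult2_eq)
    show "(r * ?n + k) mod ?n = k" using that by simp
    show "r * ?n + k < ?n * (m * ?n)" using nat_pair_less[OF rc(1) that] by (simp add: mult.assoc)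
  qed
  have "((\<I> (?n * m) \<otimes> x\<^sup>T) * cmp_end X m) $$ (r, c)
      = (\<Sum>k<?n. x $$ (k, 0) * cmp_end X m $$ (r * ?n + k, c))"
    by (rule contract_rows_index) (use assms rc in \<open>simp_all add: mult.assoc\<close>)
  also have "\<dots> = (\<Sum>k<?n. snd X (bas (c div m)) $$ (r div m, k) * x $$ (k, 0)) * (if r mod m = c mod m then 1 else 0)"
    unfolding sum_distrib_right using rc by (intro sum.cong) (simp_all add: cmp_end_def k)
  also have "\<dots> = ?r $$ (r, c)"
    using rc b assms by (simp add: kronecker_index phi_def mat_mult_index_sum rep_dims del: index_mult_mat(1))
  finally show "((\<I> (?n * m) \<otimes> x\<^sup>T) * cmp_end X m) $$ (r, c) = ?r $$ (r, c)" .
qed (use assms in auto)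

lemma evl_cmp_end: "evl m * cmp_end reg m = \<I> (d * m)"
  using cmp_end_contract[of reg uvec m] by (simp add: evl_def phi_reg_uvec)

text \<open>After contraction with \<open>x\<close> both sides become
  \<open>h \<mapsto> f (h x) = h (f x)\<close> on the first factor: dinaturality is linearity of
  \<open>f\<close> over \<open>H\<close>.\<close>

lemma cmp_end_wedge:
  assumes f: "f \<in> intertwiners X Y" and X: "rep X" and Y: "rep Y"
  shows "(f \<otimes> \<I> (m * fst X)) * cmp_end X m = (\<I> (fst Y * m) \<otimes> f\<^sup>T) * cmp_end Y m"
    (is "?l = ?r")
proof (rule contract_rows_eqI[of _ "fst Y * m" "fst X"])
  note [simp] = hom_dims[OF f]
  fix x :: "'k mat" assume x: "dim_row x = fst X" "dim_col x = 1"
  have "(\<I> (fst Y * m) \<otimes> x\<^sup>T) * ?l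
      = ((\<I> (fst Y * m) \<otimes> x\<^sup>T) * ((f \<otimes> \<I> m) \<otimes> \<I> (fst X))) * cmp_end X m"
    by (simp add: mat_assoc kronecker_one_split x mult.assoc)
  also have "\<dots> = (f \<otimes> \<I> m) * ((\<I> (fst X * m) \<otimes> x\<^sup>T) * cmp_end X m)"
    by (subst contract_commute[of _ _ "fst X * m"]) (simp_all add: x mat_assoc mult.assoc)
  also have "\<dots> = phi Y (f * x) \<otimes> \<I> m"
    using X Y x by (simp add: cmp_end_contract kronecker_mult hom_phi[OF f])
  also have "\<dots> = (\<I> (fst Y * m) \<otimes> (f * x)\<^sup>T) * cmp_end Y m"
    by (rule cmp_end_contract[symmetric]) (simp_all add: Y x)
  also have "\<dots> = (\<I> (fst Y * m) \<otimes> x\<^sup>T) * ?r"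
    by (simp add: contract_transpose x mult.assoc flip: mat_assoc)
  finally show "(\<I> (fst Y * m) \<otimes> x\<^sup>T) * ?l
    = (\<I> (fst Y * m) \<otimes> x\<^sup>T) * ?r" .
qed (use hom_dims[OF f] in \<open>simp_all add: mult.assoc\<close>)

text \<open>
  Wedges over the endomorphisms of the regular representation alone already factor through the end.
\<close>

lemma cmp_end_image:
  assumes t: "dim_row t = d * (m * d)"
    and eq: "\<And>y. dim_row y = d \<Longrightarrow> dim_col y = 1 \<Longrightarrow>
      (phi reg y \<otimes> \<I> (m * d)) * t = (\<I> (d * m) \<otimes> (phi reg y)\<^sup>T) * t"
  shows "cmp_end reg m * (evl m * t) = t"
    (is "?l = _")
proof (rule contract_rows_eqI[of _ "d * m" d])
  \<comment> \<open>Contracting with \<open>y\<close> is contracting with 1 after the right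
    multiplication \<open>phi reg y\<close>, which takes 1 to \<open>y\<close>; the hypothesis
    trades it for the same map on the first factor.\<close>
  fix y :: "'k mat" assume y: "dim_row y = d" "dim_col y = 1"
  have "(\<I> (d * m) \<otimes> y\<^sup>T) * ?l
      = ((\<I> (d * m) \<otimes> y\<^sup>T) * cmp_end reg m) * (evl m * t)"
    by (simp add: mat_assoc y t mult.assoc)
  also have "\<dots> = (phi reg y \<otimes> \<I> m) * (evl m * t)"
    using cmp_end_contract[of reg y m] y by simp
  also have "\<dots> = ((phi reg y \<otimes> \<I> m) * evl m) * t"
    by (simp add: mat_assoc t mult.assoc)
  also have "(phi reg y \<otimes> \<I> m) * evl m = evl m * (phi reg y \<otimes> \<I> (m * d))"
    unfolding evl_def kronecker_one_split by (rule contract_commute[symmetric]) simp_all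
  also have "\<dots> * t = evl m * ((\<I> (d * m) \<otimes> (phi reg y)\<^sup>T) * t)"
    by (simp add: mat_assoc t eq[OF y])
  also have "\<dots> = (\<I> (d * m) \<otimes> (phi reg y * uvec)\<^sup>T) * t"
    by (simp add: evl_def t mult.assoc contract_transpose flip: mat_assoc)
  also have "phi reg y * uvec = y"
    by (rule phi_uvec) (simp_all add: y)
  finally show "(\<I> (d * m) \<otimes> y\<^sup>T) * ?l = (\<I> (d * m) \<otimes> y\<^sup>T) * t" .
qed (simp_all add: t mult.assoc)

definition cen :: "('h, 'k) matrix_rep \<Rightarrow> ('h, 'k) matrix_rep" where
  "cen V = (d * fst V, \<lambda>x. evl (fst V) * (snd (reg \<odot> V \<odot> dual_rep reg) x * cmp_end reg (fst V)))"

lemma fst_cen [simp]: "fst (cen V) = d * fst V" by (simp add: cen_def)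

abbreviation sandwich :: "('h, 'k) matrix_rep \<Rightarrow> ('h, 'k) matrix_rep \<Rightarrow> ('h, 'k) matrix_rep \<Rightarrow> ('h, 'k) matrix_rep"
  where "sandwich X V Y \<equiv> X \<odot> V \<odot> dual_rep Y"

lemma sandwich_left_hom:
  assumes "f \<in> intertwiners X Y" "rep X" "rep Y" "rep V" "rep W"
  shows "f \<otimes> \<I> (fst V * fst W) \<in> intertwiners (sandwich X V W) (sandwich Y V W)"
proof -
  have "f \<otimes> \<I> (fst (V \<odot> dual_rep W)) \<in> intertwiners (sandwich X V W) (sandwich Y V W)"
    using assms by blast
  then show ?thesis by simp
qed

lemma sandwich_right_hom:
  assumes "f \<in> intertwiners X Y" "rep X" "rep Y" "rep V" "rep W"
  shows "\<I> (fst W * fst V) \<otimes> f\<^sup>T \<in> intertwiners (sandwich W V Y) (sandwich W V X)"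
proof -
  have "\<I> (fst W) \<otimes> (\<I> (fst V) \<otimes> f\<^sup>T) \<in> intertwiners (sandwich W V Y) (sandwich W V X)"
    by (intro hom_tensor hom_id dual_hom rep_tensor_rep dual_rep_rep) (rule assms)+
  then show ?thesis by simp
qed

text \<open>The image of \<open>cmp_end reg\<close> is stable under \<open>H\<close>: it is cut out
  by the wedge conditions for the right multiplications \<open>phi reg y\<close>, and these are
  module maps. So the formula in \<open>cen\<close> restricts the action to this image.\<close>

lemma cmp_end_reg_action:
  assumes V: "rep V"
  shows "cmp_end reg (fst V) * snd (cen V) x = snd (sandwich reg V reg) x * cmp_end reg (fst V)"
proof -
  let ?s = "sandwich reg V reg" and ?m = "fst V"
  have s: "rep ?s" using V by simp
  note [simp] = rep_dims[OF s]
  have "cmp_end reg ?m * (evl ?m * (snd ?s x * cmp_end reg ?m)) = snd ?s x * cmp_end reg ?m"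
  proof (rule cmp_end_image)
    fix y :: "'k mat" assume y: "dim_row y = d" "dim_col y = 1"
    have R: "phi reg y \<in> intertwiners reg reg" using y by (intro phi_hom) simp_all
    note l = hom_comm[OF sandwich_left_hom[OF R rep_reg rep_reg V rep_reg], of x]
    note r = hom_comm[OF sandwich_right_hom[OF R rep_reg rep_reg V rep_reg], of x]
    have "(phi reg y \<otimes> \<I> (?m * d)) * (snd ?s x * cmp_end reg ?m)
        = ((phi reg y \<otimes> \<I> (?m * d)) * snd ?s x) * cmp_end reg ?m"
      by (rule mat_assoc[symmetric]) simp_all
    also have "\<dots> = (snd ?s x * (phi reg y \<otimes> \<I> (?m * d))) * cmp_end reg ?m"
      using l by simp
    also have "\<dots> = snd ?s x * ((phi reg y \<otimes> \<I> (?m * d)) * cmp_end reg ?m)"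
      by (rule mat_assoc) simp_all
    also have "\<dots> = snd ?s x * ((\<I> (d * ?m) \<otimes> (phi reg y)\<^sup>T) * cmp_end reg ?m)"
      using cmp_end_wedge[OF R rep_reg rep_reg, of ?m] by simp
    also have "\<dots> = (snd ?s x * (\<I> (d * ?m) \<otimes> (phi reg y)\<^sup>T)) * cmp_end reg ?m"
      by (rule mat_assoc[symmetric]) (simp_all add: mult.assoc)
    also have "\<dots> = ((\<I> (d * ?m) \<otimes> (phi reg y)\<^sup>T) * snd ?s x) * cmp_end reg ?m"
      using r by simp
    also have "\<dots> = (\<I> (d * ?m) \<otimes> (phi reg y)\<^sup>T) * (snd ?s x * cmp_end reg ?m)"
      by (rule mat_assoc) (simp_all add: mult.assoc)
    finally show "(phi reg y \<otimes> \<I> (?m * d)) * (snd ?s x * cmp_end reg ?m)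
        = (\<I> (d * ?m) \<otimes> (phi reg y)\<^sup>T) * (snd ?s x * cmp_end reg ?m)" .
  qed simp
  then show ?thesis by (simp add: cen_def)
qed

lemma cmp_end_cancel:
  assumes "cmp_end reg m * A = cmp_end reg m * B" "dim_row A = d * m" "dim_row B = d * m"
  shows "A = B"
proof -
  have "evl m * (cmp_end reg m * A) = evl m * (cmp_end reg m * B)" using assms(1) by simp
  then show ?thesis using assms(2,3) by (simp add: evl_cmp_end flip: mat_assoc)
qed

lemma dim_cen [simp]: "dim_row (snd (cen V) x) = d * fst V" "dim_col (snd (cen V) x) = d * fst V"
  by (simp_all add: cen_def)

lemma cen_rep [simp, intro]:
  assumes V: "rep V" shows "rep (cen V)"
proof -
  let ?s = "sandwich reg V reg" and ?J = "cmp_end reg (fst V)"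
  have s: "rep ?s" using V by simp
  note [simp] = rep_dims[OF s]
  have "snd (cen V) (x * y) = snd (cen V) x * snd (cen V) y" for x y
  proof (rule cmp_end_cancel)
    have "?J * (snd (cen V) x * snd (cen V) y) = (?J * snd (cen V) x) * snd (cen V) y"
      by (rule mat_assoc[symmetric]) simp_all
    also have "\<dots> = snd ?s x * (?J * snd (cen V) y)"
      unfolding cmp_end_reg_action[OF V, of x] by (rule mat_assoc) simp_all
    also have "\<dots> = ?J * snd (cen V) (x * y)"
      unfolding cmp_end_reg_action[OF V] rep_mult[OF s] by (rule mat_assoc[symmetric]) simp_all
    finally show "?J * snd (cen V) (x * y) = ?J * (snd (cen V) x * snd (cen V) y)" ..
  qed simp_all
  moreover have "snd (cen V) 1 = \<I> (fst (cen V))"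
    by (simp add: cen_def rep_one[OF s] evl_cmp_end)
  moreover have "snd (cen V) (x + y) = snd (cen V) x + snd (cen V) y" for x y
  proof -
    have "(snd ?s x + snd ?s y) * ?J = snd ?s x * ?J + snd ?s y * ?J"
      by (rule add_mult_distrib_mat[of _ "d * (fst V * d)" "d * (fst V * d)" _ _ "d * fst V"]) (auto intro!: carrier_matI)
    moreover have "evl (fst V) * (snd ?s x * ?J + snd ?s y * ?J) = evl (fst V) * (snd ?s x * ?J) + evl (fst V) * (snd ?s y * ?J)"
      by (rule mult_add_distrib_mat[of _ "d * fst V" "d * (fst V * d)" _ "d * fst V"]) (auto intro!: carrier_matI)
    ultimately show ?thesis by (simp add: cen_def rep_add[OF s])
  qed
  moreover have "snd (cen V) (scale c x) = c \<cdot>\<^sub>m snd (cen V) x" for c x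
  proof -
    have "(c \<cdot>\<^sub>m snd ?s x) * ?J = c \<cdot>\<^sub>m (snd ?s x * ?J)"
      by (rule mult_smult_assoc_mat[of _ "d * (fst V * d)" "d * (fst V * d)" _ "d * fst V"]) (auto intro!: carrier_matI)
    moreover have "evl (fst V) * (c \<cdot>\<^sub>m (snd ?s x * ?J)) = c \<cdot>\<^sub>m (evl (fst V) * (snd ?s x * ?J))"
      by (rule mult_smult_distrib[of _ "d * fst V" "d * (fst V * d)" _ "d * fst V"]) (auto intro!: carrier_matI)
    ultimately show ?thesis by (simp add: cen_def rep_scale[OF s])
  qed
  moreover have "snd (cen V) x \<in> carrier_mat (fst (cen V)) (fst (cen V))" for x
    by (auto intro!: carrier_matI)
  ultimately show ?thesis by (simp add: rep_def is_matrix_rep_def)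
qed

text \<open>Contraction with \<open>phi X x\<close> instead of \<open>x\<close> stays within module
  maps, replacing the dual of \<open>X\<close> by that of the regular representation. A further
  contraction with 1 gives back the contraction with \<open>x\<close>.\<close>

lemma contract_phi_eqI:
  fixes M :: "'k mat"
  assumes X: "rep X" and "dim_row M = N * fst X" "dim_row M' = N * fst X" "dim_col M = dim_col M'"
    and eq: "\<And>x. dim_row x = fst X \<Longrightarrow> dim_col x = 1 \<Longrightarrow>
      (\<I> N \<otimes> (phi X x)\<^sup>T) * M = (\<I> N \<otimes> (phi X x)\<^sup>T) * M'"
  shows "M = M'"
proof (rule contract_rows_eqI[of _ N "fst X"])
  fix x :: "'k mat" assume x: "dim_row x = fst X" "dim_col x = 1"
  have *: "(\<I> N \<otimes> uvec\<^sup>T) * ((\<I> N \<otimes> (phi X x)\<^sup>T) * A) = (\<I> N \<otimes> x\<^sup>T) * A"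
    if "dim_row A = N * fst X" for A
    using that by (simp add: contract_transpose phi_uvec[OF X x] flip: mat_assoc)
  show "(\<I> N \<otimes> x\<^sup>T) * M = (\<I> N \<otimes> x\<^sup>T) * M'"
    using *[of M] *[of M'] eq[OF x] assms by simp
qed (use assms in auto)

text \<open>Compatibility with the action is known at the regular representation; the wedge
  condition along the module map \<open>phi X x\<close> carries it to \<open>X\<close>.\<close>

lemma cmp_end_hom:
  assumes X: "rep X" and V: "rep V"
  shows "cmp_end X (fst V) \<in> intertwiners (cen V) (sandwich X V X)"
proof -
  let ?m = "fst V"
  have s: "rep (sandwich X V X)" "rep (sandwich X V reg)" "rep (sandwich reg V reg)" using X V by simp_all
  note [simp] = rep_dims[OF s(1)] rep_dims[OF s(2)] rep_dims[OF s(3)]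
  have "cmp_end X ?m * snd (cen V) h = snd (sandwich X V X) h * cmp_end X ?m" for h
  proof (rule contract_phi_eqI[OF X, of _ "fst X * ?m"])
    fix x :: "'k mat" assume x: "dim_row x = fst X" "dim_col x = 1"
    have f: "phi X x \<in> intertwiners reg X" using X x by (rule phi_hom)
    note w = cmp_end_wedge[OF f rep_reg X, of ?m, simplified]
    let ?T = "\<I> (fst X * ?m) \<otimes> (phi X x)\<^sup>T" and ?P = "phi X x \<otimes> \<I> (?m * d)"
    have "?T * (cmp_end X ?m * snd (cen V) h) = (?T * cmp_end X ?m) * snd (cen V) h"
      by (rule mat_assoc[symmetric]) (simp_all add: mult.assoc)
    also have "\<dots> = ?P * (cmp_end reg ?m * snd (cen V) h)"
      unfolding w[symmetric] by (rule mat_assoc) simp_all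
    also have "\<dots> = (?P * snd (sandwich reg V reg) h) * cmp_end reg ?m"
      unfolding cmp_end_reg_action[OF V] by (rule mat_assoc[symmetric]) simp_all
    also have "?P * snd (sandwich reg V reg) h = snd (sandwich X V reg) h * ?P"
      using hom_comm[OF sandwich_left_hom[OF f rep_reg X V rep_reg], of h] by simp
    also have "\<dots> * cmp_end reg ?m = snd (sandwich X V reg) h * (?T * cmp_end X ?m)"
      unfolding w[symmetric] by (rule mat_assoc) simp_all
    also have "\<dots> = (snd (sandwich X V reg) h * ?T) * cmp_end X ?m"
      by (rule mat_assoc[symmetric]) (simp_all add: mult.assoc)
    also have "snd (sandwich X V reg) h * ?T = ?T * snd (sandwich X V X) h"
      using hom_comm[OF sandwich_right_hom[OF f rep_reg X V X], of h] by simp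
    also have "\<dots> * cmp_end X ?m = ?T * (snd (sandwich X V X) h * cmp_end X ?m)"
      by (rule mat_assoc) (simp_all add: mult.assoc)
    finally show "?T * (cmp_end X ?m * snd (cen V) h) = ?T * (snd (sandwich X V X) h * cmp_end X ?m)" .
  qed (simp_all add: mult.assoc)
  then show ?thesis by (simp add: intertwiners_iff)
qed

text \<open>\<open>cmp_end reg\<close> intertwines the actions and has a left inverse, so it
  reflects module maps.\<close>

lemma hom_via_cmp_end:
  assumes M: "cmp_end reg (fst V) * M \<in> intertwiners W (sandwich reg V reg)"
    and "dim_row M = d * fst V" and V: "rep V" and W: "rep W"
  shows "M \<in> intertwiners W (cen V)"
proof -
  let ?J = "cmp_end reg (fst V)" and ?s = "sandwich reg V reg"
  have s: "rep ?s" using V by simp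
  note [simp] = rep_dims[OF s] rep_dims[OF W]
  have [simp]: "dim_col M = fst W" using hom_dims[OF M] by simp
  have "M * snd W x = snd (cen V) x * M" for x
  proof (rule cmp_end_cancel)
    have "?J * (M * snd W x) = (?J * M) * snd W x"
      by (rule mat_assoc[symmetric]) (simp_all add: assms)
    also have "\<dots> = (snd ?s x * ?J) * M"
      unfolding hom_comm[OF M] by (rule mat_assoc[symmetric]) (simp_all add: assms)
    also have "\<dots> = ?J * (snd (cen V) x * M)"
      unfolding cmp_end_reg_action[OF V, symmetric] by (rule mat_assoc) (simp_all add: assms)
    finally show "?J * (M * snd W x) = ?J * (snd (cen V) x * M)" .
  qed (simp_all add: assms)
  then show ?thesis by (simp add: intertwiners_iff assms)
qed

text \<open>\<open>central_wedge\<close> for modules, with dual maps written as transposes.\<close>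

definition wedge :: "('h, 'k) matrix_rep \<Rightarrow> ('h, 'k) matrix_rep \<Rightarrow> (('h, 'k) matrix_rep \<Rightarrow> 'k mat) \<Rightarrow> bool" where
  "wedge V W j \<longleftrightarrow> (\<forall>X. rep X \<longrightarrow> j X \<in> intertwiners W (sandwich X V X)) \<and>
     (\<forall>X Y. \<forall>f\<in>intertwiners X Y. rep X \<longrightarrow> rep Y \<longrightarrow>
        (f \<otimes> \<I> (fst V * fst X)) * j X = (\<I> (fst Y * fst V) \<otimes> f\<^sup>T) * j Y)"

lemma wedge_cmp_end: "rep V \<Longrightarrow> wedge V (cen V) (\<lambda>X. cmp_end X (fst V))"
  by (simp add: wedge_def cmp_end_hom cmp_end_wedge)

text \<open>The left inverse at the regular representation forces the factorisation to be
  \<open>evl * j reg\<close>. It works there by \<open>cmp_end_image\<close>, and the maps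
  \<open>phi X x\<close> extend this to all \<open>X\<close>.\<close>

lemma end_factor:
  assumes j: "wedge V W j" and V: "rep V" and W: "rep W"
  shows "evl (fst V) * j reg \<in> intertwiners W (cen V)"
    and "rep X \<Longrightarrow> cmp_end X (fst V) * (evl (fst V) * j reg) = j X"
proof -
  let ?m = "fst V"
  have jh: "j X \<in> intertwiners W (sandwich X V X)" if "rep X" for X
    using j that unfolding wedge_def by blast
  have dims [simp]: "dim_row (j X) = fst X * (?m * fst X)" "dim_col (j X) = fst W" if "rep X" for X
    using hom_dims[OF jh[OF that]] by simp_all
  have jw: "(f \<otimes> \<I> (?m * fst X)) * j X = (\<I> (fst Y * ?m) \<otimes> f\<^sup>T) * j Y"
    if "f \<in> intertwiners X Y" "rep X" "rep Y" for f X Y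
    using j that unfolding wedge_def by blast
  have reg: "cmp_end reg ?m * (evl ?m * j reg) = j reg"
  proof (rule cmp_end_image)
    fix y :: "'k mat" assume "dim_row y = d" "dim_col y = 1"
    then have "phi reg y \<in> intertwiners reg reg" by (intro phi_hom) simp_all
    from jw[OF this rep_reg rep_reg]
    show "(phi reg y \<otimes> \<I> (?m * d)) * j reg = (\<I> (d * ?m) \<otimes> (phi reg y)\<^sup>T) * j reg" by simp
  qed simp
  show "evl ?m * j reg \<in> intertwiners W (cen V)"
    by (rule hom_via_cmp_end) (simp_all add: reg jh V W)
  show "cmp_end X ?m * (evl ?m * j reg) = j X" if X: "rep X"
  proof (rule contract_phi_eqI[OF X, of _ "fst X * ?m"])
    fix x :: "'k mat" assume x: "dim_row x = fst X" "dim_col x = 1"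
    have f: "phi X x \<in> intertwiners reg X" using X x by (rule phi_hom)
    let ?T = "\<I> (fst X * ?m) \<otimes> (phi X x)\<^sup>T" and ?P = "phi X x \<otimes> \<I> (?m * d)"
    have "?T * (cmp_end X ?m * (evl ?m * j reg)) = (?T * cmp_end X ?m) * (evl ?m * j reg)"
      by (rule mat_assoc[symmetric]) (simp_all add: mult.assoc)
    also have "?T * cmp_end X ?m = ?P * cmp_end reg ?m"
      using cmp_end_wedge[OF f rep_reg X, of ?m] by simp
    also have "\<dots> * (evl ?m * j reg) = ?P * j reg"
      by (subst mat_assoc) (simp_all add: reg)
    also have "\<dots> = ?T * j X"
      using jw[OF f rep_reg X] by simp
    finally show "?T * (cmp_end X ?m * (evl ?m * j reg)) = ?T * j X" .
  qed (simp_all add: X mult.assoc)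
qed

lemma end_factor_unique:
  assumes "dim_row g = d * fst V" "dim_row g' = d * fst V"
    and "\<And>X. rep X \<Longrightarrow> cmp_end X (fst V) * g = cmp_end X (fst V) * g'"
  shows "g = g'"
  using cmp_end_cancel[OF assms(3)[OF rep_reg] assms(1,2)] .

end

lemma kronecker_col_split:
  fixes x y :: "'a::comm_semiring_1 mat"
  assumes "dim_col x = 1" "dim_row x = n" "dim_col y = 1"
  shows "(\<I> n \<otimes> y) * x = x \<otimes> y"
  using assms kronecker_mult[of "\<I> n" x y "\<I> 1"] by simp

lemma kronecker_outer:
  fixes x y :: "'a::comm_semiring_1 mat"
  assumes "dim_col y = 1" "dim_row x = 1"
  shows "y \<otimes> x = y * x"
  using assms kronecker_mult[of y "\<I> 1" "\<I> 1" x] by simp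

lemma contract_rows2_eqI:
  fixes M :: "'a::comm_semiring_1 mat"
  assumes "dim_row M = N * (m * n)" "dim_row M' = N * (m * n)" "dim_col M = dim_col M'"
    and eq: "\<And>x y. dim_row x = n \<Longrightarrow> dim_col x = 1 \<Longrightarrow> dim_row y = m \<Longrightarrow> dim_col y = 1 \<Longrightarrow>
      (\<I> N \<otimes> (y\<^sup>T \<otimes> x\<^sup>T)) * M = (\<I> N \<otimes> (y\<^sup>T \<otimes> x\<^sup>T)) * M'"
  shows "M = M'"
proof (rule contract_rows_eqI[of _ "N * m" n])
  fix x :: "'a mat" assume x: "dim_row x = n" "dim_col x = 1"
  show "(\<I> (N * m) \<otimes> x\<^sup>T) * M = (\<I> (N * m) \<otimes> x\<^sup>T) * M'"
  proof (rule contract_rows_eqI[of _ N m])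
    fix y :: "'a mat" assume y: "dim_row y = m" "dim_col y = 1"
    have *: "(\<I> N \<otimes> y\<^sup>T) * ((\<I> (N * m) \<otimes> x\<^sup>T) * A)
        = (\<I> N \<otimes> (y\<^sup>T \<otimes> x\<^sup>T)) * A" if "dim_row A = N * (m * n)" for A
    proof -
      have "(\<I> N \<otimes> y\<^sup>T) * (\<I> (N * m) \<otimes> x\<^sup>T)
          = \<I> N \<otimes> (y\<^sup>T \<otimes> x\<^sup>T)"
        using kronecker_mult[of "\<I> N \<otimes> y\<^sup>T" "\<I> (N * m)" "\<I> 1" "x\<^sup>T"] x y
        by (simp add: kronecker_assoc)
      then show ?thesis using x y that by (simp add: mult.assoc flip: mat_assoc)
    qed
    show "(\<I> N \<otimes> y\<^sup>T) * ((\<I> (N * m) \<otimes> x\<^sup>T) * M)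
        = (\<I> N \<otimes> y\<^sup>T) * ((\<I> (N * m) \<otimes> x\<^sup>T) * M')"
      using *[of M] *[of M'] eq[OF x y] assms by simp
  qed (use x assms in auto)
qed (use assms in \<open>auto simp: mult.assoc\<close>)

lemma contract_cols2_eqI:
  fixes M :: "'a::comm_semiring_1 mat"
  assumes "dim_col M = N * (m * n)" "dim_col M' = N * (m * n)" "dim_row M = dim_row M'"
    and eq: "\<And>x y. dim_row x = m \<Longrightarrow> dim_col x = 1 \<Longrightarrow> dim_row y = n \<Longrightarrow> dim_col y = 1 \<Longrightarrow>
      M * (\<I> N \<otimes> (x \<otimes> y)) = M' * (\<I> N \<otimes> (x \<otimes> y))"
  shows "M = M'"
proof -
  have "M\<^sup>T = M'\<^sup>T"
  proof (rule contract_rows2_eqI[of _ N m n])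
    fix x y :: "'a mat" assume xy: "dim_row x = n" "dim_col x = 1" "dim_row y = m" "dim_col y = 1"
    have *: "(\<I> N \<otimes> (y\<^sup>T \<otimes> x\<^sup>T)) * X\<^sup>T = (X * (\<I> N \<otimes> (y \<otimes> x)))\<^sup>T"
      if "dim_col X = N * (m * n)" for X :: "'a mat"
      using that xy by (simp add: mat_transpose_mult kronecker_transpose)
    show "(\<I> N \<otimes> (y\<^sup>T \<otimes> x\<^sup>T)) * M\<^sup>T
        = (\<I> N \<otimes> (y\<^sup>T \<otimes> x\<^sup>T)) * M'\<^sup>T"
      using *[of M] *[of M'] eq[of y x] assms xy by simp
  qed (use assms in auto)
  then show ?thesis by (metis transpose_transpose)
qed

lemma evm_coevm_zigzag:
  shows "(evm n \<otimes> \<I> n) * (\<I> n \<otimes> coevm n) = (\<I> n :: 'a::comm_semiring_1 mat)"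
    (is "?l = _")
proof (rule contract_rows_eqI[of _ 1 n])
  fix x :: "'a mat" assume x: "dim_row x = n" "dim_col x = 1"
  have "x\<^sup>T * ?l = x\<^sup>T"
    using partial_transpose_contract[of x n "coevm n" n] x by (simp add: coevm_contract)
  then show "(\<I> 1 \<otimes> x\<^sup>T) * ?l
      = (\<I> 1 \<otimes> x\<^sup>T) * \<I> n" using x by simp
qed simp_all

section \<open>The tensor category of modules and the comonad structure on it\<close>

context fd_hopf_algebra
begin

abbreviation Hmod :: "(('h, 'k) matrix_rep, 'k mat) tensor_category" where
  "Hmod \<equiv> modules scale \<Delta> \<epsilon> S"

lemma modules_simps [simp]:
  "obj Hmod = {X. rep X}" "mor Hmod = intertwiners" "cmp Hmod = (*)"
  "idt Hmod X = \<I> (fst X)" "zer Hmod X Y = 0\<^sub>m (fst Y) (fst X)"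
  "tens Hmod = rep_tensor \<Delta>" "tensm Hmod = kronecker" "unt Hmod = unit_rep"
  "ldual Hmod = dual_rep" "ev Hmod X = evm (fst X)" "coev Hmod X = coevm (fst X)"
  by (auto simp: modules_def rep_def unit_rep_def evm_def coevm_def case_prod_beta')

text \<open>\<open>dual_map\<close> is a partial transpose of \<open>f\<close> applied to the first
  factor of the coevaluation, and contracting that tensor with \<open>x\<close> leaves
  \<open>f * x\<close>.\<close>

lemma dual_map_eq:
  assumes f: "f \<in> intertwiners X Y"
  shows "dual_map Hmod X Y f = f\<^sup>T"
proof (rule contract_rows_eqI[of _ 1 "fst X"])
  note [simp] = hom_dims[OF f]
  let ?n = "fst X" and ?m = "fst Y"
  fix x :: "'k mat" assume x: "dim_row x = ?n" "dim_col x = 1"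
  have "(\<I> ?m \<otimes> f \<otimes> \<I> ?n) * (\<I> ?m \<otimes> coevm ?n) = \<I> ?m \<otimes> ((f \<otimes> \<I> ?n) * coevm ?n)"
    by (simp add: kronecker_mult)
  then have "x\<^sup>T * dual_map Hmod X Y f = ((\<I> ?m \<otimes> x\<^sup>T) * ((f \<otimes> \<I> ?n) * coevm ?n))\<^sup>T"
    using partial_transpose_contract[of x ?n "(f \<otimes> \<I> ?n) * coevm ?n" ?m] x
    by (simp add: dual_map_def)
  also have "(\<I> ?m \<otimes> x\<^sup>T) * ((f \<otimes> \<I> ?n) * coevm ?n)
      = ((\<I> ?m \<otimes> x\<^sup>T) * (f \<otimes> \<I> ?n)) * coevm ?n"
    by (rule mat_assoc[symmetric]) (simp_all add: x)
  also have "\<dots> = f * x"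
    using x by (simp add: contract_commute[of f ?m ?n] mat_assoc coevm_contract)
  finally show "(\<I> 1 \<otimes> x\<^sup>T) * dual_map Hmod X Y f = (\<I> 1 \<otimes> x\<^sup>T) * f\<^sup>T"
    using x by (simp add: mat_transpose_mult)
qed (use hom_dims[OF f] in \<open>simp_all add: dual_map_def\<close>)

lemma dim_dual_tens [simp]:
  "dim_row (dual_tens Hmod X Y) = fst Y * fst X" "dim_col (dual_tens Hmod X Y) = fst X * fst Y"
  by (simp_all add: dual_tens_def)

text \<open>In coordinates \<open>dual_tens\<close> only reorders the two dual factors. It is again
  a partial transpose, this time of two nested coevaluations.\<close>

lemma dual_tens_contract:
  assumes x: "dim_row x = fst X" "dim_col x = 1" and y: "dim_row y = fst Y" "dim_col y = 1"
  shows "(y\<^sup>T \<otimes> x\<^sup>T) * dual_tens Hmod X Y = (x \<otimes> y)\<^sup>T"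
proof -
  let ?n = "fst X" and ?m = "fst Y"
  let ?t = "(\<I> ?n \<otimes> coevm ?m \<otimes> \<I> ?n) * coevm ?n"
  have "(y \<otimes> x)\<^sup>T * dual_tens Hmod X Y = ((\<I> (?n * ?m) \<otimes> (y \<otimes> x)\<^sup>T) * ?t)\<^sup>T"
    unfolding dual_tens_def using x y
    by (simp only: modules_simps fst_rep_tensor fst_rep_dual) (rule partial_transpose_contract, simp_all add: mult.assoc)
  also have "(\<I> (?n * ?m) \<otimes> (y \<otimes> x)\<^sup>T) * ?t = x \<otimes> y"
  proof -
    have "\<I> (?n * ?m) \<otimes> (y \<otimes> x)\<^sup>T = \<I> ?n \<otimes> ((\<I> ?m \<otimes> y\<^sup>T) \<otimes> x\<^sup>T)"
      by (simp add: kronecker_transpose kronecker_assoc)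
    then have "(\<I> (?n * ?m) \<otimes> (y \<otimes> x)\<^sup>T) * (\<I> ?n \<otimes> coevm ?m \<otimes> \<I> ?n)
        = \<I> ?n \<otimes> (y \<otimes> x\<^sup>T)"
      using x y by (simp add: kronecker_mult coevm_contract)
    also have "\<dots> = (\<I> ?n \<otimes> y) * (\<I> ?n \<otimes> x\<^sup>T)"
      using x y by (simp add: kronecker_outer kronecker_mult)
    finally have "(\<I> (?n * ?m) \<otimes> (y \<otimes> x)\<^sup>T) * ?t
        = (\<I> ?n \<otimes> y) * ((\<I> ?n \<otimes> x\<^sup>T) * coevm ?n)"
      using x y by (simp add: mult.assoc flip: mat_assoc)
    then show ?thesis using x y by (simp add: coevm_contract kronecker_col_split)
  qed
  finally show ?thesis by (simp add: kronecker_transpose)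
qed

lemma dual_tens_hom:
  assumes X: "rep X" and Y: "rep Y"
  shows "dual_tens Hmod X Y \<in> intertwiners (dual_rep (X \<odot> Y)) (dual_rep Y \<odot> dual_rep X)"
proof -
  let ?n = "fst X" and ?m = "fst Y" and ?D = "dual_rep (X \<odot> Y)"
  have "\<I> ?n \<otimes> coevm ?m \<otimes> \<I> (fst (dual_rep X)) \<in> intertwiners (X \<odot> unit_rep \<odot> dual_rep X) (X \<odot> (Y \<odot> dual_rep Y) \<odot> dual_rep X)"
    by (intro hom_tensor hom_id coevm_hom rep_tensor_rep dual_rep_rep unit_rep X Y)
  then have "(\<I> ?n \<otimes> coevm ?m \<otimes> \<I> ?n) * coevm ?n \<in> intertwiners unit_rep (X \<odot> (Y \<odot> dual_rep Y) \<odot> dual_rep X)"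
    using X Y by (intro hom_comp[of _ _ "X \<odot> dual_rep X"]) auto
  then have "\<I> (fst ?D) \<otimes> ((\<I> ?n \<otimes> coevm ?m \<otimes> \<I> ?n) * coevm ?n)
      \<in> intertwiners (?D \<odot> unit_rep) (?D \<odot> (X \<odot> (Y \<odot> dual_rep Y) \<odot> dual_rep X))"
    by (intro hom_tensor hom_id rep_tensor_rep dual_rep_rep unit_rep X Y)
  moreover have "evm (fst (X \<odot> Y)) \<otimes> \<I> (fst (dual_rep Y \<odot> dual_rep X))
      \<in> intertwiners ((?D \<odot> (X \<odot> Y)) \<odot> (dual_rep Y \<odot> dual_rep X)) (unit_rep \<odot> (dual_rep Y \<odot> dual_rep X))"
    by (intro hom_tensor hom_id evm_hom rep_tensor_rep dual_rep_rep unit_rep X Y)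
  ultimately show ?thesis
    unfolding dual_tens_def modules_simps using X Y
    by (intro hom_comp[of _ _ "?D \<odot> X \<odot> Y \<odot> dual_rep Y \<odot> dual_rep X"]) (simp_all add: tensor_assoc)
qed

text \<open>The element 1 acts as the identity of \<open>X\<close>, whose tensor is the
  coevaluation. So the unit of the comonad is the vector of 1 in \<open>H\<close>.\<close>

lemma cmp_end_uvec:
  assumes X: "rep X" shows "cmp_end X 1 * uvec = coevm (fst X)"
proof (rule contract_rows_eqI[of _ "fst X" "fst X"])
  fix x :: "'k mat" assume x: "dim_row x = fst X" "dim_col x = 1"
  have "(\<I> (fst X) \<otimes> x\<^sup>T) * (cmp_end X 1 * uvec) = ((\<I> (fst X) \<otimes> x\<^sup>T) * cmp_end X 1) * uvec"
    using x by (simp add: mat_assoc)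
  also have "\<dots> = x"
    using cmp_end_contract[OF X x, of 1] phi_uvec[OF X x] by simp
  finally show "(\<I> (fst X) \<otimes> x\<^sup>T) * (cmp_end X 1 * uvec) = (\<I> (fst X) \<otimes> x\<^sup>T) * coevm (fst X)"
    using x by (simp add: coevm_contract)
qed simp_all

lemma uvec_hom: "uvec \<in> intertwiners unit_rep (cen unit_rep)"
  by (rule hom_via_cmp_end) (use coevm_hom[OF rep_reg] cmp_end_uvec[OF rep_reg] in simp_all)

lemma cmp_end_natural:
  assumes X: "rep X" and f: "dim_row f = m'" "dim_col f = m"
  shows "cmp_end X m' * (\<I> d \<otimes> f) = (\<I> (fst X) \<otimes> f \<otimes> \<I> (fst X)) * cmp_end X m"
    (is "?l = _")
proof (rule contract_rows_eqI[of _ "fst X * m'" "fst X"])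
  let ?n = "fst X"
  fix x :: "'k mat" assume x: "dim_row x = ?n" "dim_col x = 1"
  let ?T = "\<lambda>m. \<I> (?n * m) \<otimes> x\<^sup>T"
  have "?T m' * ?l = (?T m' * cmp_end X m') * (\<I> d \<otimes> f)"
    using x f by (simp add: mat_assoc mult.assoc)
  also have "\<dots> = (\<I> ?n \<otimes> f) * (?T m * cmp_end X m)"
    using x f by (simp add: cmp_end_contract[OF X x] kronecker_mult)
  also have "\<dots> = ((\<I> ?n \<otimes> f) * ?T m) * cmp_end X m"
    using x f by (simp add: mat_assoc mult.assoc)
  also have "(\<I> ?n \<otimes> f) * ?T m = ?T m' * ((\<I> ?n \<otimes> f) \<otimes> \<I> ?n)"
    by (rule contract_commute[symmetric]) (use x f in simp_all)
  also have "\<dots> * cmp_end X m = ?T m' * ((\<I> ?n \<otimes> f \<otimes> \<I> ?n) * cmp_end X m)"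
    using x f by (simp add: kronecker_assoc mat_assoc mult.assoc)
  finally show "?T m' * ?l = ?T m' * ((\<I> ?n \<otimes> f \<otimes> \<I> ?n) * cmp_end X m)" .
qed (use f in \<open>simp_all add: mult.assoc\<close>)

lemma cen_map_hom:
  assumes f: "f \<in> intertwiners V W" and V: "rep V" and W: "rep W"
  shows "\<I> d \<otimes> f \<in> intertwiners (cen V) (cen W)"
proof (rule hom_via_cmp_end)
  note [simp] = hom_dims[OF f]
  have "\<I> (fst reg) \<otimes> f \<otimes> \<I> (fst (dual_rep reg)) \<in> intertwiners (sandwich reg V reg) (sandwich reg W reg)"
    by (intro hom_tensor hom_id rep_tensor_rep dual_rep_rep rep_reg f V W)
  then have "(\<I> (fst reg) \<otimes> f \<otimes> \<I> (fst reg)) * cmp_end reg (fst V) \<in> intertwiners (cen V) (sandwich reg W reg)"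
    using V W by (intro hom_comp[OF cmp_end_hom]) simp_all
  then show "cmp_end reg (fst W) * (\<I> d \<otimes> f) \<in> intertwiners (cen V) (sandwich reg W reg)"
    by (subst cmp_end_natural[of _ _ _ "fst V"]) simp_all
qed (use V W hom_dims[OF f] in simp_all)

text \<open>The comultiplication \<open>Z(V) \<rightarrow> Z(Z(V))\<close> of the comonad:
  \<open>\<Delta>\<close> on the factor \<open>H\<close> of \<open>H \<otimes> V\<close>.\<close>

definition dlt :: "nat \<Rightarrow> 'k mat" where "dlt m = comat \<otimes> \<I> m"

lemma dim_dlt [simp]: "dim_row (dlt m) = d * (d * m)" "dim_col (dlt m) = d * m"
  by (simp_all add: dlt_def mult.assoc)

lemma dlt_coassoc: "(\<I> d \<otimes> dlt m) * dlt m = (comat \<otimes> \<I> (d * m)) * dlt m"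
    (is "?l = ?r")
proof -
  have "?l = ((\<I> d \<otimes> comat) * comat) \<otimes> \<I> m"
    using kronecker_mult[of "\<I> d \<otimes> comat" comat "\<I> m" "\<I> m"] by (simp add: dlt_def kronecker_assoc)
  also have "\<dots> = ?r"
    using kronecker_mult[of "comat \<otimes> \<I> d" comat "\<I> m" "\<I> m"]
    by (simp add: dlt_def kronecker_assoc comat_coassoc[symmetric])
  finally show ?thesis .
qed

lemma dlt_counit:
  "(rowf \<epsilon> \<otimes> \<I> (d * m)) * dlt m = \<I> (d * m)"
  "(\<I> d \<otimes> (rowf \<epsilon> \<otimes> \<I> m)) * dlt m = \<I> (d * m)"
  using kronecker_mult[of "rowf \<epsilon> \<otimes> \<I> d" comat "\<I> m" "\<I> m"]
    kronecker_mult[of "\<I> d \<otimes> rowf \<epsilon>" comat "\<I> m" "\<I> m"]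
  by (simp_all add: dlt_def kronecker_assoc counit_comat)

lemma dlt_natural:
  assumes "dim_row f = m'" "dim_col f = m"
  shows "dlt m' * (\<I> d \<otimes> f) = (\<I> d \<otimes> (\<I> d \<otimes> f)) * dlt m"
  using assms kronecker_mult[of comat "\<I> d" "\<I> m'" f] kronecker_mult[of "\<I> (d * d)" comat f "\<I> m"]
  by (simp add: dlt_def)

lemma phi_phi_dlt:
  assumes x: "rep X" "dim_row x = fst X" "dim_col x = 1" and y: "rep Y" "dim_row y = fst Y" "dim_col y = 1"
  shows "(phi X x \<otimes> (phi Y y \<otimes> \<I> m)) * dlt m = phi (X \<odot> Y) (x \<otimes> y) \<otimes> \<I> m"
  using kronecker_mult[of "phi X x \<otimes> phi Y y" comat "\<I> m" "\<I> m"] phi_tensor[OF x y]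
  by (simp add: dlt_def kronecker_assoc)

text \<open>With the dual factors contracted with \<open>y\<close> and \<open>x\<close>, both sides
  send \<open>h \<otimes> v\<close> to \<open>h\<^sub>1 x \<otimes> h\<^sub>2 y \<otimes> v\<close>;
  on the right this is the action of \<open>h\<close> on \<open>X \<otimes> Y\<close>.\<close>

lemma cmp_end_dlt:
  assumes X: "rep X" and Y: "rep Y"
  shows "(\<I> (fst X) \<otimes> cmp_end Y m \<otimes> \<I> (fst X)) * (cmp_end X (d * m) * dlt m)
    = (\<I> (fst X * (fst Y * m)) \<otimes> dual_tens Hmod X Y) * cmp_end (X \<odot> Y) m"
proof (rule contract_rows2_eqI[of _ "fst X * (fst Y * m)" "fst Y" "fst X"])
  let ?p = "fst X" and ?q = "fst Y"
  fix x y :: "'k mat" assume x: "dim_row x = ?p" "dim_col x = 1" and y: "dim_row y = ?q" "dim_col y = 1"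
  let ?T = "\<I> (?p * (?q * m)) \<otimes> (y\<^sup>T \<otimes> x\<^sup>T)"
  have T: "?T = \<I> ?p \<otimes> ((\<I> (?q * m) \<otimes> y\<^sup>T) \<otimes> x\<^sup>T)"
    by (simp add: kronecker_assoc)
  have "?T * ((\<I> ?p \<otimes> cmp_end Y m \<otimes> \<I> ?p) * (cmp_end X (d * m) * dlt m))
      = (?T * (\<I> ?p \<otimes> cmp_end Y m \<otimes> \<I> ?p)) * (cmp_end X (d * m) * dlt m)"
    using x y by (simp add: mat_assoc mult.assoc)
  also have "?T * (\<I> ?p \<otimes> cmp_end Y m \<otimes> \<I> ?p) = \<I> ?p \<otimes> ((phi Y y \<otimes> \<I> m) \<otimes> x\<^sup>T)"
    unfolding T using x y by (simp add: kronecker_mult cmp_end_contract[OF Y y] mult.assoc)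
  also have "\<dots> = (\<I> ?p \<otimes> (phi Y y \<otimes> \<I> m)) * (\<I> (?p * (d * m)) \<otimes> x\<^sup>T)"
    using x y kronecker_mult[of "\<I> ?p \<otimes> (phi Y y \<otimes> \<I> m)" "\<I> (?p * (d * m))" "\<I> 1" "x\<^sup>T"]
    by (simp add: kronecker_assoc)
  also have "\<dots> * (cmp_end X (d * m) * dlt m)
      = (\<I> ?p \<otimes> (phi Y y \<otimes> \<I> m)) * (((\<I> (?p * (d * m)) \<otimes> x\<^sup>T) * cmp_end X (d * m)) * dlt m)"
    using x y by (simp add: mat_assoc mult.assoc)
  also have "\<dots> = ((\<I> ?p \<otimes> (phi Y y \<otimes> \<I> m)) * (phi X x \<otimes> \<I> (d * m))) * dlt m"
    using x y by (simp add: cmp_end_contract[OF X x] mat_assoc)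
  also have "\<dots> = (phi X x \<otimes> (phi Y y \<otimes> \<I> m)) * dlt m"
    by (subst kronecker_mult) simp_all
  also have "\<dots> = phi (X \<odot> Y) (x \<otimes> y) \<otimes> \<I> m"
    by (rule phi_phi_dlt) (simp_all add: X Y x y)
  also have "\<dots> = (\<I> (fst (X \<odot> Y) * m) \<otimes> (x \<otimes> y)\<^sup>T) * cmp_end (X \<odot> Y) m"
    by (rule cmp_end_contract[symmetric]) (simp_all add: X Y x y)
  also have "\<I> (fst (X \<odot> Y) * m) \<otimes> (x \<otimes> y)\<^sup>T = ?T * (\<I> (?p * (?q * m)) \<otimes> dual_tens Hmod X Y)"
    using x y by (simp add: kronecker_mult dual_tens_contract mult.assoc)
  also have "\<dots> * cmp_end (X \<odot> Y) m = ?T * ((\<I> (?p * (?q * m)) \<otimes> dual_tens Hmod X Y) * cmp_end (X \<odot> Y) m)"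
    by (rule mat_assoc) (simp_all add: x y ac_simps)
  finally show "?T * ((\<I> ?p \<otimes> cmp_end Y m \<otimes> \<I> ?p) * (cmp_end X (d * m) * dlt m))
      = ?T * ((\<I> (?p * (?q * m)) \<otimes> dual_tens Hmod X Y) * cmp_end (X \<odot> Y) m)" .
qed (simp_all add: ac_simps)

text \<open>A module map \<open>g\<close> that is injective on the level of matrices reflects module
  maps.\<close>

lemma hom_cancel:
  assumes g: "g \<in> intertwiners Y Z" and gf: "g * f \<in> intertwiners X Z" and f: "dim_row f = fst Y"
    and L: "L * g = \<I> (fst Y)" "dim_col L = fst Z" and rep: "rep X" "rep Y" "rep Z"
  shows "f \<in> intertwiners X Y"
proof -
  note d = hom_dims[OF g] rep_dims[OF rep(1)] rep_dims[OF rep(2)] rep_dims[OF rep(3)]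
  have fc: "dim_col f = fst X" using hom_dims[OF gf] by simp
  have L_row: "dim_row L = fst Y" using arg_cong[OF L(1), of dim_row] by simp
  have cancel: "L * (g * A) = A" if "dim_row A = fst Y" for A
    using that d L by (simp flip: mat_assoc)
  have "f * snd X x = snd Y x * f" for x
  proof -
    have "g * (f * snd X x) = (g * f) * snd X x" using d f fc by (simp add: mat_assoc)
    also have "\<dots> = (snd Z x * g) * f" unfolding hom_comm[OF gf] using d f by (simp add: mat_assoc)
    also have "\<dots> = g * (snd Y x * f)" unfolding hom_comm[OF g, symmetric] using d f by (simp add: mat_assoc)
    finally have "L * (g * (f * snd X x)) = L * (g * (snd Y x * f))" by simp
    then show ?thesis using cancel[of "f * snd X x"] cancel[of "snd Y x * f"] d f by simp
  qed
  then show ?thesis using f fc by (simp add: intertwiners_iff)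
qed

text \<open>Compatibility with the action is read off after composing with the two injective
  components at the regular representation, where \<open>cmp_end_dlt\<close> gives a composite of
  known module maps.\<close>

lemma dlt_hom:
  assumes V: "rep V" shows "dlt (fst V) \<in> intertwiners (cen V) (cen (cen V))"
proof (rule hom_via_cmp_end)
  let ?m = "fst V" and ?T = "reg \<odot> reg \<odot> V \<odot> dual_rep reg \<odot> dual_rep reg"
  have "\<I> (fst (reg \<odot> reg)) \<otimes> \<I> (fst V) \<otimes> dual_tens Hmod reg reg
      \<in> intertwiners (sandwich (reg \<odot> reg) V (reg \<odot> reg)) ((reg \<odot> reg) \<odot> V \<odot> dual_rep reg \<odot> dual_rep reg)"
    by (intro hom_tensor hom_id dual_tens_hom rep_tensor_rep dual_rep_rep rep_reg V)
  then have r: "(\<I> (d * (d * ?m)) \<otimes> dual_tens Hmod reg reg) * cmp_end (reg \<odot> reg) ?m \<in> intertwiners (cen V) ?T"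
    using V by (intro hom_comp[OF cmp_end_hom]) (simp_all add: tensor_assoc mult.assoc)
  let ?g = "\<I> d \<otimes> cmp_end reg ?m \<otimes> \<I> d"
  have "\<I> (fst reg) \<otimes> cmp_end reg ?m \<otimes> \<I> (fst (dual_rep reg))
      \<in> intertwiners (sandwich reg (cen V) reg) (reg \<odot> sandwich reg V reg \<odot> dual_rep reg)"
    by (intro hom_tensor hom_id cmp_end_hom rep_tensor_rep dual_rep_rep rep_reg cen_rep V)
  then have g: "?g \<in> intertwiners (sandwich reg (cen V) reg) ?T"
    using V by (simp add: tensor_assoc)
  show "cmp_end reg (fst (cen V)) * dlt ?m \<in> intertwiners (cen V) (sandwich reg (cen V) reg)"
  proof (rule hom_cancel[OF g])
    show "?g * (cmp_end reg (fst (cen V)) * dlt ?m) \<in> intertwiners (cen V) ?T"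
      using r cmp_end_dlt[OF rep_reg rep_reg, of ?m] by simp
    show "(\<I> d \<otimes> evl ?m \<otimes> \<I> d) * ?g = \<I> (fst (sandwich reg (cen V) reg))"
      by (simp add: kronecker_mult evl_cmp_end)
  qed (use V in simp_all)
qed (use V in simp_all)

lemma central_wedge_iff:
  assumes "rep V" "rep W"
  shows "central_wedge Hmod V W j \<longleftrightarrow> wedge V W j"
  unfolding central_wedge_def wedge_def
  by (auto simp: dual_map_eq)

lemma central_end_cen:
  assumes V: "rep V" shows "central_end Hmod V (cen V) (\<lambda>X. cmp_end X (fst V))"
  unfolding central_end_def
proof (intro conjI ballI allI impI)
  show "cen V \<in> obj Hmod" using V by simp
  show "central_wedge Hmod V (cen V) (\<lambda>X. cmp_end X (fst V))"
    using V by (simp add: central_wedge_iff wedge_cmp_end)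
  fix W j assume "W \<in> obj Hmod" "central_wedge Hmod V W j"
  then have W: "rep W" and j: "wedge V W j" using V by (simp_all add: central_wedge_iff)
  show "\<exists>!g. g \<in> mor Hmod W (cen V) \<and> (\<forall>X\<in>obj Hmod. cmp_end X (fst V) \<cdot>\<^bsub>Hmod\<^esub> g = j X)"
  proof (rule ex1I)
    show "evl (fst V) * j reg \<in> mor Hmod W (cen V) \<and> (\<forall>X\<in>obj Hmod. cmp_end X (fst V) \<cdot>\<^bsub>Hmod\<^esub> (evl (fst V) * j reg) = j X)"
      using end_factor[OF j V W] by simp
    fix g assume g: "g \<in> mor Hmod W (cen V) \<and> (\<forall>X\<in>obj Hmod. cmp_end X (fst V) \<cdot>\<^bsub>Hmod\<^esub> g = j X)"
    show "g = evl (fst V) * j reg"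
    proof (rule end_factor_unique)
      fix X assume "rep X"
      then show "cmp_end X (fst V) * g = cmp_end X (fst V) * (evl (fst V) * j reg)"
        using conjunct2[OF g, THEN bspec, of X] end_factor(2)[OF j V W] by simp
    qed (use g hom_dims(1)[of g W "cen V"] in simp_all)
  qed
qed

definition cen_functor :: "(('h, 'k) matrix_rep, 'k mat, ('h, 'k) matrix_rep, 'k mat) functor_data" where
  "cen_functor = \<lparr>fobj = cen, fmor = (\<lambda>_ _ f. \<I> d \<otimes> f)\<rparr>"

lemma cen_functor_is_functor: "is_functor Hmod Hmod cen_functor"
  unfolding is_functor_def
proof (intro conjI ballI)
  fix X Y W f g
  assume f: "f \<in> mor Hmod X Y" and g: "g \<in> mor Hmod Y W"
  show "fmor cen_functor X W (g \<cdot>\<^bsub>Hmod\<^esub> f) = fmor cen_functor Y W g \<cdot>\<^bsub>Hmod\<^esub> fmor cen_functor X Y f"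
    using hom_dims[OF f[simplified]] hom_dims[OF g[simplified]] by (simp add: cen_functor_def kronecker_mult)
qed (auto simp: cen_functor_def cen_map_hom)

theorem central_hopf_comonad_cen:
  "central_hopf_comonad Hmod cen_functor (\<lambda>V X. cmp_end X (fst V)) (\<lambda>V. dlt (fst V)) uvec"
  unfolding central_hopf_comonad_def
proof (intro conjI ballI)
  show "is_functor Hmod Hmod cen_functor" by (rule cen_functor_is_functor)
next
  fix V W f X assume "V \<in> obj Hmod" "W \<in> obj Hmod" "f \<in> mor Hmod V W" "X \<in> obj Hmod"
  then show "cmp_end X (fst W) \<cdot>\<^bsub>Hmod\<^esub> fmor cen_functor V W f
      = (idt Hmod X \<boxtimes>\<^bsub>Hmod\<^esub> f \<boxtimes>\<^bsub>Hmod\<^esub> idt Hmod (ldual Hmod X)) \<cdot>\<^bsub>Hmod\<^esub> cmp_end X (fst V)"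
    by (simp add: cen_functor_def cmp_end_natural hom_dims)
next
  fix V X Y assume "V \<in> obj Hmod" "X \<in> obj Hmod" "Y \<in> obj Hmod"
  then show "(idt Hmod X \<boxtimes>\<^bsub>Hmod\<^esub> cmp_end Y (fst V) \<boxtimes>\<^bsub>Hmod\<^esub> idt Hmod (ldual Hmod X)) \<cdot>\<^bsub>Hmod\<^esub>
        cmp_end X (fst (fobj cen_functor V)) \<cdot>\<^bsub>Hmod\<^esub> dlt (fst V)
      = (idt Hmod X \<boxtimes>\<^bsub>Hmod\<^esub> idt Hmod Y \<boxtimes>\<^bsub>Hmod\<^esub> idt Hmod V \<boxtimes>\<^bsub>Hmod\<^esub> dual_tens Hmod X Y) \<cdot>\<^bsub>Hmod\<^esub>
        cmp_end (X \<boxdot>\<^bsub>Hmod\<^esub> Y) (fst V)"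
    by (simp add: cen_functor_def cmp_end_dlt)
qed (auto simp: cen_functor_def central_end_cen dlt_hom uvec_hom cmp_end_uvec[simplified])

end

section \<open>The right adjoint of the forgetful functor\<close>

text \<open>
  The usual expression of the inverse of a half-braiding through the half-braiding of the dual object,
  on the level of matrices.
\<close>

lemma half_braiding_inverse:
  fixes s t :: "'a::comm_ring_1 mat"
  assumes s: "dim_row s = n * N" "dim_col s = N * n" and t: "dim_row t = n * N" "dim_col t = N * n"
    and ev: "(evm n \<otimes> \<I> N) * ((\<I> n \<otimes> t) * (s \<otimes> \<I> n)) = \<I> N \<otimes> evm n"
    and coev: "((\<I> n \<otimes> s) * (t \<otimes> \<I> n)) * (\<I> N \<otimes> coevm n) = coevm n \<otimes> \<I> N"
  defines "r \<equiv> (evm n \<otimes> \<I> (N * n)) * ((\<I> n \<otimes> t \<otimes> \<I> n) * (\<I> (n * N) \<otimes> coevm n))"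
  shows "r * s = \<I> (N * n)" "s * r = \<I> (n * N)"
proof -
  let ?t = "\<I> n \<otimes> t \<otimes> \<I> n"
  let ?e = "evm n \<otimes> \<I> (N * n)"
  let ?c = "\<I> (N * n) \<otimes> coevm n"
  let ?d = "\<I> (n * N) \<otimes> coevm n"
  have "?d * s = s \<otimes> coevm n"
    using s kronecker_mult[of "\<I> (n * N)" s "coevm n" "\<I> 1"] by simp
  also have "\<dots> = ((s \<otimes> \<I> n) \<otimes> \<I> n) * ?c"
    using s kronecker_mult[of s "\<I> (N * n)" "\<I> (n * n)" "coevm n"] by (simp add: kronecker_assoc)
  finally have 1: "?d * s = ((s \<otimes> \<I> n) \<otimes> \<I> n) * ?c" .
  have "r * s = ?e * (?t * (?d * s))"
    unfolding r_def using s t by (simp add: mat_assoc mult.assoc)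
  also have "\<dots> = ?e * ((?t * ((s \<otimes> \<I> n) \<otimes> \<I> n)) * ?c)"
    unfolding 1 using s t by (simp add: mat_assoc mult.assoc)
  also have "?t * ((s \<otimes> \<I> n) \<otimes> \<I> n) = ((\<I> n \<otimes> t) * (s \<otimes> \<I> n)) \<otimes> \<I> n"
    using s t kronecker_mult[of "\<I> n \<otimes> t" "s \<otimes> \<I> n" "\<I> n" "\<I> n"]
    by (simp add: kronecker_assoc mult.assoc)
  also have "?e * (\<dots> * ?c)
      = (((evm n \<otimes> \<I> N) \<otimes> \<I> n) * (((\<I> n \<otimes> t) * (s \<otimes> \<I> n)) \<otimes> \<I> n)) * ?c"
    using s t by (simp add: kronecker_one_split mat_assoc mult.assoc)
  also have "((evm n \<otimes> \<I> N) \<otimes> \<I> n) * (((\<I> n \<otimes> t) * (s \<otimes> \<I> n)) \<otimes> \<I> n) = (\<I> N \<otimes> evm n) \<otimes> \<I> n"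
    using s t kronecker_mult[of "evm n \<otimes> \<I> N" "(\<I> n \<otimes> t) * (s \<otimes> \<I> n)" "\<I> n" "\<I> n"] ev
    by (simp add: mult.assoc)
  also have "\<dots> * ?c = (\<I> N \<otimes> (evm n \<otimes> \<I> n)) * (\<I> N \<otimes> (\<I> n \<otimes> coevm n))"
    by (simp add: kronecker_assoc)
  also have "\<dots> = \<I> N \<otimes> ((evm n \<otimes> \<I> n) * (\<I> n \<otimes> coevm n))"
    by (subst kronecker_mult) simp_all
  finally show "r * s = \<I> (N * n)" by (simp add: evm_coevm_zigzag)
next
  let ?t = "\<I> n \<otimes> t \<otimes> \<I> n"
  let ?e = "evm n \<otimes> \<I> (N * n)"
  let ?d = "\<I> (n * N) \<otimes> coevm n"
  let ?c = "\<I> N \<otimes> coevm n"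
  let ?s = "\<I> n \<otimes> (\<I> n \<otimes> s)"
  have "s * ?e = evm n \<otimes> s"
    using s kronecker_mult[of "\<I> 1" "evm n" s "\<I> (N * n)"] by simp
  also have "\<dots> = (evm n \<otimes> \<I> (n * N)) * ?s"
    using s kronecker_mult[of "evm n" "\<I> (n * n)" "\<I> (n * N)" s] by simp
  finally have 2: "s * ?e = (evm n \<otimes> \<I> (n * N)) * ?s" .
  have 3: "\<I> (n * N) \<otimes> (coevm n :: 'a mat) = \<I> n \<otimes> ?c" by simp
  have "s * r = (s * ?e) * (?t * ?d)"
    unfolding r_def using s t by (simp add: mat_assoc mult.assoc)
  also have "\<dots> = (evm n \<otimes> \<I> (n * N)) * (?s * (?t * (\<I> n \<otimes> ?c)))"
    unfolding 2 3 by (rule mat_assoc) (use s t in \<open>simp_all add: mult.assoc\<close>)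
  also have "?s * (?t * (\<I> n \<otimes> ?c))
      = \<I> n \<otimes> (((\<I> n \<otimes> s) * (t \<otimes> \<I> n)) * ?c)"
  proof -
    have "?t * (\<I> n \<otimes> ?c) = \<I> n \<otimes> ((t \<otimes> \<I> n) * ?c)"
      by (subst kronecker_mult) (use t in \<open>simp_all add: mult.assoc\<close>)
    moreover have "?s * (\<I> n \<otimes> ((t \<otimes> \<I> n) * ?c))
        = \<I> n \<otimes> ((\<I> n \<otimes> s) * ((t \<otimes> \<I> n) * ?c))"
      by (subst kronecker_mult) (use s t in \<open>simp_all add: mult.assoc\<close>)
    ultimately show ?thesis using s t by (simp add: mat_assoc mult.assoc)
  qed
  also have "(evm n \<otimes> \<I> (n * N)) * (\<I> n \<otimes> (((\<I> n \<otimes> s) * (t \<otimes> \<I> n)) * ?c))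
      = ((evm n \<otimes> \<I> n) \<otimes> \<I> N) * ((\<I> n \<otimes> coevm n) \<otimes> \<I> N)"
    unfolding coev by (simp add: kronecker_assoc)
  also have "\<dots> = \<I> (n * N)"
    by (subst kronecker_mult) (simp_all add: evm_coevm_zigzag)
  finally show "s * r = \<I> (n * N)" .
qed

context fd_hopf_algebra
begin

text \<open>The half-braiding \<open>h \<otimes> v \<otimes> x \<mapsto> h\<^sub>1 x \<otimes> h\<^sub>2 \<otimes> v\<close> of \<open>H \<otimes> V\<close>.\<close>

definition brd :: "nat \<Rightarrow> ('h, 'k) matrix_rep \<Rightarrow> 'k mat" where
  "brd m X = (\<I> (fst X * (d * m)) \<otimes> evm (fst X)) * ((cmp_end X (d * m) * dlt m) \<otimes> \<I> (fst X))"

lemma dim_brd [simp]: "dim_row (brd m X) = fst X * (d * m)" "dim_col (brd m X) = d * m * fst X"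
  by (simp_all add: brd_def)

text \<open>\<open>brd\<close> is composed of \<open>dlt\<close>, \<open>cmp_end\<close> and an
  evaluation, which makes it a module map by construction. This formula recovers its effect on
  elements, the form in which the braiding laws are checked.\<close>

lemma brd_col:
  assumes X: "rep X" and x: "dim_row x = fst X" "dim_col x = 1"
  shows "brd m X * (\<I> (d * m) \<otimes> x) = (phi X x \<otimes> \<I> (d * m)) * dlt m"
proof -
  let ?n = "fst X" and ?N = "d * m"
  let ?A = "cmp_end X ?N * dlt m"
  have "brd m X * (\<I> ?N \<otimes> x) = (\<I> (?n * ?N) \<otimes> evm ?n) * ((?A \<otimes> \<I> ?n) * (\<I> ?N \<otimes> x))"
    unfolding brd_def using x by (simp add: mat_assoc mult.assoc)
  also have "(?A \<otimes> \<I> ?n) * (\<I> ?N \<otimes> x) = (\<I> (?n * ?N * ?n) \<otimes> x) * ?A"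
    by (rule column_commute) (use x in \<open>simp_all add: mult.assoc\<close>)
  also have "(\<I> (?n * ?N) \<otimes> evm ?n) * \<dots> = ((\<I> (?n * ?N) \<otimes> evm ?n) * (\<I> (?n * ?N) \<otimes> (\<I> ?n \<otimes> x))) * ?A"
    using x by (simp add: mat_assoc mult.assoc)
  also have "(\<I> (?n * ?N) \<otimes> evm ?n) * (\<I> (?n * ?N) \<otimes> (\<I> ?n \<otimes> x)) = \<I> (?n * ?N) \<otimes> x\<^sup>T"
    by (subst kronecker_mult) (use x in \<open>simp_all add: evm_contract\<close>)
  also have "\<dots> * ?A = ((\<I> (?n * ?N) \<otimes> x\<^sup>T) * cmp_end X ?N) * dlt m"
    using x by (simp add: mat_assoc mult.assoc)
  finally show ?thesis by (simp only: cmp_end_contract[OF X x])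
qed

lemma brd_hom:
  assumes V: "rep V" and X: "rep X"
  shows "brd (fst V) X \<in> intertwiners (cen V \<odot> X) (X \<odot> cen V)"
proof -
  let ?A = "cmp_end X (d * fst V) * dlt (fst V)"
  have "cmp_end X (fst (cen V)) * dlt (fst V) \<in> intertwiners (cen V) (sandwich X (cen V) X)"
    by (rule hom_comp[OF dlt_hom cmp_end_hom]) (use V X in simp_all)
  then have "?A \<otimes> \<I> (fst X) \<in> intertwiners (cen V \<odot> X) (sandwich X (cen V) X \<odot> X)"
    using V X by (intro hom_tensor hom_id) simp_all
  moreover have "\<I> (fst (X \<odot> cen V)) \<otimes> evm (fst X) \<in> intertwiners ((X \<odot> cen V) \<odot> (dual_rep X \<odot> X)) ((X \<odot> cen V) \<odot> unit_rep)"
    by (intro hom_tensor hom_id evm_hom rep_tensor_rep dual_rep_rep unit_rep cen_rep X V)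
  ultimately show ?thesis
    unfolding brd_def using X V
    by (intro hom_comp[of _ _ "X \<odot> cen V \<odot> dual_rep X \<odot> X"]) (simp_all add: tensor_assoc)
qed

lemma brd_natural:
  assumes f: "f \<in> intertwiners X Y" and X: "rep X" and Y: "rep Y"
  shows "brd m Y * (\<I> (d * m) \<otimes> f) = (f \<otimes> \<I> (d * m)) * brd m X"
proof (rule contract_cols_eqI[of _ "d * m" "fst X"])
  note [simp] = hom_dims[OF f]
  fix x :: "'k mat" assume x: "dim_row x = fst X" "dim_col x = 1"
  have "brd m Y * (\<I> (d * m) \<otimes> f) * (\<I> (d * m) \<otimes> x) = brd m Y * (\<I> (d * m) \<otimes> (f * x))"
    using x by (simp add: mat_assoc kronecker_mult)
  also have "\<dots> = (phi Y (f * x) \<otimes> \<I> (d * m)) * dlt m"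
    by (rule brd_col) (use x Y in simp_all)
  also have "phi Y (f * x) \<otimes> \<I> (d * m) = (f \<otimes> \<I> (d * m)) * (phi X x \<otimes> \<I> (d * m))"
    using x by (simp add: kronecker_mult hom_phi[OF f X Y])
  also have "\<dots> * dlt m = (f \<otimes> \<I> (d * m)) * (brd m X * (\<I> (d * m) \<otimes> x))"
    using x by (simp add: brd_col[OF X x] mat_assoc)
  finally show "brd m Y * (\<I> (d * m) \<otimes> f) * (\<I> (d * m) \<otimes> x) = (f \<otimes> \<I> (d * m)) * brd m X * (\<I> (d * m) \<otimes> x)"
    using x by (simp add: mat_assoc)
qed (use hom_dims[OF f] in simp_all)

text \<open>On \<open>h \<otimes> v \<otimes> x \<otimes> y\<close> both sides yield
  \<open>h\<^sub>1 x \<otimes> h\<^sub>2 y \<otimes> h\<^sub>3 \<otimes> v\<close>, with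
  \<open>\<Delta>\<close> iterated in the two possible ways.\<close>

lemma brd_tensor:
  assumes X: "rep X" and Y: "rep Y"
  shows "brd m (X \<odot> Y) = (\<I> (fst X) \<otimes> brd m Y) * (brd m X \<otimes> \<I> (fst Y))"
proof (rule contract_cols2_eqI[of _ "d * m" "fst X" "fst Y"])
  let ?p = "fst X" and ?q = "fst Y" and ?N = "d * m"
  fix x y :: "'k mat" assume x: "dim_row x = ?p" "dim_col x = 1" and y: "dim_row y = ?q" "dim_col y = 1"
  let ?A = "(phi X x \<otimes> \<I> ?N) * dlt m" and ?B = "(phi Y y \<otimes> \<I> ?N) * dlt m"
  have "(brd m X \<otimes> \<I> ?q) * (\<I> ?N \<otimes> (x \<otimes> y)) = ?A \<otimes> y"
    using x y kronecker_mult[of "brd m X" "\<I> ?N \<otimes> x" "\<I> ?q" y]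
    by (simp add: kronecker_assoc brd_col[OF X x])
  also have "\<dots> = (\<I> (?p * ?N) \<otimes> y) * ?A"
    using x y kronecker_mult[of "\<I> (?p * ?N)" ?A y "\<I> 1"] by simp
  finally have "(\<I> ?p \<otimes> brd m Y) * (brd m X \<otimes> \<I> ?q) * (\<I> ?N \<otimes> (x \<otimes> y))
      = (\<I> ?p \<otimes> brd m Y) * ((\<I> ?p \<otimes> (\<I> ?N \<otimes> y)) * ?A)"
    using x y by (simp add: mat_assoc mult.assoc)
  also have "\<dots> = ((\<I> ?p \<otimes> brd m Y) * (\<I> ?p \<otimes> (\<I> ?N \<otimes> y))) * ?A"
    by (rule mat_assoc[symmetric]) (use x y in simp_all)
  also have "(\<I> ?p \<otimes> brd m Y) * (\<I> ?p \<otimes> (\<I> ?N \<otimes> y)) = \<I> ?p \<otimes> ?B"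
    by (subst kronecker_mult) (use x y in \<open>simp_all add: brd_col[OF Y y]\<close>)
  also have "\<dots> * ?A = ((\<I> ?p \<otimes> ?B) * (phi X x \<otimes> \<I> ?N)) * dlt m"
    by (rule mat_assoc[symmetric]) (use x y in simp_all)
  also have "(\<I> ?p \<otimes> ?B) * (phi X x \<otimes> \<I> ?N) = phi X x \<otimes> ?B"
    by (subst kronecker_mult) simp_all
  also have "\<dots> = (phi X x \<otimes> (phi Y y \<otimes> \<I> ?N)) * (\<I> d \<otimes> dlt m)"
    by (subst kronecker_mult) simp_all
  also have "\<dots> * dlt m = (phi X x \<otimes> (phi Y y \<otimes> \<I> ?N)) * ((comat \<otimes> \<I> ?N) * dlt m)"
    by (simp add: mat_assoc dlt_coassoc)
  also have "\<dots> = ((phi X x \<otimes> (phi Y y \<otimes> \<I> ?N)) * dlt ?N) * dlt m"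
    unfolding dlt_def[of ?N] by (rule mat_assoc[symmetric]) (simp_all add: mult.assoc)
  also have "\<dots> = (phi (X \<odot> Y) (x \<otimes> y) \<otimes> \<I> ?N) * dlt m"
    by (simp add: phi_phi_dlt X Y x y)
  also have "\<dots> = brd m (X \<odot> Y) * (\<I> ?N \<otimes> (x \<otimes> y))"
    by (rule brd_col[symmetric]) (simp_all add: X Y x y)
  finally show "brd m (X \<odot> Y) * (\<I> ?N \<otimes> (x \<otimes> y))
      = (\<I> ?p \<otimes> brd m Y) * (brd m X \<otimes> \<I> ?q) * (\<I> ?N \<otimes> (x \<otimes> y))" ..
qed (simp_all add: mult.assoc)

lemma phi_unit: "phi unit_rep (\<I> 1) = rowf \<epsilon>"
  by (rule eq_matI) (simp_all add: phi_def rowf_def scalar_prod_def)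

lemma brd_unit: "brd m unit_rep = \<I> (d * m)"
proof -
  have "brd m unit_rep = brd m unit_rep * (\<I> (d * m) \<otimes> \<I> 1)" by simp
  also have "\<dots> = (rowf \<epsilon> \<otimes> \<I> (d * m)) * dlt m"
    by (subst brd_col) (simp_all add: phi_unit[simplified])
  finally show ?thesis by (simp add: dlt_counit)
qed

text \<open>The preimage is the right dual of \<open>X\<close>: the transposed action twisted by the
  inverse of the antipode. Here bijectivity of \<open>S\<close> enters the categorical side.\<close>

lemma dual_surj:
  assumes w: "\<And>x. S (w x) = x" "\<And>x. w (S x) = x" and X: "rep X"
  obtains Y where "rep Y" "dual_rep Y = X"
proof
  let ?Y = "(fst X, \<lambda>x. (snd X (w x))\<^sup>T)"
  have inj: "x = y" if "S x = S y" for x y using that w by metis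
  have w_lin: "w (x + y) = w x + w y" "w (scale c x) = scale c (w x)" "w (x * y) = w y * w x" "w 1 = 1" for x y c
    by (rule inj, simp add: S_add S_scale S_mult w)+
  note [simp] = rep_dims[OF X]
  have "(snd X (w (x * y)))\<^sup>T = (snd X (w x))\<^sup>T * (snd X (w y))\<^sup>T" for x y
    by (simp add: w_lin rep_mult[OF X] mat_transpose_mult)
  moreover have "(snd X (w x))\<^sup>T \<in> carrier_mat (fst X) (fst X)" for x
    by (auto intro!: carrier_matI)
  moreover have "(snd X (w (x + y)))\<^sup>T = (snd X (w x))\<^sup>T + (snd X (w y))\<^sup>T" for x y
    by (rule eq_matI) (simp_all add: w_lin rep_add[OF X])
  moreover have "(snd X (w (scale c x)))\<^sup>T = c \<cdot>\<^sub>m (snd X (w x))\<^sup>T" for c x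
    by (rule eq_matI) (simp_all add: w_lin rep_scale[OF X])
  ultimately show "rep ?Y" by (simp add: rep_def is_matrix_rep_def rep_one[OF X] w_lin)
  show "dual_rep ?Y = X" by (rule matrix_rep_eqI) (simp_all add: w)
qed

text \<open>Choose \<open>Y\<close> with left dual \<open>X\<close>. Naturality of the braiding
  along the evaluation \<open>X \<otimes> Y \<rightarrow> 1\<close> and the coevaluation
  \<open>1 \<rightarrow> Y \<otimes> X\<close> provides the two hypotheses of
  \<open>half_braiding_inverse\<close>.\<close>

lemma brd_iso:
  assumes w: "\<And>x. S (w x) = x" "\<And>x. w (S x) = x" and V: "rep V" and X: "rep X"
  shows "iso_morphism Hmod (cen V \<odot> X) (X \<odot> cen V) (brd (fst V) X)"
proof -
  obtain Y where Y: "rep Y" and YX: "dual_rep Y = X" using dual_surj[OF w X] .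
  have n: "fst Y = fst X" using YX by auto
  let ?n = "fst X" and ?N = "d * fst V" and ?b = "brd (fst V)"
  have "(evm ?n \<otimes> \<I> ?N) * ?b (X \<odot> Y) = \<I> ?N \<otimes> evm ?n"
    using brd_natural[OF evm_hom[OF Y], of "fst V"] X Y by (simp add: YX n brd_unit[simplified])
  then have ev: "(evm ?n \<otimes> \<I> ?N) * ((\<I> ?n \<otimes> ?b Y) * (?b X \<otimes> \<I> ?n)) = \<I> ?N \<otimes> evm ?n"
    by (simp add: brd_tensor X Y n)
  have "?b (Y \<odot> X) * (\<I> ?N \<otimes> coevm ?n) = coevm ?n \<otimes> \<I> ?N"
    using brd_natural[OF coevm_hom[OF Y], of "fst V"] X Y by (simp add: YX n brd_unit[simplified])
  then have coev: "((\<I> ?n \<otimes> ?b X) * (?b Y \<otimes> \<I> ?n)) * (\<I> ?N \<otimes> coevm ?n) = coevm ?n \<otimes> \<I> ?N"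
    by (simp add: brd_tensor X Y n)
  define r where "r = (evm ?n \<otimes> \<I> (?N * ?n)) * ((\<I> ?n \<otimes> ?b Y \<otimes> \<I> ?n) * (\<I> (?n * ?N) \<otimes> coevm ?n))"
  have r: "r * ?b X = \<I> (?N * ?n)" "?b X * r = \<I> (?n * ?N)"
    unfolding r_def by (rule half_braiding_inverse; use ev coev n in simp)+
  have b: "?b X \<in> intertwiners (cen V \<odot> X) (X \<odot> cen V)" by (rule brd_hom[OF V X])
  have "r \<in> intertwiners (X \<odot> cen V) (cen V \<odot> X)"
    by (rule hom_cancel[OF b, where L = r]) (use r V X hom_id[of "X \<odot> cen V"] in \<open>simp_all add: r_def mult.assoc\<close>)
  then show ?thesis using b r by (auto simp: iso_morphism_def)
qed

text \<open>Restricted to representations because half-braidings are required to be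
  extensional.\<close>

definition cen_hb :: "('h, 'k) matrix_rep \<Rightarrow> ('h, 'k) matrix_rep \<Rightarrow> 'k mat" where
  "cen_hb V = (\<lambda>X\<in>{X. rep X}. brd (fst V) X)"

lemma cen_hb_eq [simp]: "rep X \<Longrightarrow> cen_hb V X = brd (fst V) X"
  by (simp add: cen_hb_def)

lemma half_braiding_cen:
  assumes w: "\<And>x. S (w x) = x" "\<And>x. w (S x) = x" and V: "rep V"
  shows "half_braiding Hmod (cen V) (cen_hb V)"
  unfolding half_braiding_def
proof (intro conjI ballI)
  show "cen_hb V \<in> extensional (obj Hmod)" by (simp add: cen_hb_def)
  fix X assume "X \<in> obj Hmod"
  then show "iso_morphism Hmod (cen V \<boxdot>\<^bsub>Hmod\<^esub> X) (X \<boxdot>\<^bsub>Hmod\<^esub> cen V) (cen_hb V X)"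
    using brd_iso[OF w V] by simp
next
  fix X Y f assume "X \<in> obj Hmod" "Y \<in> obj Hmod" "f \<in> mor Hmod X Y"
  then show "cen_hb V Y \<cdot>\<^bsub>Hmod\<^esub> (idt Hmod (cen V) \<boxtimes>\<^bsub>Hmod\<^esub> f) = (f \<boxtimes>\<^bsub>Hmod\<^esub> idt Hmod (cen V)) \<cdot>\<^bsub>Hmod\<^esub> cen_hb V X"
    by (simp add: brd_natural)
next
  fix X Y assume "X \<in> obj Hmod" "Y \<in> obj Hmod"
  then show "cen_hb V (X \<boxdot>\<^bsub>Hmod\<^esub> Y) = (idt Hmod X \<boxtimes>\<^bsub>Hmod\<^esub> cen_hb V Y) \<cdot>\<^bsub>Hmod\<^esub> (cen_hb V X \<boxtimes>\<^bsub>Hmod\<^esub> idt Hmod Y)"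
    by (simp add: brd_tensor)
qed

lemma half_braidingD:
  assumes t: "half_braiding Hmod V \<tau>" and V: "rep V"
  shows "rep X \<Longrightarrow> \<tau> X \<in> intertwiners (V \<odot> X) (X \<odot> V)"
    and "f \<in> intertwiners X Y \<Longrightarrow> rep X \<Longrightarrow> rep Y \<Longrightarrow> \<tau> Y * (\<I> (fst V) \<otimes> f) = (f \<otimes> \<I> (fst V)) * \<tau> X"
    and "rep X \<Longrightarrow> rep Y \<Longrightarrow> \<tau> (X \<odot> Y) = (\<I> (fst X) \<otimes> \<tau> Y) * (\<tau> X \<otimes> \<I> (fst Y))"
    and "\<tau> unit_rep = \<I> (fst V)"
proof -
  have iso: "iso_morphism Hmod (V \<odot> X) (X \<odot> V) (\<tau> X)" if "rep X" for X
    using t that unfolding half_braiding_def modules_simps by blast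
  then show hom: "\<tau> X \<in> intertwiners (V \<odot> X) (X \<odot> V)" if "rep X" for X
    using that by (simp add: iso_morphism_def)
  show mult: "\<tau> (X \<odot> Y) = (\<I> (fst X) \<otimes> \<tau> Y) * (\<tau> X \<otimes> \<I> (fst Y))" if "rep X" "rep Y" for X Y
    using t that unfolding half_braiding_def modules_simps by blast
  show "\<tau> Y * (\<I> (fst V) \<otimes> f) = (f \<otimes> \<I> (fst V)) * \<tau> X" if "f \<in> intertwiners X Y" "rep X" "rep Y"
    using t that unfolding half_braiding_def modules_simps by blast
  have d: "dim_row (\<tau> unit_rep) = fst V" "dim_col (\<tau> unit_rep) = fst V"
    using hom_dims[OF hom[OF unit_rep]] by simp_all
  obtain g where gh: "g \<in> intertwiners (unit_rep \<odot> V) (V \<odot> unit_rep)" and g1: "g * \<tau> unit_rep = \<I> (fst V)"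
    using iso[OF unit_rep] by (auto simp: iso_morphism_def)
  have g: "g * \<tau> unit_rep = \<I> (fst V)" "dim_col g = fst V"
    using g1 hom_dims[OF gh] by simp_all
  \<comment> \<open>The tensor law at \<open>1 \<otimes> 1\<close> makes this component idempotent,
    and an invertible idempotent is the identity.\<close>
  have "\<tau> unit_rep * \<tau> unit_rep = \<tau> unit_rep"
    using mult[OF unit_rep unit_rep] by simp
  then have "g * \<tau> unit_rep * \<tau> unit_rep = g * \<tau> unit_rep"
    using d g(2) by (simp add: mat_assoc)
  then show "\<tau> unit_rep = \<I> (fst V)" using g d by simp
qed

section \<open>The Drinfeld center and the adjunction\<close>

lemma center_simps [simp]:
  "obj (drinfeld_center Hmod) = {A. rep (fst A) \<and> half_braiding Hmod (fst A) (snd A)}"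
  "mor (drinfeld_center Hmod) A B = {f \<in> intertwiners (fst A) (fst B).
     \<forall>X. rep X \<longrightarrow> (\<I> (fst X) \<otimes> f) * snd A X = snd B X * (f \<otimes> \<I> (fst X))}"
  "cmp (drinfeld_center Hmod) = (*)"
  "idt (drinfeld_center Hmod) A = \<I> (fst (fst A))"
  "zer (drinfeld_center Hmod) A B = 0\<^sub>m (fst (fst B)) (fst (fst A))"
  by (auto simp: drinfeld_center_def case_prod_beta')

definition cen_adjoint ::
    "(('h, 'k) matrix_rep, 'k mat, ('h, 'k) matrix_rep \<times> (('h, 'k) matrix_rep \<Rightarrow> 'k mat), 'k mat) functor_data" where
  "cen_adjoint = \<lparr>fobj = (\<lambda>V. (cen V, cen_hb V)), fmor = (\<lambda>_ _ f. \<I> d \<otimes> f)\<rparr>"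

lemma cen_adjoint_simps [simp]:
  "fobj cen_adjoint V = (cen V, cen_hb V)" "fmor cen_adjoint V W f = \<I> d \<otimes> f"
  "fobj center_forget A = fst A" "fmor center_forget A B f = f"
  by (simp_all add: cen_adjoint_def center_forget_def)

lemma brd_cen_map:
  assumes X: "rep X" and f: "dim_row f = m'" "dim_col f = m"
  shows "(\<I> (fst X) \<otimes> (\<I> d \<otimes> f)) * brd m X = brd m' X * ((\<I> d \<otimes> f) \<otimes> \<I> (fst X))"
proof (rule contract_cols_eqI[of _ "d * m" "fst X"])
  let ?F = "\<I> d \<otimes> f"
  fix x :: "'k mat" assume x: "dim_row x = fst X" "dim_col x = 1"
  have "(\<I> (fst X) \<otimes> ?F) * brd m X * (\<I> (d * m) \<otimes> x) = (\<I> (fst X) \<otimes> ?F) * ((phi X x \<otimes> \<I> (d * m)) * dlt m)"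
    using x f by (simp add: mat_assoc brd_col[OF X x] mult.assoc)
  also have "\<dots> = ((\<I> (fst X) \<otimes> ?F) * (phi X x \<otimes> \<I> (d * m))) * dlt m"
    by (rule mat_assoc[symmetric]) (use f in simp_all)
  also have "(\<I> (fst X) \<otimes> ?F) * (phi X x \<otimes> \<I> (d * m)) = (phi X x \<otimes> \<I> (d * m')) * (\<I> d \<otimes> ?F)"
    using f kronecker_mult[of "\<I> (fst X)" "phi X x" ?F "\<I> (d * m)"] kronecker_mult[of "phi X x" "\<I> d" "\<I> (d * m')" ?F]
    by simp
  also have "\<dots> * dlt m = (phi X x \<otimes> \<I> (d * m')) * (dlt m' * ?F)"
    using f by (simp add: mat_assoc dlt_natural mult.assoc)
  also have "\<dots> = brd m' X * ((\<I> (d * m') \<otimes> x) * ?F)"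
    using f x by (simp add: brd_col[OF X x] flip: mat_assoc)
  also have "(\<I> (d * m') \<otimes> x) * ?F = (?F \<otimes> \<I> (fst X)) * (\<I> (d * m) \<otimes> x)"
    by (rule column_commute[symmetric]) (use f x in simp_all)
  also have "brd m' X * \<dots> = brd m' X * (?F \<otimes> \<I> (fst X)) * (\<I> (d * m) \<otimes> x)"
    by (rule mat_assoc[symmetric]) (use f x in simp_all)
  finally show "(\<I> (fst X) \<otimes> ?F) * brd m X * (\<I> (d * m) \<otimes> x) = brd m' X * (?F \<otimes> \<I> (fst X)) * (\<I> (d * m) \<otimes> x)" .
qed (use f in \<open>simp_all add: mult.assoc\<close>)

text \<open>The coaction \<open>v \<mapsto> \<tau>(v \<otimes> 1)\<close> of \<open>H\<close> on
  \<open>V\<close>, with \<open>\<tau>\<close> taken at the regular representation; it encodes the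
  whole half-braiding.\<close>

definition adj_unit :: "('h, 'k) matrix_rep \<times> (('h, 'k) matrix_rep \<Rightarrow> 'k mat) \<Rightarrow> 'k mat" where
  "adj_unit A = snd A reg * (\<I> (fst (fst A)) \<otimes> uvec)"

lemma adj_unit_hom:
  assumes V: "rep V" and t: "half_braiding Hmod V \<tau>"
  shows "adj_unit (V, \<tau>) \<in> intertwiners V (cen V)"
    and "rep X \<Longrightarrow> (\<I> (fst X) \<otimes> adj_unit (V, \<tau>)) * \<tau> X = brd (fst V) X * (adj_unit (V, \<tau>) \<otimes> \<I> (fst X))"
proof -
  let ?m = "fst V" and ?e = "adj_unit (V, \<tau>)"
  note hb = half_braidingD[OF t V]
  have dims [simp]: "dim_row (\<tau> X) = fst X * ?m" "dim_col (\<tau> X) = ?m * fst X" if "rep X" for X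
    using hom_dims[OF hb(1)[OF that]] by simp_all
  have e [simp]: "dim_row ?e = d * ?m" "dim_col ?e = ?m" by (simp_all add: adj_unit_def)
  \<comment> \<open>Naturality along \<open>phi X x\<close> recovers every component of the
    half-braiding from the coaction.\<close>
  have phi_e: "(phi X x \<otimes> \<I> ?m) * ?e = \<tau> X * (\<I> ?m \<otimes> x)"
    if X: "rep X" and x: "dim_row x = fst X" "dim_col x = 1" for X x
  proof -
    have "(phi X x \<otimes> \<I> ?m) * ?e = ((phi X x \<otimes> \<I> ?m) * \<tau> reg) * (\<I> ?m \<otimes> uvec)"
      unfolding adj_unit_def by (simp add: mat_assoc)
    also have "\<dots> = \<tau> X * (\<I> ?m \<otimes> phi X x) * (\<I> ?m \<otimes> uvec)"
      by (simp only: hb(2)[OF phi_hom[OF X x] rep_reg X])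
    also have "\<dots> = \<tau> X * ((\<I> ?m \<otimes> phi X x) * (\<I> ?m \<otimes> uvec))"
      using X by (simp add: mat_assoc)
    finally show ?thesis by (simp add: kronecker_mult phi_uvec[OF X x])
  qed
  \<comment> \<open>The coaction is thus the map into the end given by the family on the right,
    whose member at the regular representation is a composite of module maps.\<close>
  have J: "cmp_end X ?m * ?e = (\<tau> X \<otimes> \<I> (fst X)) * (\<I> ?m \<otimes> coevm (fst X))" if X: "rep X" for X
  proof (rule contract_rows_eqI[of _ "fst X * ?m" "fst X"])
    let ?n = "fst X"
    fix x :: "'k mat" assume x: "dim_row x = ?n" "dim_col x = 1"
    have "(\<I> (?n * ?m) \<otimes> x\<^sup>T) * (cmp_end X ?m * ?e) = ((\<I> (?n * ?m) \<otimes> x\<^sup>T) * cmp_end X ?m) * ?e"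
      by (rule mat_assoc[symmetric]) (use x in \<open>simp_all add: mult.assoc\<close>)
    also have "\<dots> = \<tau> X * (\<I> ?m \<otimes> x)"
      by (simp only: cmp_end_contract[OF X x] phi_e[OF X x])
    also have "\<I> ?m \<otimes> x = (\<I> ?m \<otimes> (\<I> ?n \<otimes> x\<^sup>T)) * (\<I> ?m \<otimes> coevm ?n)"
      by (subst kronecker_mult) (use x in \<open>simp_all add: coevm_contract\<close>)
    also have "\<tau> X * \<dots> = (\<tau> X * (\<I> (?m * ?n) \<otimes> x\<^sup>T)) * (\<I> ?m \<otimes> coevm ?n)"
      using x X by (simp add: mat_assoc mult.assoc)
    also have "\<tau> X * (\<I> (?m * ?n) \<otimes> x\<^sup>T) = (\<I> (?n * ?m) \<otimes> x\<^sup>T) * (\<tau> X \<otimes> \<I> ?n)"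
      by (rule contract_commute[symmetric]) (use x X in simp_all)
    also have "\<dots> * (\<I> ?m \<otimes> coevm ?n) = (\<I> (?n * ?m) \<otimes> x\<^sup>T) * ((\<tau> X \<otimes> \<I> ?n) * (\<I> ?m \<otimes> coevm ?n))"
      by (rule mat_assoc) (use x X in \<open>simp_all add: mult.assoc\<close>)
    finally show "(\<I> (?n * ?m) \<otimes> x\<^sup>T) * (cmp_end X ?m * ?e)
      = (\<I> (?n * ?m) \<otimes> x\<^sup>T) * ((\<tau> X \<otimes> \<I> ?n) * (\<I> ?m \<otimes> coevm ?n))" .
  qed (use X in \<open>simp_all add: mult.assoc\<close>)
  show "?e \<in> intertwiners V (cen V)"
  proof (rule hom_via_cmp_end)
    have "\<I> (fst V) \<otimes> coevm (fst reg) \<in> intertwiners (V \<odot> unit_rep) (V \<odot> (reg \<odot> dual_rep reg))"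
      by (intro hom_tensor hom_id coevm_hom rep_tensor_rep dual_rep_rep unit_rep rep_reg V)
    moreover have "\<tau> reg \<otimes> \<I> (fst (dual_rep reg)) \<in> intertwiners ((V \<odot> reg) \<odot> dual_rep reg) ((reg \<odot> V) \<odot> dual_rep reg)"
      by (intro hom_tensor hom_id hb(1) rep_tensor_rep dual_rep_rep rep_reg V)
    ultimately have "(\<tau> reg \<otimes> \<I> d) * (\<I> ?m \<otimes> coevm d) \<in> intertwiners V (sandwich reg V reg)"
      using V by (intro hom_comp[of _ _ "V \<odot> reg \<odot> dual_rep reg"]) (simp_all add: tensor_assoc)
    then show "cmp_end reg (fst V) * ?e \<in> intertwiners V (sandwich reg V reg)"
      using J[OF rep_reg] by simp
  qed (simp_all add: V)
  show "(\<I> (fst X) \<otimes> ?e) * \<tau> X = brd ?m X * (?e \<otimes> \<I> (fst X))" if X: "rep X"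
  proof (rule contract_cols_eqI[of _ ?m "fst X"])
    let ?n = "fst X"
    fix x :: "'k mat" assume x: "dim_row x = ?n" "dim_col x = 1"
    let ?A = "\<tau> X * (\<I> ?m \<otimes> x)"
    have "brd ?m X * (?e \<otimes> \<I> ?n) * (\<I> ?m \<otimes> x) = brd ?m X * ((?e \<otimes> \<I> ?n) * (\<I> ?m \<otimes> x))"
      by (rule mat_assoc) (use x in simp_all)
    also have "(?e \<otimes> \<I> ?n) * (\<I> ?m \<otimes> x) = (\<I> (d * ?m) \<otimes> x) * ?e"
      by (rule column_commute) (use x in simp_all)
    also have "brd ?m X * \<dots> = (phi X x \<otimes> \<I> (d * ?m)) * dlt ?m * ?e"
      using x by (simp add: brd_col[OF X x] flip: mat_assoc)
    also have "(phi X x \<otimes> \<I> (d * ?m)) * dlt ?m = phi (X \<odot> reg) (x \<otimes> uvec) \<otimes> \<I> ?m"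
      using phi_phi_dlt[OF X x rep_reg, of uvec ?m] by (simp add: phi_reg_uvec)
    also have "\<dots> * ?e = \<tau> (X \<odot> reg) * (\<I> ?m \<otimes> (x \<otimes> uvec))"
      by (rule phi_e) (use X x in simp_all)
    \<comment> \<open>The tensor law for \<open>X\<close> and the regular representation; it takes
      the place of coassociativity of the coaction.\<close>
    also have "\<dots> = ((\<I> ?n \<otimes> \<tau> reg) * (\<tau> X \<otimes> \<I> d)) * (\<I> ?m \<otimes> (x \<otimes> uvec))"
      using hb(3)[OF X rep_reg] by simp
    also have "\<dots> = (\<I> ?n \<otimes> \<tau> reg) * ((\<tau> X \<otimes> \<I> d) * (\<I> ?m \<otimes> (x \<otimes> uvec)))"
      by (rule mat_assoc) (use X x in \<open>simp_all add: mult.assoc\<close>)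
    also have "(\<tau> X \<otimes> \<I> d) * (\<I> ?m \<otimes> (x \<otimes> uvec)) = ?A \<otimes> uvec"
      using X x kronecker_mult[of "\<tau> X" "\<I> ?m \<otimes> x" "\<I> d" uvec] by (simp add: kronecker_assoc)
    also have "\<dots> = (\<I> (?n * ?m) \<otimes> uvec) * ?A"
      using X x kronecker_mult[of "\<I> (?n * ?m)" ?A uvec "\<I> 1"] by simp
    also have "(\<I> ?n \<otimes> \<tau> reg) * \<dots> = ((\<I> ?n \<otimes> \<tau> reg) * (\<I> ?n \<otimes> (\<I> ?m \<otimes> uvec))) * ?A"
      using X x by (simp add: mat_assoc mult.assoc)
    also have "(\<I> ?n \<otimes> \<tau> reg) * (\<I> ?n \<otimes> (\<I> ?m \<otimes> uvec)) = \<I> ?n \<otimes> ?e"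
      by (subst kronecker_mult) (simp_all add: adj_unit_def)
    also have "\<dots> * ?A = (\<I> ?n \<otimes> ?e) * \<tau> X * (\<I> ?m \<otimes> x)"
      by (rule mat_assoc[symmetric]) (use X x in simp_all)
    finally show "(\<I> ?n \<otimes> ?e) * \<tau> X * (\<I> ?m \<otimes> x) = brd ?m X * (?e \<otimes> \<I> ?n) * (\<I> ?m \<otimes> x)" ..
  qed (use X in simp_all)
qed


lemma rowf_counit_hom: "rowf \<epsilon> \<in> intertwiners reg unit_rep"
  using phi_hom[OF unit_rep, of "\<I> 1"] by (simp add: phi_unit[simplified])

lemma rowf_uvec: "functional f \<Longrightarrow> rowf f * uvec = mat 1 1 (\<lambda>_. f 1)"
  by (rule rowf_colv)

lemma rowf_counit_uvec: "rowf \<epsilon> * uvec = \<I> 1"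
  unfolding rowf_uvec[OF counit_functional] by (rule eq_matI) (simp_all add: counit_one)

text \<open>This map is the component of the end at the unit object, where
  \<open>1 \<otimes> V \<otimes> 1\<close> is \<open>V\<close>; that makes it a module map.\<close>

lemma adj_counit_hom:
  assumes V: "rep V" shows "rowf \<epsilon> \<otimes> \<I> (fst V) \<in> intertwiners (cen V) V"
proof -
  have "cmp_end unit_rep (fst V) = rowf \<epsilon> \<otimes> \<I> (fst V)"
    using cmp_end_contract[OF unit_rep, of "\<I> 1" "fst V"] by (simp add: phi_unit[simplified])
  moreover have "sandwich unit_rep V unit_rep = V" using V by simp
  ultimately show ?thesis using cmp_end_hom[OF unit_rep V] by metis
qed

lemma adjoint_functors_cen:
  assumes w: "\<And>x. S (w x) = x" "\<And>x. w (S x) = x"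
  shows "adjoint_functors (drinfeld_center Hmod) Hmod center_forget cen_adjoint"
  unfolding adjoint_functors_def
proof (intro conjI exI[of _ adj_unit] exI[of _ "\<lambda>V. rowf \<epsilon> \<otimes> \<I> (fst V)"] ballI)
  show "is_functor (drinfeld_center Hmod) Hmod center_forget"
    by (auto simp: is_functor_def)
  show "is_functor Hmod (drinfeld_center Hmod) cen_adjoint"
    unfolding is_functor_def
  proof (intro conjI ballI)
    fix X assume "X \<in> obj Hmod"
    then show "fobj cen_adjoint X \<in> obj (drinfeld_center Hmod)"
      "fmor cen_adjoint X X (idt Hmod X) = idt (drinfeld_center Hmod) (fobj cen_adjoint X)"
      using half_braiding_cen[OF w] by simp_all
  next
    fix X Y f assume f: "f \<in> mor Hmod X Y" and "X \<in> obj Hmod" "Y \<in> obj Hmod"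
    then show "fmor cen_adjoint X Y f \<in> mor (drinfeld_center Hmod) (fobj cen_adjoint X) (fobj cen_adjoint Y)"
      using cen_map_hom[of f X Y] hom_dims[OF f[simplified]] brd_cen_map[of _ f "fst Y" "fst X"]
      by (simp del: split_paired_All)
  next
    fix X Y W f g assume f: "f \<in> mor Hmod X Y" and g: "g \<in> mor Hmod Y W"
    then show "fmor cen_adjoint X W (g \<cdot>\<^bsub>Hmod\<^esub> f) = fmor cen_adjoint Y W g \<cdot>\<^bsub>drinfeld_center Hmod\<^esub> fmor cen_adjoint X Y f"
      using hom_dims[OF f[simplified]] hom_dims[OF g[simplified]] by (simp add: kronecker_mult)
  qed
next
  fix A assume A: "A \<in> obj (drinfeld_center Hmod)"
  obtain V \<tau> where [simp]: "A = (V, \<tau>)" by (cases A)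
  have V: "rep V" and t: "half_braiding Hmod V \<tau>" using A by simp_all
  note hb = half_braidingD[OF t V] and e = adj_unit_hom[OF V t]
  have [simp]: "dim_row (\<tau> reg) = d * fst V" "dim_col (\<tau> reg) = fst V * d"
    using hom_dims[OF hb(1)[OF rep_reg]] by simp_all
  show "adj_unit A \<in> mor (drinfeld_center Hmod) A (fobj cen_adjoint (fobj center_forget A))"
    using e by (simp del: split_paired_All)
  \<comment> \<open>First triangle identity: naturality along \<open>\<epsilon>\<close> leads to the
    component of \<open>\<tau>\<close> at the unit object, which is the identity.\<close>
  have "(rowf \<epsilon> \<otimes> \<I> (fst V)) * adj_unit A = ((rowf \<epsilon> \<otimes> \<I> (fst V)) * \<tau> reg) * (\<I> (fst V) \<otimes> uvec)"
    unfolding adj_unit_def by (simp add: mat_assoc)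
  also have "\<dots> = (\<I> (fst V) \<otimes> rowf \<epsilon>) * (\<I> (fst V) \<otimes> uvec)"
    by (simp add: hb(2)[OF rowf_counit_hom rep_reg unit_rep, symmetric] hb(4))
  also have "\<dots> = \<I> (fst V)"
    by (simp add: kronecker_mult rowf_counit_uvec[simplified])
  finally show "(rowf \<epsilon> \<otimes> \<I> (fst (fobj center_forget A))) \<cdot>\<^bsub>Hmod\<^esub>
      fmor center_forget A (fobj cen_adjoint (fobj center_forget A)) (adj_unit A) = idt Hmod (fobj center_forget A)"
    by simp
next
  fix A B f
  assume A: "A \<in> obj (drinfeld_center Hmod)" and B: "B \<in> obj (drinfeld_center Hmod)"
    and f: "f \<in> mor (drinfeld_center Hmod) A B"
  let ?V = "fst A" and ?W = "fst B"
  have fh: "f \<in> intertwiners ?V ?W"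
    and fall: "\<And>X. rep X \<Longrightarrow> (\<I> (fst X) \<otimes> f) * snd A X = snd B X * (f \<otimes> \<I> (fst X))"
    using f unfolding center_simps by blast+
  have fc: "(\<I> d \<otimes> f) * snd A reg = snd B reg * (f \<otimes> \<I> d)"
    using fall[OF rep_reg] by simp
  note [simp] = hom_dims[OF fh]
  have [simp]: "dim_row (snd A reg) = d * fst ?V" "dim_col (snd A reg) = fst ?V * d"
    "dim_row (snd B reg) = d * fst ?W" "dim_col (snd B reg) = fst ?W * d"
    using hom_dims[OF half_braidingD(1)[of ?V "snd A" reg]] hom_dims[OF half_braidingD(1)[of ?W "snd B" reg]] A B
    by simp_all
  have "(\<I> d \<otimes> f) * adj_unit A = ((\<I> d \<otimes> f) * snd A reg) * (\<I> (fst ?V) \<otimes> uvec)"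
    unfolding adj_unit_def by (simp add: mat_assoc)
  also have "\<dots> = snd B reg * ((f \<otimes> \<I> d) * (\<I> (fst ?V) \<otimes> uvec))"
    unfolding fc by (simp add: mat_assoc)
  also have "\<dots> = snd B reg * ((\<I> (fst ?W) \<otimes> uvec) * f)"
    by (simp add: column_commute)
  also have "\<dots> = adj_unit B * f"
    unfolding adj_unit_def by (simp add: mat_assoc)
  finally show "fmor cen_adjoint (fobj center_forget A) (fobj center_forget B) (fmor center_forget A B f)
      \<cdot>\<^bsub>drinfeld_center Hmod\<^esub> adj_unit A = adj_unit B \<cdot>\<^bsub>drinfeld_center Hmod\<^esub> f"
    by simp
next
  fix V assume "V \<in> obj Hmod"
  then have V: "rep V" by simp
  show "rowf \<epsilon> \<otimes> \<I> (fst V) \<in> mor Hmod (fobj center_forget (fobj cen_adjoint V)) V"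
    using adj_counit_hom[OF V] by simp
  \<comment> \<open>On objects in the image of the right adjoint the unit of the adjunction is the
    comultiplication of the comonad, so the second triangle identity is a counit law.\<close>
  have "adj_unit (cen V, cen_hb V) = dlt (fst V)"
    using brd_col[OF rep_reg, of uvec "fst V"] by (simp add: adj_unit_def phi_reg_uvec)
  then show "fmor cen_adjoint (fobj center_forget (fobj cen_adjoint V)) V (rowf \<epsilon> \<otimes> \<I> (fst V))
      \<cdot>\<^bsub>drinfeld_center Hmod\<^esub> adj_unit (fobj cen_adjoint V) = idt (drinfeld_center Hmod) (fobj cen_adjoint V)"
    by (simp add: dlt_counit)
next
  fix V W f assume f: "f \<in> mor Hmod V W"
  then show "f \<cdot>\<^bsub>Hmod\<^esub> (rowf \<epsilon> \<otimes> \<I> (fst V)) = (rowf \<epsilon> \<otimes> \<I> (fst W)) \<cdot>\<^bsub>Hmod\<^esub>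
      fmor center_forget (fobj cen_adjoint V) (fobj cen_adjoint W) (fmor cen_adjoint V W f)"
    using hom_dims[OF f[simplified]] kronecker_mult[of "\<I> 1" "rowf \<epsilon>" f "\<I> (fst V)"]
    by (simp add: kronecker_mult)
qed

text \<open>
  The regular representation detects kernels: a vector \<open>y\<close> killed by \<open>f\<close> yields \<open>h \<mapsto> h y\<close>, killed by \<open>f\<close>.
\<close>

lemma monomorphism_kernel:
  assumes f: "monomorphism Hmod Y X f" and Y: "rep Y" and X: "rep X"
    and y: "dim_row y = fst Y" "dim_col y = 1" and fy: "f * y = 0\<^sub>m (fst X) 1"
  shows "y = 0\<^sub>m (fst Y) 1"
proof -
  have fh: "f \<in> intertwiners Y X"
    and mono: "\<And>g h. g \<in> intertwiners reg Y \<Longrightarrow> h \<in> intertwiners reg Y \<Longrightarrow> f * g = f * h \<Longrightarrow> g = h"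
    using f rep_reg unfolding monomorphism_def modules_simps by blast+
  let ?z = "0\<^sub>m (fst Y) 1 :: 'k mat"
  have fz: "f * ?z = 0\<^sub>m (fst X) 1"
    using hom_dims[OF fh] by (intro right_mult_zero_mat) (auto intro!: carrier_matI)
  have "phi Y y = phi Y ?z"
    by (rule mono) (use y in \<open>simp_all add: phi_hom Y hom_phi[OF fh Y X] fy[simplified] fz[simplified]\<close>)
  then show ?thesis
    using phi_uvec[OF Y y] phi_uvec[OF Y, of ?z] by simp
qed

text \<open>A nonzero linear map to a line with trivial kernel starts from a line.\<close>

lemma simple_unit: "simple_object Hmod unit_rep"
  unfolding simple_object_def
proof (intro conjI ballI allI impI)
  show "unit_rep \<in> obj Hmod" by simp
  have "(\<I> 1 :: 'k mat) $$ (0, 0) \<noteq> 0\<^sub>m 1 1 $$ (0, 0)" by simp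
  then show "idt Hmod unit_rep \<noteq> zer Hmod unit_rep unit_rep" by (metis modules_simps(4,5) fst_unit_rep)
  fix Y f assume Y: "Y \<in> obj Hmod" and mono: "monomorphism Hmod Y unit_rep f"
  let ?n = "fst Y"
  have Y: "rep Y" using Y by simp
  have f: "f \<in> intertwiners Y unit_rep" using mono by (simp add: monomorphism_def)
  note [simp] = hom_dims[OF f]
  show "f = zer Hmod Y unit_rep \<or> iso_morphism Hmod Y unit_rep f"
  proof (cases "\<exists>j<?n. f $$ (0, j) \<noteq> 0")
    case False
    then have "f = 0\<^sub>m 1 ?n" by (intro eq_matI) auto
    then show ?thesis by simp
  next
    case True
    then obtain j where j: "j < ?n" "f $$ (0, j) \<noteq> 0" by blast
    have "i = j" if i: "i < ?n" for i
    proof (rule ccontr)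
      assume ij: "i \<noteq> j"
      \<comment> \<open>A nonzero kernel vector supported on two coordinates, present as soon as
        \<open>Y\<close> has a second dimension.\<close>
      define y where "y = mat ?n 1 (\<lambda>(k, _). if k = i then f $$ (0, j) else if k = j then - f $$ (0, i) else 0)"
      have "(\<Sum>k<?n. f $$ (0, k) * y $$ (k, 0))
          = (\<Sum>k<?n. (if k = i then f $$ (0, i) * f $$ (0, j) else 0) + (if k = j then - (f $$ (0, j) * f $$ (0, i)) else 0))"
        using ij by (intro sum.cong) (auto simp: y_def)
      also have "\<dots> = 0" using i j by (simp add: sum.distrib)
      finally have "f * y = 0\<^sub>m (fst unit_rep) 1"
        by (intro eq_matI) (simp_all add: mat_mult_index_sum y_def del: index_mult_mat(1))
      then have "y = 0\<^sub>m ?n 1"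
        by (intro monomorphism_kernel[OF mono Y unit_rep]) (simp_all add: y_def)
      then have "y $$ (i, 0) = 0" using i by simp
      then show False using i j by (simp add: y_def)
    qed
    note all_eq = this
    have j0: "j = 0" using all_eq[of 0] j(1) by simp
    have n: "?n = 1" using all_eq[of 1] j(1) j0 by (cases "1 < ?n") simp_all
    let ?g = "mat 1 1 (\<lambda>_. inverse (f $$ (0, 0)))"
    have fg: "f * ?g = \<I> 1" "?g * f = \<I> 1"
      using j n j0 by (auto intro!: eq_matI simp: scalar_prod_def)
    have "?g \<in> intertwiners unit_rep Y"
      by (rule hom_cancel[OF f, where L = ?g]) (use fg n Y hom_id[OF unit_rep] in simp_all)
    then have "iso_morphism Hmod Y unit_rep f"
      using f fg n by (auto simp: iso_morphism_def)
    then show ?thesis ..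
  qed
qed

text \<open>On \<open>Z(1) = H\<close> the action is
  \<open>h \<mapsto> x\<^sub>1 h S x\<^sub>2\<close>: contracting the dual factor with 1 after
  \<open>x\<^sub>2\<close> has acted on it is contracting it with
  \<open>S x\<^sub>2\<close>.\<close>

lemma cen_unit_action:
  assumes l: "functional l"
  shows "rowf l * (snd (cen unit_rep) x * colv h) = mat 1 1 (\<lambda>_. sw x (\<lambda>a b. l (a * h * S b)))"
proof -
  let ?s = "reg \<odot> dual_rep reg"
  have s: "sandwich reg unit_rep reg = ?s" by simp
  have reps: "rep (dual_rep reg)" "rep ?s" by simp_all
  note [simp] = rep_dims[OF reps(2)]
  have kc: "snd reg a \<otimes> (snd reg (S b))\<^sup>T \<in> carrier_mat (d * d) (d * d)" for a b
    by (auto intro!: carrier_matI)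
  have "evl 1 * snd ?s x = swm x d (d * d) (\<lambda>a b. evl 1 * (snd reg a \<otimes> (snd reg (S b))\<^sup>T))"
    unfolding snd_rep_tensor[OF rep_reg reps(1)] fst_reg fst_rep_dual snd_rep_dual
    by (rule swm_mult_left[OF kc]) simp_all
  also have "(\<lambda>a b. evl 1 * (snd reg a \<otimes> (snd reg (S b))\<^sup>T))
      = (\<lambda>a b. snd reg a * (\<I> d \<otimes> (colv (S b))\<^sup>T))"
  proof (intro ext)
    fix a b
    have "evl 1 * (snd reg a \<otimes> (snd reg (S b))\<^sup>T) = snd reg a \<otimes> (colv (S b))\<^sup>T"
      by (simp add: evl_def kronecker_mult reg_colv flip: mat_transpose_mult)
    also have "\<dots> = snd reg a * (\<I> d \<otimes> (colv (S b))\<^sup>T)"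
      using kronecker_mult[of "snd reg a" "\<I> d" "\<I> 1" "(colv (S b))\<^sup>T"] by simp
    finally show "evl 1 * (snd reg a \<otimes> (snd reg (S b))\<^sup>T) = snd reg a * (\<I> d \<otimes> (colv (S b))\<^sup>T)" .
  qed
  finally have 1: "evl 1 * snd ?s x = swm x d (d * d) (\<lambda>a b. snd reg a * (\<I> d \<otimes> (colv (S b))\<^sup>T))" .
  have "snd (cen unit_rep) x * colv h = (evl 1 * snd ?s x) * (cmp_end reg 1 * colv h)"
    unfolding cen_def s by (simp add: mat_assoc)
  also have "\<dots> = swm x d 1 (\<lambda>a b. snd reg a * (\<I> d \<otimes> (colv (S b))\<^sup>T) * (cmp_end reg 1 * colv h))"
    unfolding 1 by (rule swm_mult_right) (auto intro!: carrier_matI)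
  also have "(\<lambda>a b. snd reg a * (\<I> d \<otimes> (colv (S b))\<^sup>T) * (cmp_end reg 1 * colv h)) = (\<lambda>a b. colv (a * h * S b))"
  proof (intro ext)
    fix a b
    have "snd reg a * (\<I> d \<otimes> (colv (S b))\<^sup>T) * (cmp_end reg 1 * colv h)
        = snd reg a * (((\<I> d \<otimes> (colv (S b))\<^sup>T) * cmp_end reg 1) * colv h)"
      by (simp add: mat_assoc)
    also have "\<dots> = colv (a * h * S b)"
      using cmp_end_contract[OF rep_reg, of "colv (S b)" 1] phi_colv[OF rep_reg, of "colv (S b)" h]
      by (simp add: reg_colv mult.assoc)
    finally show "snd reg a * (\<I> d \<otimes> (colv (S b))\<^sup>T) * (cmp_end reg 1 * colv h) = colv (a * h * S b)" .
  qed
  finally have "rowf l * (snd (cen unit_rep) x * colv h) = swm x 1 1 (\<lambda>a b. rowf l * colv (a * h * S b))"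
    by (simp only:) (rule swm_mult_left, auto intro!: carrier_matI)
  then show ?thesis
    by (simp add: rowf_colv[OF l] swm_def cong: cong_mat)
qed

lemma rowf_hom_iff:
  assumes l: "functional l"
  shows "rowf l \<in> intertwiners (cen unit_rep) unit_rep \<longleftrightarrow> ad_invariant l"
proof -
  have 1: "(rowf l * snd (cen unit_rep) x) * colv h = mat 1 1 (\<lambda>_. sw x (\<lambda>a b. l (a * h * S b)))" for x h
    by (simp add: mat_assoc cen_unit_action[OF l])
  have 2: "(snd unit_rep x * rowf l) * colv h = mat 1 1 (\<lambda>_. \<epsilon> x * l h)" for x h
  proof -
    have "mat 1 1 (\<lambda>_. \<epsilon> x) * mat 1 1 (\<lambda>_. l h) = mat 1 1 (\<lambda>_. \<epsilon> x * l h)"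
      by (rule eq_matI) (simp_all add: scalar_prod_def)
    then show ?thesis by (simp add: mat_assoc rowf_colv[OF l])
  qed
  have "rowf l * snd (cen unit_rep) x = snd unit_rep x * rowf l \<longleftrightarrow>
      (\<forall>h. sw x (\<lambda>a b. l (a * h * S b)) = \<epsilon> x * l h)" for x
  proof
    assume eq: "rowf l * snd (cen unit_rep) x = snd unit_rep x * rowf l"
    show "\<forall>h. sw x (\<lambda>a b. l (a * h * S b)) = \<epsilon> x * l h"
    proof
      fix h
      have "mat 1 1 (\<lambda>_. sw x (\<lambda>a b. l (a * h * S b))) = mat 1 1 (\<lambda>_. \<epsilon> x * l h)"
        unfolding 1[symmetric] 2[symmetric] eq ..
      then have "mat 1 1 (\<lambda>_. sw x (\<lambda>a b. l (a * h * S b))) $$ (0, 0) = mat 1 1 (\<lambda>_. \<epsilon> x * l h) $$ (0, 0)" by simp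
      then show "sw x (\<lambda>a b. l (a * h * S b)) = \<epsilon> x * l h" by simp
    qed
  next
    assume "\<forall>h. sw x (\<lambda>a b. l (a * h * S b)) = \<epsilon> x * l h"
    then have "(rowf l * snd (cen unit_rep) x) * colv h = (snd unit_rep x * rowf l) * colv h" for h
      unfolding 1 2 by simp
    then show "rowf l * snd (cen unit_rep) x = snd unit_rep x * rowf l"
      by (rule mat_eq_colvI[rotated 3]) simp_all
  qed
  then show ?thesis by (simp add: intertwiners_iff ad_invariant_def)
qed

lemma center_unit_simps [simp]:
  "fst (center_unit Hmod) = unit_rep" "rep X \<Longrightarrow> snd (center_unit Hmod) X = \<I> (fst X)"
  by (simp_all add: center_unit_def)

lemma modular_object_unit:
  assumes l: "cointegral l" "l 1 = 1" and ad: "ad_invariant l"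
  shows "modular_object Hmod unit_rep"
  unfolding modular_object_def
proof (intro conjI exI[of _ cen_adjoint])
  have fl: "functional l" using l(1) by (rule cointegral_functional)
  obtain w where w: "\<And>x. S (w x) = x" "\<And>x. w (S x) = x"
  proof
    interpret S: Vector_Spaces.linear scale scale S by (rule antipode_linear)
    have "inj S" using S_inj[OF l] by (simp add: S.inj_iff_eq_0)
    then show "S (inv_into UNIV S x) = x" "inv_into UNIV S (S x) = x" for x
      using S_surj[OF l] by (simp_all add: surj_f_inv_f)
  qed
  show "adjoint_functors (drinfeld_center Hmod) Hmod center_forget cen_adjoint"
    by (rule adjoint_functors_cen[OF w])
  show "simple_object Hmod unit_rep" by (rule simple_unit)
  \<comment> \<open>In elements, \<open>h \<otimes> x\<close> goes to \<open>h\<^sub>1 x\<close>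
    weighted with \<open>l h\<^sub>2\<close>, which is \<open>l h\<close> times \<open>x\<close>. So
    the cointegral law gives compatibility with the half-braidings, and invariance gives
    compatibility with the action.\<close>
  have center: "(\<I> (fst X) \<otimes> rowf l) * brd 1 X = rowf l \<otimes> \<I> (fst X)" if X: "rep X" for X
  proof (rule contract_cols_eqI[of _ d "fst X"])
    fix x :: "'k mat" assume x: "dim_row x = fst X" "dim_col x = 1"
    have "(\<I> (fst X) \<otimes> rowf l) * brd 1 X * (\<I> d \<otimes> x) = (\<I> (fst X) \<otimes> rowf l) * ((phi X x \<otimes> \<I> d) * comat)"
      using brd_col[OF X x, of 1] x by (simp add: mat_assoc dlt_def)
    also have "\<dots> = ((\<I> (fst X) \<otimes> rowf l) * (phi X x \<otimes> \<I> d)) * comat"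
      by (rule mat_assoc[symmetric]) simp_all
    also have "(\<I> (fst X) \<otimes> rowf l) * (phi X x \<otimes> \<I> d) = phi X x * (\<I> d \<otimes> rowf l)"
      using kronecker_mult[of "\<I> (fst X)" "phi X x" "rowf l" "\<I> d"]
        kronecker_mult[of "phi X x" "\<I> d" "\<I> 1" "rowf l"] by simp
    also have "\<dots> * comat = phi X x * (uvec * rowf l)"
      using l(1) by (simp add: mat_assoc cointegral_iff_comat[OF fl])
    also have "\<dots> = x * rowf l"
      by (simp add: phi_uvec[OF X x] flip: mat_assoc)
    also have "\<dots> = (rowf l \<otimes> \<I> (fst X)) * (\<I> d \<otimes> x)"
      using x column_commute[of "rowf l" 1 d x "fst X"] by simp
    finally show "(\<I> (fst X) \<otimes> rowf l) * brd 1 X * (\<I> d \<otimes> x) = (rowf l \<otimes> \<I> (fst X)) * (\<I> d \<otimes> x)" .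
  qed simp_all
  have ne: "rowf l \<noteq> 0\<^sub>m 1 d"
  proof
    assume "rowf l = 0\<^sub>m 1 d"
    then have "mat 1 1 (\<lambda>_. l 1) = 0\<^sub>m 1 d * uvec" using rowf_uvec[OF fl] by simp
    then have "mat 1 1 (\<lambda>_. l 1) $$ (0, 0) = (0\<^sub>m 1 d * uvec) $$ (0, 0)" by simp
    then show False using l(2) by (simp add: mat_mult_index_sum del: index_mult_mat(1))
  qed
  show "\<exists>f\<in>mor (drinfeld_center Hmod) (fobj cen_adjoint unit_rep) (center_unit Hmod).
      f \<noteq> zer (drinfeld_center Hmod) (fobj cen_adjoint unit_rep) (center_unit Hmod)"
    using center ne ad by (intro bexI[of _ "rowf l"]) (simp_all add: rowf_hom_iff[OF fl] del: split_paired_All)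
qed

lemma iso_unit: "iso_morphism Hmod unit_rep unit_rep (\<I> 1)"
  unfolding iso_morphism_def using hom_id[OF unit_rep] by (intro conjI bexI[of _ "\<I> 1"]) simp_all

text \<open>With the unit as modular object and \<open>i\<close> the identity, the equation
  \<open>Z(l) \<delta> = u l\<close> is the right side of \<open>cointegral_iff_comat\<close>, and
  the composite that must not vanish is the scalar \<open>l 1\<close>.\<close>

theorem cointegral_property_CU:
  assumes l: "cointegral l" "l 1 = 1" and ad: "ad_invariant l"
  shows "property_CU Hmod"
proof -
  have fl: "functional l" using l(1) by (rule cointegral_functional)
  note mod = modular_object_unit[OF l ad]
  have "unimodular_category Hmod"
    using mod iso_unit unfolding unimodular_category_def isomorphic_objects_def modules_simps by blast
  moreover have "categorical_cointegral Hmod cen_functor (\<lambda>V. dlt (fst V)) uvec unit_rep (rowf l)"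
    using ad l(1) by (simp add: categorical_cointegral_def cen_functor_def rowf_hom_iff[OF fl]
      cointegral_iff_comat[OF fl] dlt_def)
  moreover have nonzero: "rowf l * ((\<I> d \<otimes> \<I> 1) * uvec) \<noteq> 0\<^sub>m 1 1"
  proof
    assume "rowf l * ((\<I> d \<otimes> \<I> 1) * uvec) = 0\<^sub>m 1 1"
    then have "mat 1 1 (\<lambda>_. l 1) $$ (0, 0) = 0\<^sub>m 1 1 $$ (0, 0)" by (simp add: rowf_uvec[OF fl])
    then show False using l(2) by simp
  qed
  moreover have "rowf l \<noteq> 0\<^sub>m 1 d"
  proof
    assume 0: "rowf l = 0\<^sub>m 1 d"
    have "0\<^sub>m 1 d * ((\<I> d \<otimes> \<I> 1) * uvec) = (0\<^sub>m 1 1 :: 'k mat)"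
      by (rule left_mult_zero_mat) (auto intro!: carrier_matI)
    then show False using nonzero 0 by simp
  qed
  ultimately show ?thesis
    using mod iso_unit central_hopf_comonad_cen unfolding property_CU_def
    by (intro conjI exI[of _ cen_functor] exI[of _ "\<lambda>V X. cmp_end X (fst V)"] exI[of _ "\<lambda>V. dlt (fst V)"]
        exI[of _ uvec] exI[of _ unit_rep] exI[of _ "rowf l"] exI[of _ "\<I> 1"])
      (simp_all add: cen_functor_def)
qed

section \<open>Property CU\<close>

text \<open>
  A comonad structure \<open>Z\<close> as in the definition of property CU is compared with the explicit one at the unit
  object only: \<open>g : cen 1 \<rightarrow> Z(1)\<close> and \<open>r : Z(1) \<rightarrow> cen 1\<close> are the morphisms induced by the two universal
  properties, and \<open>l \<circ> Z(i) \<circ> g\<close> is the row vector of the functional on \<open>H\<close> that is sought.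
\<close>

lemma property_CU_cointegral:
  assumes CU: "property_CU Hmod"
  obtains l where "cointegral l" "l 1 = 1" "ad_invariant l"
proof -
  obtain Z \<pi> \<delta> u \<alpha> l i where com: "central_hopf_comonad Hmod Z \<pi> \<delta> u" and mod: "modular_object Hmod \<alpha>"
    and coint: "categorical_cointegral Hmod Z \<delta> u \<alpha> l" and i: "iso_morphism Hmod unit_rep \<alpha> i"
    and ne: "l * (fmor Z unit_rep \<alpha> i * u) \<noteq> 0\<^sub>m 1 1"
    using CU unfolding property_CU_def modules_simps fst_unit_rep by metis
  have \<alpha>: "rep \<alpha>" using mod by (simp add: modular_object_def simple_object_def)
  obtain i' where ih: "i \<in> intertwiners unit_rep \<alpha>" and i'h: "i' \<in> intertwiners \<alpha> unit_rep"
    and i'i: "i' * i = \<I> 1" and ii': "i * i' = \<I> (fst \<alpha>)"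
    using i by (auto simp: iso_morphism_def)
  have Zend: "central_end Hmod V (fobj Z V) (\<pi> V)" if "rep V" for V
    using com that unfolding central_hopf_comonad_def modules_simps by blast
  have Zrep: "rep (fobj Z V)" if "rep V" for V
    using Zend[OF that] by (simp add: central_end_def)
  have Zwedge: "wedge V (fobj Z V) (\<pi> V)" if "rep V" for V
    using Zend[OF that] that Zrep[OF that] by (simp add: central_end_def central_wedge_iff)
  have Zuniv: "\<exists>!g. g \<in> intertwiners W (fobj Z V) \<and> (\<forall>X\<in>{X. rep X}. \<pi> V X * g = j X)"
    if "rep V" "rep W" "wedge V W j" for V W j
    using Zend[OF that(1)] that central_wedge_iff[OF that(1,2)]
    unfolding central_end_def modules_simps by blast
  have Zfun: "is_functor Hmod Hmod Z"
    using com unfolding central_hopf_comonad_def by blast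
  have \<pi>h: "\<pi> V X \<in> intertwiners (fobj Z V) (sandwich X V X)" if "rep V" "rep X" for V X
    using Zwedge[OF that(1)] that(2) unfolding wedge_def by blast
  have Zmor: "fmor Z V W f \<in> intertwiners (fobj Z V) (fobj Z W)" if "f \<in> intertwiners V W" "rep V" "rep W" for V W f
    using Zfun that unfolding is_functor_def modules_simps by blast
  have \<pi>nat: "\<pi> W X * fmor Z V W f = (\<I> (fst X) \<otimes> f \<otimes> \<I> (fst X)) * \<pi> V X"
    if "f \<in> intertwiners V W" "rep V" "rep W" "rep X" for V W f X
    using com that unfolding central_hopf_comonad_def modules_simps fst_rep_dual by blast
  have uh: "u \<in> intertwiners unit_rep (fobj Z unit_rep)" and \<pi>u: "\<And>X. rep X \<Longrightarrow> \<pi> unit_rep X * u = coevm (fst X)"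
    using com unfolding central_hopf_comonad_def modules_simps by blast+
  have lh: "l \<in> intertwiners (fobj Z \<alpha>) unit_rep"
    and lcoint: "fmor Z (fobj Z \<alpha>) unit_rep l * \<delta> \<alpha> = u * l"
    using coint by (simp_all add: categorical_cointegral_def)
  have \<delta>h: "\<delta> \<alpha> \<in> intertwiners (fobj Z \<alpha>) (fobj Z (fobj Z \<alpha>))"
    using com \<alpha> unfolding central_hopf_comonad_def modules_simps by blast
  have \<pi>\<delta>: "(\<I> (fst X) \<otimes> \<pi> \<alpha> Y \<otimes> \<I> (fst X)) * (\<pi> (fobj Z \<alpha>) X * \<delta> \<alpha>)
      = (\<I> (fst X) \<otimes> \<I> (fst Y) \<otimes> \<I> (fst \<alpha>) \<otimes> dual_tens Hmod X Y) * \<pi> \<alpha> (X \<odot> Y)"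
    if "rep X" "rep Y" for X Y
    using com \<alpha> that unfolding central_hopf_comonad_def modules_simps fst_rep_dual by blast
  let ?E = "fobj Z unit_rep" and ?A = "fobj Z \<alpha>" and ?Zi = "fmor Z unit_rep \<alpha> i" and ?Zi' = "fmor Z \<alpha> unit_rep i'"
  have E: "rep ?E" and A: "rep ?A" and ZA: "rep (fobj Z ?A)" using Zrep \<alpha> by auto
  have Zih: "?Zi \<in> intertwiners ?E ?A" and Zi'h: "?Zi' \<in> intertwiners ?A ?E"
    using Zmor ih i'h \<alpha> by auto
  have jw: "wedge unit_rep (cen unit_rep) (\<lambda>X. cmp_end X 1)"
    using wedge_cmp_end[OF unit_rep] by simp
  obtain g where gh: "g \<in> intertwiners (cen unit_rep) ?E" and \<pi>g: "\<And>X. rep X \<Longrightarrow> \<pi> unit_rep X * g = cmp_end X 1"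
    using Zuniv[OF unit_rep cen_rep[OF unit_rep] jw] by blast
  define r where "r = evl 1 * \<pi> unit_rep reg"
  have rh: "r \<in> intertwiners ?E (cen unit_rep)" and \<pi>r: "\<And>X. rep X \<Longrightarrow> cmp_end X 1 * r = \<pi> unit_rep X"
    unfolding r_def by (rule end_factor[OF Zwedge[OF unit_rep] unit_rep E, unfolded fst_unit_rep])+
  note dims [simp] = hom_dims[OF ih] hom_dims[OF i'h] hom_dims[OF uh] hom_dims[OF lh] hom_dims[OF \<delta>h]
    hom_dims[OF Zih] hom_dims[OF Zi'h] hom_dims[OF gh] hom_dims[OF rh]
  have \<pi>dims [simp]: "dim_row (\<pi> V X) = fst X * (fst V * fst X)" "dim_col (\<pi> V X) = fst (fobj Z V)" if "rep V" "rep X" for V X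
    using hom_dims[OF \<pi>h[OF that]] by simp_all
  \<comment> \<open>The uniqueness half of the universal property, as a cancellation rule for the
    family \<open>\<pi>\<close>.\<close>
  have E_unique: "f = f'" if "f \<in> intertwiners W ?E" "f' \<in> intertwiners W ?E" "rep W"
    "\<And>X. rep X \<Longrightarrow> \<pi> unit_rep X * f = \<pi> unit_rep X * f'" for f f' W
  proof -
    have "wedge unit_rep W (\<lambda>X. \<pi> unit_rep X * f)"
    proof -
      have "\<pi> unit_rep X * f \<in> intertwiners W (sandwich X unit_rep X)" if "rep X" for X
        using \<pi>h[OF unit_rep that] that \<open>f \<in> intertwiners W ?E\<close> \<open>rep W\<close> E by (intro hom_comp[OF _ \<pi>h]) simp_all
      moreover have "(h \<otimes> \<I> (fst unit_rep * fst X)) * (\<pi> unit_rep X * f)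
          = (\<I> (fst Y * fst unit_rep) \<otimes> h\<^sup>T) * (\<pi> unit_rep Y * f)"
        if "h \<in> intertwiners X Y" "rep X" "rep Y" for h X Y
      proof -
        have "(h \<otimes> \<I> (fst unit_rep * fst X)) * \<pi> unit_rep X = (\<I> (fst Y * fst unit_rep) \<otimes> h\<^sup>T) * \<pi> unit_rep Y"
          using Zwedge[OF unit_rep] that unfolding wedge_def by blast
        then have "((h \<otimes> \<I> (fst unit_rep * fst X)) * \<pi> unit_rep X) * f
            = ((\<I> (fst Y * fst unit_rep) \<otimes> h\<^sup>T) * \<pi> unit_rep Y) * f" by simp
        then show ?thesis
          using that hom_dims[OF that(1)] hom_dims[OF \<open>f \<in> intertwiners W ?E\<close>] by (simp add: mat_assoc)
      qed
      ultimately show ?thesis unfolding wedge_def by blast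
    qed
    from Zuniv[OF unit_rep that(3) this] show ?thesis using that(1,2,4) by (smt (verit) mem_Collect_eq)
  qed
  \<comment> \<open>Comparing the two ends, \<open>g\<close> undoes \<open>r\<close>; together with
    \<open>ZiZi'\<close> this will express \<open>l\<close> through \<open>f\<close>.\<close>
  have gr: "g * r = \<I> (fst ?E)"
  proof (rule E_unique[OF _ hom_id[OF E] E])
    show "g * r \<in> intertwiners ?E ?E" by (rule hom_comp[OF rh gh]) (use E in simp_all)
    show "\<pi> unit_rep X * (g * r) = \<pi> unit_rep X * \<I> (fst ?E)" if "rep X" for X
      using that by (simp add: \<pi>g \<pi>r[simplified] flip: mat_assoc)
  qed
  have gu: "g * uvec = u"
  proof (rule E_unique[OF _ uh unit_rep])
    show "g * uvec \<in> intertwiners unit_rep ?E" by (rule hom_comp[OF uvec_hom gh]) (use E in simp_all)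
    show "\<pi> unit_rep X * (g * uvec) = \<pi> unit_rep X * u" if "rep X" for X
      using that by (simp add: \<pi>g \<pi>u cmp_end_uvec[simplified] flip: mat_assoc)
  qed
  have ZiZi': "?Zi * ?Zi' = \<I> (fst ?A)"
  proof -
    have "fmor Z \<alpha> \<alpha> (i * i') = ?Zi * ?Zi'"
      using Zfun ih i'h \<alpha> unit_rep unfolding is_functor_def modules_simps by blast
    moreover have "fmor Z \<alpha> \<alpha> (\<I> (fst \<alpha>)) = \<I> (fst ?A)"
      using Zfun \<alpha> unfolding is_functor_def modules_simps by blast
    ultimately show ?thesis by (simp add: ii')
  qed
  define f where "f = l * (?Zi * g)"
  have fh: "f \<in> intertwiners (cen unit_rep) unit_rep"
    unfolding f_def by (intro hom_comp[OF hom_comp[OF gh Zih] lh]) (use E A in simp_all)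
  note [simp] = hom_dims[OF fh]
  define c where "c h = (f * colv h) $$ (0, 0)" for h
  have c: "functional c"
    by (simp add: functional_def c_def mat_mult_index_sum functional_simps[OF crd_functional] distrib_left
      sum.distrib sum_distrib_left mult.left_commute del: index_mult_mat(1))
  have f_row: "f = rowf c"
  proof (rule mat_eq_colvI)
    fix h show "f * colv h = rowf c * colv h"
      unfolding rowf_colv[OF c] by (rule eq_matI) (simp_all add: c_def)
  qed simp_all
  have ad: "ad_invariant c" using fh unfolding f_row rowf_hom_iff[OF c] .
  have fu: "f * uvec = l * (?Zi * u)"
    unfolding f_def by (simp add: mat_assoc gu)
  have c1: "c 1 \<noteq> 0"
  proof
    assume "c 1 = 0"
    then have "f * uvec = 0\<^sub>m 1 1"
      unfolding f_row rowf_uvec[OF c] by (intro eq_matI) simp_all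
    then show False using ne fu by simp
  qed
  \<comment> \<open>\<open>l\<close> is rewritten as \<open>f\<close> after a component of
    \<open>\<pi>\<close>, because the defining equation of \<open>\<delta>\<close> speaks about
    \<open>\<delta>\<close> only through such components.\<close>
  have l_eq: "l = f * (evl 1 * ((\<I> d \<otimes> i' \<otimes> \<I> d) * \<pi> \<alpha> reg))"
  proof -
    have "f * (r * ?Zi') = l * (?Zi * ((g * r) * ?Zi'))"
      unfolding f_def by (simp add: mat_assoc)
    also have "\<dots> = l" by (simp add: gr ZiZi')
    finally have "l = f * (r * ?Zi')" ..
    also have "r * ?Zi' = evl 1 * (\<pi> unit_rep reg * ?Zi')"
      unfolding r_def by (simp add: mat_assoc)
    finally show ?thesis using \<pi>nat[OF i'h \<alpha> unit_rep rep_reg] by simp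
  qed
  let ?k = "f * evl 1"
  let ?L = "\<I> d \<otimes> l \<otimes> \<I> d"
  let ?P = "\<pi> ?A reg * \<delta> \<alpha>"
  let ?K = "\<I> d \<otimes> ?k \<otimes> \<I> d"
  let ?C = "\<I> d \<otimes> cmp_end reg 1 \<otimes> \<I> d"
  \<comment> \<open>The composite \<open>?L * ?P\<close> is computed twice. Here \<open>l\<close> is
    pulled through \<open>\<pi>\<close> by naturality, the cointegral equation applies, and
    \<open>\<pi>\<close> after \<open>u\<close> is the coevaluation.\<close>
  have "?L * ?P = coevm d * l"
  proof -
    have "?L * ?P = (?L * \<pi> ?A reg) * \<delta> \<alpha>"
      by (rule mat_assoc[symmetric]) (simp_all add: A)
    also have "\<dots> = \<pi> unit_rep reg * (fmor Z ?A unit_rep l * \<delta> \<alpha>)"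
    proof -
      have nat: "?L * \<pi> ?A reg = \<pi> unit_rep reg * fmor Z ?A unit_rep l"
        using \<pi>nat[OF lh A unit_rep rep_reg] by simp
      show ?thesis
        unfolding nat by (rule mat_assoc) (use hom_dims[OF Zmor[OF lh A unit_rep]] in simp_all)
    qed
    also have "\<dots> = coevm d * l"
      unfolding lcoint using \<pi>u[OF rep_reg] by (simp flip: mat_assoc)
    finally show ?thesis .
  qed
  \<comment> \<open>Second computation: insert \<open>l_eq\<close>, use the equation for
    \<open>\<delta>\<close>, and move \<open>i\<close> outwards until it cancels against
    \<open>i'\<close>. What remains lives on the explicit end.\<close>
  moreover have "?L * ?P * (?Zi * g)
      = ?K * ((\<I> (d * d) \<otimes> dual_tens Hmod reg reg) * cmp_end (reg \<odot> reg) 1)"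
  proof -
    let ?i3 = "\<I> d \<otimes> i' \<otimes> \<I> d" and ?B = "dual_tens Hmod reg reg"
  let ?K3 = "\<I> d \<otimes> (?k * ?i3) \<otimes> \<I> d"
  let ?I = "\<I> d \<otimes> i \<otimes> \<I> d"
  let ?I1 = "\<I> d \<otimes> ?I \<otimes> \<I> d"
  let ?B1 = "\<I> (d * (d * fst \<alpha>)) \<otimes> ?B"
  let ?I2 = "\<I> (d * d) \<otimes> i \<otimes> \<I> (d * d)"
  let ?J = "\<I> (d * d) \<otimes> i"
  let ?B2 = "\<I> (d * d) \<otimes> ?B"
    have "\<I> d \<otimes> l \<otimes> \<I> d = ?K3 * (\<I> d \<otimes> \<pi> \<alpha> reg \<otimes> \<I> d)"
      using \<alpha> by (subst l_eq) (simp add: kronecker_mult mat_assoc)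
    then have "?L * ?P
        = ?K3 * ((\<I> d \<otimes> \<pi> \<alpha> reg \<otimes> \<I> d) * ?P)"
      using \<alpha> A by (simp add: mat_assoc)
    also have "\<dots> = ?K3 * (?B1 * \<pi> \<alpha> (reg \<odot> reg))"
      using \<pi>\<delta>[OF rep_reg rep_reg] by simp
    finally have "?L * ?P * (?Zi * g)
        = ?K3 * (?B1 * (\<pi> \<alpha> (reg \<odot> reg) * (?Zi * g)))"
      using \<alpha> by (simp add: mat_assoc ac_simps)
    also have "\<pi> \<alpha> (reg \<odot> reg) * (?Zi * g) = ?I2 * cmp_end (reg \<odot> reg) 1"
    proof -
      have "\<pi> \<alpha> (reg \<odot> reg) * (?Zi * g) = (\<pi> \<alpha> (reg \<odot> reg) * ?Zi) * g"
        by (rule mat_assoc[symmetric]) (use \<alpha> in simp_all)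
      also have "\<dots> = ?I2 * (\<pi> unit_rep (reg \<odot> reg) * g)"
        using \<pi>nat[OF ih unit_rep \<alpha>, of "reg \<odot> reg"] by (simp add: mat_assoc)
      finally show ?thesis by (simp add: \<pi>g)
    qed
    also have "?B1 * \<dots>
        = (?B1 * ?I2) * cmp_end (reg \<odot> reg) 1"
      by (rule mat_assoc[symmetric]) (simp_all add: mult.assoc)
    also have "?B1 * ?I2
        = ?I1 * ?B2"
    proof -
      have "\<I> (d * d) \<otimes> i \<otimes> \<I> (d * d) = ?J \<otimes> \<I> (d * d)"
        by (simp add: kronecker_assoc)
      moreover have "?B1 * (?J \<otimes> \<I> (d * d)) = ?J \<otimes> ?B"
        by (subst kronecker_mult) (simp_all add: mult.assoc)
      moreover have "\<I> d \<otimes> ?I \<otimes> \<I> d = ?J \<otimes> \<I> (d * d)"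
        by (simp add: kronecker_assoc)
      moreover have "(?J \<otimes> \<I> (d * d)) * ?B2 = ?J \<otimes> ?B"
        by (subst kronecker_mult) (simp_all add: mult.assoc)
      ultimately show ?thesis by simp
    qed
    also have "?K3 * (?I1 * ?B2 * cmp_end (reg \<odot> reg) 1)
        = (?K3 * ?I1) * (?B2 * cmp_end (reg \<odot> reg) 1)"
      by (simp add: mat_assoc ac_simps)
    also have "?K3 * ?I1
        = \<I> d \<otimes> (?k * (?i3 * ?I)) \<otimes> \<I> d"
      by (simp add: kronecker_mult mat_assoc)
    also have "?i3 * ?I = \<I> (d * d)"
      by (simp add: kronecker_mult i'i[simplified])
    finally show ?thesis by simp
  qed
  moreover have "(\<I> (d * d) \<otimes> dual_tens Hmod reg reg) * cmp_end (reg \<odot> reg) 1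
      = ?C * (cmp_end reg d * comat)"
    using cmp_end_dlt[OF rep_reg rep_reg, of 1] by (simp add: dlt_def)
  moreover have "?K * (?C * (cmp_end reg d * comat))
      = (\<I> d \<otimes> f \<otimes> \<I> d) * (cmp_end reg d * comat)"
  proof -
    have "?K * (?C * (cmp_end reg d * comat))
        = (?K * ?C) * (cmp_end reg d * comat)"
      by (rule mat_assoc[symmetric]) simp_all
    also have "?K * ?C = \<I> d \<otimes> f \<otimes> \<I> d"
      using evl_cmp_end[of 1] by (simp add: kronecker_mult mat_assoc)
    finally show ?thesis .
  qed
  ultimately have eq: "(\<I> d \<otimes> f \<otimes> \<I> d) * (cmp_end reg d * comat) = coevm d * f"
    by (simp add: f_def mat_assoc)
  \<comment> \<open>Contracting the dual factor with 1 removes it: the coevaluation becomes the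
    vector of 1, and \<open>evl\<close> inverts \<open>cmp_end reg\<close>.\<close>
  have "(\<I> d \<otimes> f) * comat = uvec * f"
  proof -
    let ?u = "\<I> d \<otimes> uvec\<^sup>T"
    have "?u * ((\<I> d \<otimes> f \<otimes> \<I> d) * (cmp_end reg d * comat)) = (?u * ((\<I> d \<otimes> f) \<otimes> \<I> d)) * (cmp_end reg d * comat)"
      by (simp add: mat_assoc kronecker_assoc)
    also have "?u * ((\<I> d \<otimes> f) \<otimes> \<I> d) = (\<I> d \<otimes> f) * (\<I> (d * d) \<otimes> uvec\<^sup>T)"
      by (rule contract_commute) simp_all
    also have "\<dots> * (cmp_end reg d * comat) = (\<I> d \<otimes> f) * ((evl d * cmp_end reg d) * comat)"
      by (simp add: evl_def mat_assoc mult.assoc)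
    also have "\<dots> = (\<I> d \<otimes> f) * comat" by (simp add: evl_cmp_end)
    finally have "(\<I> d \<otimes> f) * comat = (?u * coevm d) * f"
      unfolding eq by (simp add: mat_assoc)
    then show ?thesis by (simp add: coevm_contract)
  qed
  then have "cointegral c" by (simp add: cointegral_iff_comat[OF c] f_row)
  \<comment> \<open>Normalisation by \<open>c 1\<close>, the scalar that property CU requires to be
    nonzero.\<close>
  then have "cointegral (\<lambda>h. c h / c 1)"
    using c by (simp add: cointegral_def functional_def add_divide_distrib) (simp add: divide_inverse sw_cmult_right mult.assoc[symmetric])
  moreover have "ad_invariant (\<lambda>h. c h / c 1)"
    using ad by (simp add: ad_invariant_def divide_inverse sw_cmult_right mult.assoc)
  ultimately show ?thesis using c1 by (intro that[of "\<lambda>h. c h / c 1"]) simp_all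
qed

theorem cosemisimple_unimodular_iff_property_CU:
  "cosemisimple scale \<Delta> \<and> unimodular_hopf scale \<epsilon> \<longleftrightarrow> property_CU Hmod"
  using cosemisimple_unimodular_iff cointegral_property_CU property_CU_cointegral by metis

end

theorem theorem4p14:
  fixes scale :: "'k::alg_closed_field \<Rightarrow> 'h::ring_1 \<Rightarrow> 'h"
    and \<Delta> :: "'h \<Rightarrow> ('h \<times> 'h \<Rightarrow>\<^sub>0 'k)"
    and \<epsilon> :: "'h \<Rightarrow> 'k"
    and S :: "'h \<Rightarrow> 'h"
  assumes "hopf_algebra scale \<Delta> \<epsilon> S"
    and "finite_dimensional scale"
  shows "cosemisimple scale \<Delta> \<and> unimodular_hopf scale \<epsilon> \<longleftrightarrow>
         property_CU (modules scale \<Delta> \<epsilon> S)"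
proof -
  interpret hopf_algebra scale \<Delta> \<epsilon> S by fact
  obtain A where A: "finite A" "span A = UNIV"
    using assms(2) by (auto simp: finite_dimensional_def)
  obtain B where B: "independent B" "UNIV \<subseteq> span B"
    by (rule maximal_independent_subset[of UNIV])
  have "finite B"
    using independent_span_bound[OF A(1) B(1)] A(2) by simp
  then interpret fd_hopf_algebra scale \<Delta> \<epsilon> S B
    using B by unfold_locales auto
  show ?thesis by (rule cosemisimple_unimodular_iff_property_CU)
qed

end
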